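(* Let $\gamma\ge1$. There exists $\epsilon>0$ such that for all $0<v_+<v_0<\epsilon$ the compressive inflow boundary layer with parameters $(\gamma,v_0,v_+)$ is (spectrally) stable, i.e. its Evans function $D_{\rm in}$ has no zero in $\{\lambda\in\mathbb{C}:\operatorname{Re}\lambda\ge0\}$.
   Context: Parameters: $\gamma\ge1$, $0<v_+<v_0<1$, $a:=v_+^\gamma\frac{1-v_+}{1-v_+^\gamma}$. The compressive inflow boundary layer is the restriction to $x\ge0$ of the (monotone decreasing) solution $\hat v$ on $\mathbb{R}$ of $\hat v'=\hat v\big(\hat v-1+a(\hat v^{-\gamma}-1)\big)$ with $\hat v(0)=v_0$; $\hat v(-\infty)=1$, $\hat v(+\infty)=v_+$. With $h(\hat v)=-\hat v^{\gamma+1}+a(\gamma-1)+(a+1)\hat v^\gamma$, the inflow eigenvalue problem is $$\lambda v+v'-u'=0,\qquad \lambda u+u'-\Big(\tfrac{h(\hat v)}{\hat v^{\gamma+1}}v\Big)'=\Big(\tfrac{u'}{\hat v}\Big)'\quad(x>0),\qquad (v,u)(0)=(0,0),$$ with decay at $+\infty$. Setting $w=\frac{u'}{\hat v}+\frac{h(\hat v)}{\hat v^{\gamma+1}}v-u$ and $W=(w,u-v,v)^T$ it becomes $W'=A(x,\lambda)W$, where, with $f(\hat v)=2\hat v-a(\gamma-1)\hat v^{-\gamma}-(a+1)$, $$A(x,\lambda)=\begin{pmatrix}0&\lambda&\lambda\\0&0&\lambda\\ \hat v&\hat v&f(\hat v)-\lambda\end{pmatrix},\qquad A_+(\lambda)=A(+\infty,\lambda).$$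 For $\operatorname{Re}\lambda\ge0$, $\lambda\ne0$, $-A_+(\lambda)^*$ has exactly one eigenvalue $\tilde\mu_1^+(\lambda)$ of negative real part; it and a (nonzero) eigenvector $\widetilde V_1^+(\lambda)$ can be chosen analytic in $\bar\lambda$ and extend so to $\lambda=0$ with $\widetilde V_1^+(0)\ne0$. $\widetilde W_1^+$ is the solution of $\widetilde W'=-A(x,\lambda)^*\widetilde W$ with $\widetilde W_1^+\sim e^{\tilde\mu_1^+x}\widetilde V_1^+$ as $x\to+\infty$ (extended to $\lambda=0$ by continuity), and $D_{\rm in}(\lambda):=(1,0,0)^T\cdot\widetilde W_1^+(0,\lambda)$, where $x\cdot y=\sum_ix_i\bar y_i$. Zeros of $D_{\rm in}$ do not depend on the choice of $\widetilde V_1^+$. Spectral stability means nonexistence of zeros of $D_{\rm in}$ (which correspond to eigenvalues) with $\operatorname{Re}\lambda\ge0$. *)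

theory Defs
  imports "HOL-Analysis.Analysis"
begin

definition bl_a :: "real \<Rightarrow> real \<Rightarrow> real" where
  "bl_a \<gamma> vp = vp powr \<gamma> * ((1 - vp) / (1 - vp powr \<gamma>))"

text \<open>The profile is kept on the whole line, since its state at minus infinity is part of what
  determines it; the boundary layer is its restriction to x >= 0, and only that restriction
  enters the definitions after this one.\<close>

definition compressive_inflow_profile :: "real \<Rightarrow> real \<Rightarrow> real \<Rightarrow> (real \<Rightarrow> real) \<Rightarrow> bool" where
  "compressive_inflow_profile \<gamma> v0 vp vh \<longleftrightarrow>
     (\<forall>x. (vh has_real_derivative
            vh x * (vh x - 1 + bl_a \<gamma> vp * (vh x powr (- \<gamma>) - 1))) (at x)) \<and>
     antimono vh \<and> vh 0 = v0 \<and>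
     (vh \<longlongrightarrow> 1) at_bot \<and> (vh \<longlongrightarrow> vp) at_top"

definition bl_f :: "real \<Rightarrow> real \<Rightarrow> real \<Rightarrow> real" where
  "bl_f \<gamma> vp v = 2 * v - bl_a \<gamma> vp * (\<gamma> - 1) * v powr (- \<gamma>) - (bl_a \<gamma> vp + 1)"

definition evans_A :: "real \<Rightarrow> real \<Rightarrow> (real \<Rightarrow> real) \<Rightarrow> real \<Rightarrow> complex \<Rightarrow> complex ^ 3 ^ 3" where
  "evans_A \<gamma> vp vh x lam = vector
     [vector [0, lam, lam],
      vector [0, 0, lam],
      vector [of_real (vh x), of_real (vh x), of_real (bl_f \<gamma> vp (vh x)) - lam]]"

definition evans_A_plus :: "real \<Rightarrow> real \<Rightarrow> (real \<Rightarrow> real) \<Rightarrow> complex \<Rightarrow> complex ^ 3 ^ 3" where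
  "evans_A_plus \<gamma> vp vh lam = Lim at_top (\<lambda>x. evans_A \<gamma> vp vh x lam)"

definition conj_transpose :: "complex ^ 'n ^ 'm \<Rightarrow> complex ^ 'm ^ 'n" where
  "conj_transpose M = (\<chi> i j. cnj (M $ j $ i))"

definition herm_dot :: "complex ^ 'n \<Rightarrow> complex ^ 'n \<Rightarrow> complex" where
  "herm_dot x y = (\<Sum>i\<in>UNIV. x $ i * cnj (y $ i))"

text \<open>An admissible choice of \<open>\<mu>\<close>, \<open>V\<close> and the resulting \<open>W\<close>, where \<open>W lam x\<close> is the adjoint
  solution at the point x. Analyticity in the conjugate of \<open>lam\<close> is analyticity of
  \<open>z \<mapsto> \<mu> (cnj z)\<close>; the set Re z >= 0 is invariant under conjugation, and analyticity on it
  (the point 0 included) means holomorphy in a neighbourhood. The relation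
  \<open>W \<sim> exp (\<mu> x) V\<close> is read as \<open>exp (- \<mu> x) W \<longlonglongrightarrow> V\<close>. At \<open>lam = 0\<close>, where the
  spectral gap is lost, \<open>W\<close> is prescribed by continuity only.\<close>

definition inflow_adjoint_mode ::
  "real \<Rightarrow> real \<Rightarrow> (real \<Rightarrow> real) \<Rightarrow> (complex \<Rightarrow> complex) \<Rightarrow> (complex \<Rightarrow> complex ^ 3) \<Rightarrow>
   (complex \<Rightarrow> real \<Rightarrow> complex ^ 3) \<Rightarrow> bool" where
  "inflow_adjoint_mode \<gamma> vp vh \<mu> V W \<longleftrightarrow>
     (\<lambda>z. \<mu> (cnj z)) analytic_on {z. Re z \<ge> 0} \<and>
     (\<forall>i. (\<lambda>z. V (cnj z) $ i) analytic_on {z. Re z \<ge> 0}) \<and>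
     (\<forall>lam. Re lam \<ge> 0 \<longrightarrow> V lam \<noteq> 0) \<and>
     (\<forall>lam. Re lam \<ge> 0 \<and> lam \<noteq> 0 \<longrightarrow>
        Re (\<mu> lam) < 0 \<and>
        (- conj_transpose (evans_A_plus \<gamma> vp vh lam)) *v V lam = \<mu> lam *s V lam \<and>
        (\<forall>x\<ge>0. (W lam has_vector_derivative
                 (- conj_transpose (evans_A \<gamma> vp vh x lam)) *v W lam x) (at x within {0..})) \<and>
        ((\<lambda>x. exp (- \<mu> lam * of_real x) *s W lam x) \<longlongrightarrow> V lam) at_top) \<and>
     (\<forall>x\<ge>0. ((\<lambda>lam. W lam x) \<longlongrightarrow> W 0 x) (at 0 within {lam. Re lam \<ge> 0}))"

definition D_in :: "(complex \<Rightarrow> real \<Rightarrow> complex ^ 3) \<Rightarrow> complex \<Rightarrow> complex" where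
  "D_in W lam = herm_dot (vector [1, 0, 0]) (W lam 0)"

text \<open>The profile is unique, and the zeros of the Evans function do not depend on the admissible
  choice, so both are quantified universally.\<close>

definition inflow_spectrally_stable :: "real \<Rightarrow> real \<Rightarrow> real \<Rightarrow> bool" where
  "inflow_spectrally_stable \<gamma> v0 vp \<longleftrightarrow>
     (\<forall>vh \<mu> V W. compressive_inflow_profile \<gamma> v0 vp vh \<and> inflow_adjoint_mode \<gamma> vp vh \<mu> V W \<longrightarrow>
        (\<forall>lam. Re lam \<ge> 0 \<longrightarrow> D_in W lam \<noteq> 0))"

end

theory Submission
  imports Defs
begin

text \<open>
  With \<open>s = cnj lam\<close>, the unknowns \<open>\<psi> = W\<^sub>1\<close>, \<open>q = (W\<^sub>1 - W\<^sub>2) / s\<close> and \<open>p = - W\<^sub>3 / s\<close> turn the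
  adjoint equation into
    \<open>q' = \<psi>\<close>, \<open>\<psi>' = s vh p\<close>, \<open>p' = (s + N) p + 2 \<psi> - s q\<close>,
  where \<open>N = - f (vh)\<close> lies between \<open>3/4\<close> and \<open>\<gamma> + 1\<close>. For \<open>s \<noteq> 0\<close>, a zero of the Evans function
  is a decaying solution with \<open>\<psi> 0 = 0\<close>. For small \<open>v0\<close> the unknowns \<open>q\<close> and \<open>\<psi>\<close> vary slowly, and \<open>p\<close> is
  slaved to them: to leading order \<open>p = s R q\<close>, where \<open>R\<close> solves \<open>R' = (s + N) R - 1\<close> and satisfies
  \<open>Re (s R) > 0\<close>. Thus approximately \<open>q'' = vh s\<^sup>2 R q\<close>. Multiplying by \<open>cnj q / s\<close> and integrating by
  parts gives
    \<open>Re (1 / s) \<integral> |\<psi>|\<^sup>2 + \<integral> vh Re (s R) |q|\<^sup>2 = - Re (\<psi> 0 * cnj (q 0) / s)\<close>,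
  so \<open>\<psi> 0 = 0\<close> is possible only for the zero solution.

  The proof makes this rigorous with Lyapunov functionals, quadratic forms in the unknowns that
  increase to \<open>0\<close> along a decaying mode and are nonnegative at the boundary when \<open>\<psi> 0 = 0\<close>
  (\<open>lyapunov_rigidity\<close>). For \<open>|s|\<close> above a constant depending on \<open>\<gamma>\<close> there is a simple one
  (\<open>high_frequency_dissipation\<close>). The delicate case is small imaginary \<open>s\<close>, where the coercivity
  \<open>Re (s R)\<close> is only of order \<open>|s|\<^sup>2\<close> and all lower-order contributions have to cancel. They do
  (\<open>low_frequency_dissipation\<close>), since \<open>f\<close> is the derivative of the profile vector field: the
  slope of the profile is then an integrating factor for \<open>N\<close>, so that the zero-frequency response
  \<open>K\<close> of the fast equation and the weight \<open>\<theta>\<close> are explicit, with bounds that are uniform in \<open>vp\<close>.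

  At \<open>lam = 0\<close> the solution is defined as a limit, which may be taken along the positive reals.
  There the mode is real with a fixed sign pattern, and a monotone functional bounds \<open>\<psi> 0\<close> from
  below uniformly in \<open>s\<close> (\<open>real_mode_lower_bound\<close>).
\<close>


section \<open>Young's inequality and monotone quantities on the half-line\<close>

text \<open>Young's inequality in the form in which a cross term with coefficient \<open>c\<close> is charged to two
  dissipation terms: the hypothesis is that the quadratic form \<open>\<alpha> u\<^sup>2 - c u w + \<beta> w\<^sup>2\<close> has
  nonpositive discriminant.\<close>

lemma absorb:
  fixes c u w \<alpha> \<beta> :: real
  assumes "c\<^sup>2 \<le> 4 * \<alpha> * \<beta>" "0 \<le> \<alpha>" "0 \<le> \<beta>"
  shows "c * u * w \<le> \<alpha> * u\<^sup>2 + \<beta> * w\<^sup>2"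
proof -
  have "\<bar>c\<bar> \<le> 2 * sqrt \<alpha> * sqrt \<beta>"
    using assms by (metis (no_types, lifting) real_sqrt_abs real_sqrt_four real_sqrt_le_iff real_sqrt_mult)
  moreover have "2 * (sqrt \<alpha> * \<bar>u\<bar>) * (sqrt \<beta> * \<bar>w\<bar>) \<le> (sqrt \<alpha> * \<bar>u\<bar>)\<^sup>2 + (sqrt \<beta> * \<bar>w\<bar>)\<^sup>2"
    by (rule sum_squares_bound)
  moreover have "c * u * w \<le> \<bar>c\<bar> * (\<bar>u\<bar> * \<bar>w\<bar>)"
    by (metis abs_ge_self abs_mult mult.assoc)
  moreover have "\<bar>c\<bar> * (\<bar>u\<bar> * \<bar>w\<bar>) \<le> (2 * sqrt \<alpha> * sqrt \<beta>) * (\<bar>u\<bar> * \<bar>w\<bar>)"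
    by (rule mult_right_mono) (use calculation in auto)
  ultimately show ?thesis
    using assms by (simp add: power_mult_distrib algebra_simps)
qed

lemma inner_bound: "- (norm a * norm b) \<le> inner a b" "inner a b \<le> norm a * norm b"
  using Cauchy_Schwarz_ineq2[of a b] by (auto simp: abs_le_iff)

lemma inner_mult_left_complex: "inner (a * b) c = inner b (cnj a * c)" for a b c :: complex
  by (simp add: inner_complex_def algebra_simps)

lemma has_real_derivative_inner:
  fixes a b :: "real \<Rightarrow> 'a::real_inner"
  assumes "(a has_vector_derivative a') (at x within S)" "(b has_vector_derivative b') (at x within S)"
  shows "((\<lambda>x. inner (a x) (b x)) has_real_derivative inner (a x) b' + inner a' (b x)) (at x within S)"
  unfolding has_real_derivative_iff_has_vector_derivative
  by (rule bounded_bilinear.has_vector_derivative[OF bounded_bilinear_inner assms])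

lemma nondecreasing_interval:
  fixes E D :: "real \<Rightarrow> real"
  assumes "\<And>x. x \<ge> 0 \<Longrightarrow> (E has_real_derivative D x) (at x within {0..})"
    and "\<And>z. x < z \<Longrightarrow> z < y \<Longrightarrow> D z \<ge> 0" and "0 \<le> x" "x \<le> y"
  shows "E x \<le> E y"
proof (rule DERIV_nonneg_imp_increasing_open[of x y E])
  show "x \<le> y" by fact
  show "\<exists>d. DERIV E z :> d \<and> 0 \<le> d" if "x < z" "z < y" for z
  proof -
    have "at z within {0..} = at z"
      by (rule at_within_interior) (use that assms in auto)
    then show ?thesis using assms(1)[of z] assms(2)[of z] that assms(3) by auto
  qed
  show "continuous_on {x..y} E"
    by (rule DERIV_continuous_on[of _ E D]) (use assms(3) in \<open>auto intro: DERIV_subset[OF assms(1)]\<close>)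
qed

lemma nondecreasing_halfline:
  fixes E D :: "real \<Rightarrow> real"
  assumes "\<And>x. x \<ge> 0 \<Longrightarrow> (E has_real_derivative D x) (at x within {0..})"
    and "\<And>x. x \<ge> 0 \<Longrightarrow> D x \<ge> 0" and "0 \<le> x" "x \<le> y"
  shows "E x \<le> E y"
  by (rule nondecreasing_interval[OF assms(1)]) (use assms in auto)

lemma nondecreasing_to_zero:
  fixes E D :: "real \<Rightarrow> real"
  assumes "\<And>x. x \<ge> 0 \<Longrightarrow> (E has_real_derivative D x) (at x within {0..})"
    and "\<And>x. x \<ge> 0 \<Longrightarrow> D x \<ge> 0" and "(E \<longlongrightarrow> 0) at_top" and "x \<ge> 0"
  shows "E x \<le> 0"
proof (rule tendsto_lowerbound[OF assms(3)])
  show "\<forall>\<^sub>F y in at_top. E x \<le> E y"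
    using eventually_ge_at_top[of x] by eventually_elim (rule nondecreasing_halfline[OF assms(1,2)], use assms(4) in auto)
qed simp

text \<open>The only use made of a Lyapunov functional below. Since \<open>E\<close> increases to its limit \<open>0\<close>, it is
  nonpositive; if it is nonnegative at the boundary it must be constant, so its dissipation rate
  vanishes.\<close>

lemma lyapunov_rigidity:
  fixes E D :: "real \<Rightarrow> real"
  assumes "\<And>x. x \<ge> 0 \<Longrightarrow> (E has_real_derivative D x) (at x within {0..})"
    and "\<And>x. x \<ge> 0 \<Longrightarrow> D x \<ge> 0" and "(E \<longlongrightarrow> 0) at_top" and "E 0 \<ge> 0" and "x > 0"
  shows "D x = 0"
proof -
  have "E y = 0" if "y \<ge> 0" for y
    using nondecreasing_to_zero[OF assms(1-3) that] nondecreasing_halfline[OF assms(1,2), of 0 y] assms(4) that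
    by auto
  moreover have "at x within {0..} = at x"
    by (rule at_within_interior) (use assms in auto)
  ultimately have "((\<lambda>_. 0) has_real_derivative D x) (at x)"
    using assms(1)[of x] assms(5)
    by (metis (no_types, lifting) greaterThan_iff has_field_derivative_transform_within_open less_eq_real_def open_greaterThan)
  then show ?thesis using DERIV_unique DERIV_const by blast
qed

section \<open>The boundary layer and its linearization\<close>

text \<open>The bound \<open>1/8\<close> on the boundary value makes \<open>- bl_f\<close>, the growth rate of the fast unknown, at
  least \<open>3/4\<close> along the layer. A square of the fast unknown then grows faster than the weight
  \<open>vh\<close> decays, as the relative decay rate of the profile is at most \<open>1\<close>.\<close>

locale inflow_layer =
  fixes \<gamma> vp v0 :: real and vh :: "real \<Rightarrow> real"
  assumes gamma_ge: "\<gamma> \<ge> 1" and vp_pos: "0 < vp" and vp_less: "vp < v0" and v0_le: "v0 \<le> 1/8"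
    and profile: "compressive_inflow_profile \<gamma> v0 vp vh"
begin

abbreviation "a \<equiv> bl_a \<gamma> vp"

definition speed :: "real \<Rightarrow> real" where
  "speed v = v * (v - 1 + a * (v powr (- \<gamma>) - 1))"

definition rate :: "real \<Rightarrow> real" where
  "rate v = - bl_f \<gamma> vp v"

definition C :: real where
  "C = \<gamma> + 1"

lemma C_ge: "C \<ge> 2"
  using gamma_ge by (simp add: C_def)

lemma vh_deriv: "(vh has_real_derivative speed (vh x)) (at x within S)"
  using profile unfolding compressive_inflow_profile_def speed_def
  by (meson has_field_derivative_at_within)

lemma vp_powr: "0 < vp powr \<gamma>" "vp powr \<gamma> \<le> vp" "vp powr \<gamma> < 1"
proof -
  show "0 < vp powr \<gamma>" using vp_pos by simp
  have "vp powr \<gamma> \<le> vp powr 1"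
    by (rule powr_mono') (use gamma_ge vp_pos vp_less v0_le in auto)
  then show "vp powr \<gamma> \<le> vp" using vp_pos by simp
  then show "vp powr \<gamma> < 1" using vp_less v0_le by simp
qed

lemma a_vp: "a * vp powr (- \<gamma>) = (1 - vp) / (1 - vp powr \<gamma>)"
  using vp_powr by (simp add: bl_a_def powr_minus field_simps)

lemma a_bounds: "0 < a" "a \<le> vp" "a * vp powr (- \<gamma>) \<le> 1"
proof -
  have q: "0 < (1 - vp) / (1 - vp powr \<gamma>)" "(1 - vp) / (1 - vp powr \<gamma>) \<le> 1"
    using vp_powr vp_less v0_le by auto
  show "a * vp powr (- \<gamma>) \<le> 1" using a_vp q by simp
  show "0 < a" unfolding bl_a_def by (rule mult_pos_pos[OF vp_powr(1) q(1)])
  have "a \<le> vp powr \<gamma> * 1"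
    unfolding bl_a_def by (rule mult_left_mono) (use q vp_powr in auto)
  then show "a \<le> vp" using vp_powr by simp
qed

lemma speed_vp: "speed vp = 0"
proof -
  have "a * (vp powr (- \<gamma>) - 1) = 1 - vp"
    using a_vp vp_powr by (simp add: algebra_simps bl_a_def) (simp add: field_simps)
  then show ?thesis by (simp add: speed_def)
qed

lemma a_powr_bounds:
  assumes "vp \<le> v" "v \<le> v0"
  shows "a \<le> a * v powr (- \<gamma>)" "a * v powr (- \<gamma>) \<le> 1"
proof -
  have "1 powr (- \<gamma>) \<le> v powr (- \<gamma>)"
    by (rule powr_mono2') (use assms gamma_ge vp_pos v0_le in auto)
  then show "a \<le> a * v powr (- \<gamma>)" using a_bounds by simp
  have "v powr (- \<gamma>) \<le> vp powr (- \<gamma>)"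
    by (rule powr_mono2') (use assms gamma_ge vp_pos v0_le in auto)
  then have "a * v powr (- \<gamma>) \<le> a * vp powr (- \<gamma>)" using a_bounds by simp
  then show "a * v powr (- \<gamma>) \<le> 1" using a_bounds(3) by linarith
qed

lemma rate_eq: "rate v = 1 + a + (\<gamma> - 1) * (a * v powr (- \<gamma>)) - 2 * v"
  by (simp add: rate_def bl_f_def algebra_simps)

lemma rate_bounds:
  assumes "vp \<le> v" "v \<le> v0"
  shows "3/4 \<le> rate v" "rate v \<le> C"
proof -
  have "0 \<le> (\<gamma> - 1) * (a * v powr (- \<gamma>))"
    using a_bounds gamma_ge by simp
  moreover have "(\<gamma> - 1) * (a * v powr (- \<gamma>)) \<le> (\<gamma> - 1) * 1"
    by (rule mult_left_mono[OF a_powr_bounds(2)[OF assms]]) (use gamma_ge in simp)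
  ultimately show "3/4 \<le> rate v" "rate v \<le> C"
    unfolding rate_eq C_def using a_bounds assms v0_le by auto
qed

lemma rate_antimono:
  assumes "vp \<le> v"
  shows "rate v \<le> rate vp"
proof -
  have "v powr (- \<gamma>) \<le> vp powr (- \<gamma>)"
    by (rule powr_mono2') (use assms gamma_ge vp_pos in auto)
  then have "(\<gamma> - 1) * (a * v powr (- \<gamma>)) \<le> (\<gamma> - 1) * (a * vp powr (- \<gamma>))"
    using a_bounds gamma_ge by (intro mult_left_mono) auto
  then show ?thesis unfolding rate_eq using assms by simp
qed

text \<open>The function \<open>f\<close> of the eigenvalue problem is the derivative of the profile vector field. Hence
  the slope of the profile solves the linearized equation with coefficient \<open>f\<close>, and every
  first-order equation with this coefficient can be integrated explicitly.\<close>

lemma speed_deriv: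
  assumes "v > 0"
  shows "(speed has_real_derivative - rate v) (at v within S)"
  unfolding speed_def[abs_def] rate_eq using assms
  by (auto intro!: derivative_eq_intros simp: algebra_simps powr_diff powr_minus power2_eq_square field_simps)

lemma profile_range:
  assumes "x \<ge> 0"
  shows "vp \<le> vh x" "vh x \<le> v0" "0 < vh x"
proof -
  have am: "antimono vh" and v00: "vh 0 = v0" and lim: "(vh \<longlongrightarrow> vp) at_top"
    using profile by (auto simp: compressive_inflow_profile_def)
  show "vh x \<le> v0" using antimonoD[OF am assms] v00 by simp
  show "vp \<le> vh x"
  proof (rule tendsto_upperbound[OF lim])
    show "\<forall>\<^sub>F y in at_top. vh y \<le> vh x"
      using eventually_ge_at_top[of x] by eventually_elim (rule antimonoD[OF am])
  qed simp
  then show "0 < vh x" using vp_pos by simp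
qed

lemma profile_limit: "(vh \<longlongrightarrow> vp) at_top" and profile_0: "vh 0 = v0"
  using profile by (auto simp: compressive_inflow_profile_def)

lemma speed_mean_value:
  assumes "vp \<le> v" "v \<le> v0"
  shows "3/4 * (v - vp) \<le> - speed v" "- speed v \<le> C * (v - vp)"
proof -
  have "3/4 * (v - vp) \<le> - speed v \<and> - speed v \<le> C * (v - vp)"
  proof (cases "v = vp")
    case True then show ?thesis using speed_vp by simp
  next
    case False
    then have lt: "vp < v" using assms by simp
    have "\<exists>z. vp < z \<and> z < v \<and> speed v - speed vp = (v - vp) * - rate z"
      by (rule MVT2[OF lt]) (use vp_pos in \<open>auto intro!: speed_deriv\<close>)
    then obtain z where z: "vp < z" "z < v" "speed v - speed vp = (v - vp) * - rate z" by blast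
    have "3/4 \<le> rate z" "rate z \<le> C" using rate_bounds[of z] z assms by auto
    then have "(v - vp) * (3/4) \<le> (v - vp) * rate z" "(v - vp) * rate z \<le> (v - vp) * C"
      using lt by (intro mult_left_mono; simp)+
    moreover have "- speed v = (v - vp) * rate z" using z(3) speed_vp by simp
    ultimately show ?thesis by (simp only: mult.commute[of _ "v - vp"])
  qed
  then show "3/4 * (v - vp) \<le> - speed v" "- speed v \<le> C * (v - vp)" by auto
qed

definition gap :: "real \<Rightarrow> real" where "gap x = vh x - vp"
definition slope :: "real \<Rightarrow> real" where "slope x = - speed (vh x)"
definition N :: "real \<Rightarrow> real" where "N x = rate (vh x)"

lemma N_bounds:
  assumes "x \<ge> 0"
  shows "3/4 \<le> N x" "N x \<le> C" "N x \<le> rate vp"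
  using rate_bounds[of "vh x"] rate_antimono[of "vh x"] profile_range[OF assms] by (auto simp: N_def)

lemma gap_deriv: "(gap has_real_derivative - slope x) (at x within S)"
  unfolding gap_def[abs_def] slope_def using DERIV_diff[OF vh_deriv DERIV_const] by simp

lemma vh_deriv_slope: "(vh has_real_derivative - slope x) (at x within S)"
  unfolding slope_def using vh_deriv by simp

lemma slope_deriv:
  assumes "x \<ge> 0"
  shows "(slope has_real_derivative - N x * slope x) (at x within S)"
proof -
  have "((\<lambda>x. speed (vh x)) has_real_derivative (- rate (vh x)) * speed (vh x)) (at x within S)"
    by (rule DERIV_chain2[OF speed_deriv vh_deriv]) (use profile_range[OF assms] in simp)
  from DERIV_minus[OF this] show ?thesis
    unfolding slope_def[abs_def] N_def by simp
qed

lemma slope_bounds: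
  assumes "x \<ge> 0"
  shows "3/4 * gap x \<le> slope x" "slope x \<le> C * gap x"
  using speed_mean_value[of "vh x"] profile_range[OF assms] by (auto simp: gap_def slope_def)

lemma slope_le_vh:
  assumes "x \<ge> 0"
  shows "slope x \<le> vh x"
proof -
  have "a * (vh x powr (- \<gamma>) - 1) \<ge> 0"
    using a_powr_bounds[of "vh x"] profile_range[OF assms] by (simp add: algebra_simps)
  then have "vh x * (- 1) \<le> vh x * (vh x - 1 + a * (vh x powr (- \<gamma>) - 1))"
    using profile_range[OF assms] by (intro mult_left_mono) auto
  then show ?thesis by (simp add: slope_def speed_def)
qed

text \<open>Gronwall: the distance to the end state decays at most at rate \<open>C\<close>, so it never vanishes.\<close>

lemma gap_pos:
  assumes "x \<ge> 0"
  shows "0 < gap x"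
proof -
  have "gap 0 * exp (C * 0) \<le> gap x * exp (C * x)"
  proof (rule nondecreasing_halfline[where E = "\<lambda>x. gap x * exp (C * x)"])
    fix y :: real assume "y \<ge> 0"
    show "((\<lambda>x. gap x * exp (C * x)) has_real_derivative (C * gap y - slope y) * exp (C * y)) (at y within {0..})"
      by (auto intro!: derivative_eq_intros gap_deriv simp: algebra_simps)
    show "0 \<le> (C * gap y - slope y) * exp (C * y)"
      using slope_bounds[OF \<open>y \<ge> 0\<close>] by simp
  qed (use assms in auto)
  then have "0 < gap x * exp (C * x)"
    using vp_less profile_0 by (simp add: gap_def)
  then show ?thesis by (simp add: zero_less_mult_iff)
qed

lemma slope_pos: "x \<ge> 0 \<Longrightarrow> 0 < slope x"
  using slope_bounds(1)[of x] gap_pos[of x] by simp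

lemma slope_nonzero: "x \<ge> 0 \<Longrightarrow> slope x \<noteq> 0"
  using slope_pos[of x] by simp

lemma gap_le: "x \<ge> 0 \<Longrightarrow> gap x \<le> vh x"
  using vp_pos by (simp add: gap_def)

text \<open>The bounded solution of \<open>K' = N K - 1\<close>, that is \<open>\<integral> exp (- \<integral> N)\<close> over \<open>[x, \<infinity>)\<close>. Because the
  slope is an integrating factor, the integral is this quotient. It is the response of the fast
  unknown to constant forcing at zero frequency.\<close>

definition K :: "real \<Rightarrow> real" where "K x = gap x / slope x"

lemma K_bounds:
  assumes "x \<ge> 0"
  shows "0 \<le> K x" "K x \<le> 2"
  using slope_bounds[OF assms] slope_pos[OF assms] gap_pos[OF assms] by (auto simp: K_def field_simps)

lemma K_deriv:
  assumes "x \<ge> 0"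
  shows "(K has_real_derivative N x * K x - 1) (at x within S)"
  unfolding K_def[abs_def] using slope_pos[OF assms]
  by (auto intro!: derivative_eq_intros gap_deriv slope_deriv[OF assms] simp: field_simps power2_eq_square)

text \<open>The limit of \<open>vh x * K x\<close> at the end state.\<close>

definition k_inf :: real where "k_inf = vp / rate vp"

lemma k_inf_nonneg: "0 \<le> k_inf"
  using rate_bounds[of vp] vp_pos vp_less by (simp add: k_inf_def)

text \<open>What matters is that the constant in front of the gap does not depend on \<open>vp\<close>. Where \<open>vh\<close> is at
  least twice \<open>vp\<close>, both terms are bounded by multiples of the gap. Closer to the end state
  \<open>vh * K\<close> is the reciprocal of a mean value of \<open>D'\<close>, and the second derivative of \<open>D\<close>, of order
  \<open>vp\<^sup>-\<^sup>2\<close>, is compensated by two factors of order \<open>vp\<close>.\<close>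

lemma vK_near_limit:
  assumes "x \<ge> 0"
  shows "\<bar>vh x * K x - k_inf\<bar> \<le> 8 * C\<^sup>2 * gap x"
proof (cases "vh x \<ge> 2 * vp")
  case True
  have "vh x * K x \<le> vh x * 2" "0 \<le> vh x * K x"
    using K_bounds[OF assms] profile_range[OF assms] by (auto intro: mult_left_mono)
  moreover have "k_inf \<le> 2 * vp"
    using rate_bounds[of vp] vp_pos vp_less by (auto simp: k_inf_def field_simps)
  moreover have "vh x \<le> 2 * gap x" "vp \<le> gap x" using True by (auto simp: gap_def)
  moreover have "4 * gap x \<le> 8 * C\<^sup>2 * gap x"
    using power_mono[OF C_ge, of 2] gap_pos[OF assms] by (intro mult_right_mono) auto
  ultimately show ?thesis using k_inf_nonneg by linarith
next
  case False
  define D where "D = (\<lambda>v. 1 + a - v - a * v powr (- \<gamma>))"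
  define D' where "D' = (\<lambda>v. \<gamma> * a * v powr (- \<gamma> - 1) - 1)"
  have speedD: "speed v = - (v * D v)" for v by (simp add: speed_def D_def algebra_simps)
  have der: "(D has_real_derivative D' v) (at v)" if "v > 0" for v
    unfolding D_def D'_def using that by (auto intro!: derivative_eq_intros simp: powr_diff)
  have lt: "vp < vh x" using gap_pos[OF assms] by (simp add: gap_def)
  have "\<exists>z. vp < z \<and> z < vh x \<and> D (vh x) - D vp = (vh x - vp) * D' z"
    by (rule MVT2[OF lt]) (use vp_pos in \<open>auto intro!: der\<close>)
  then obtain z where z: "vp < z" "z < vh x" "D (vh x) - D vp = (vh x - vp) * D' z" by blast
  have Dvp: "D vp = 0" using speedD[of vp] speed_vp vp_pos by simp
  have rvp: "rate vp = vp * D' vp"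
  proof -
    have "1 + a - vp - a * vp powr (- \<gamma>) = 0" using Dvp by (simp add: D_def)
    moreover have "vp * vp powr (- \<gamma> - 1) = vp powr (- \<gamma>)"
      using vp_pos by (simp add: powr_diff)
    ultimately show ?thesis by (simp add: rate_eq D'_def algebra_simps)
  qed
  have kinf: "k_inf = 1 / D' vp" using rvp vp_pos by (simp add: k_inf_def)
  have vK: "vh x * K x * D' z = 1"
  proof -
    have "slope x = vh x * (gap x * D' z)" using z(3) Dvp by (simp add: slope_def speedD gap_def)
    moreover have "D' z \<noteq> 0" using calculation slope_pos[OF assms] by auto
    ultimately show ?thesis using gap_pos[OF assms] profile_range(3)[OF assms] by (simp add: K_def)
  qed
  have "\<exists>y. vp < y \<and> y < z \<and> D' z - D' vp = (z - vp) * (\<gamma> * a * ((- \<gamma> - 1) * y powr (- \<gamma> - 1 - 1)))"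
    unfolding D'_def by (rule MVT2[OF z(1)]) (use vp_pos in \<open>auto intro!: derivative_eq_intros\<close>)
  then obtain y where y: "vp < y" "y < z" "D' z - D' vp = (z - vp) * (\<gamma> * a * ((- \<gamma> - 1) * y powr (- \<gamma> - 1 - 1)))" by blast
  have ypos: "y > 0" using y vp_pos by simp
  have yp: "a * y powr (- \<gamma> - 1 - 1) \<le> 1 / vp\<^sup>2"
  proof -
    have "y powr (- \<gamma> - 1 - 1) \<le> vp powr (- \<gamma> - 1 - 1)"
      by (rule powr_mono2') (use y gamma_ge vp_pos in auto)
    then have "a * y powr (- \<gamma> - 1 - 1) \<le> a * vp powr (- \<gamma> - 1 - 1)" using a_bounds by simp
    also have "\<dots> = (a * vp powr (- \<gamma>)) / vp\<^sup>2"       using vp_pos powr_add[of vp "- 2" "- \<gamma>"] by (simp add: powr_minus divide_inverse)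
    also have "\<dots> \<le> 1 / vp\<^sup>2" by (rule divide_right_mono) (use a_bounds in auto)
    finally show ?thesis .
  qed
  have diff: "0 \<le> D' vp - D' z" "D' vp - D' z \<le> gap x * (C\<^sup>2 / vp\<^sup>2)"
  proof -
    have eq: "D' vp - D' z = (z - vp) * (\<gamma> * (\<gamma> + 1) * (a * y powr (- \<gamma> - 1 - 1)))"
      using y(3) by (simp add: algebra_simps)
    show "0 \<le> D' vp - D' z" unfolding eq using z(1) gamma_ge a_bounds(1) by (intro mult_nonneg_nonneg) auto
    have "\<gamma> * (\<gamma> + 1) * (a * y powr (- \<gamma> - 1 - 1)) \<le> C\<^sup>2 * (1 / vp\<^sup>2)"
      by (rule mult_mono[OF _ yp]) (use gamma_ge a_bounds in \<open>auto simp: C_def power2_eq_square intro!: mult_right_mono\<close>)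
    then show "D' vp - D' z \<le> gap x * (C\<^sup>2 / vp\<^sup>2)"
      unfolding eq using z gamma_ge a_bounds by (intro mult_mono) (auto simp: gap_def)
  qed
  have Dz: "0 < D' z" using vK K_bounds(1)[OF assms] profile_range(3)[OF assms]
    by (metis less_eq_real_def mult_nonneg_nonneg mult_nonneg_nonpos not_less zero_less_one zero_less_mult_iff)
  have Dvp_pos: "0 < D' vp" using Dz diff by simp
  have A: "vh x * K x - k_inf = (D' vp - D' z) * (vh x * K x) * k_inf"
    using vK Dvp_pos by (simp add: kinf field_simps)
  have "vh x * K x \<le> vh x * 2"
    using K_bounds[OF assms] profile_range[OF assms] by (intro mult_left_mono) auto
  then have B1: "vh x * K x \<le> 4 * vp"
    using False by linarith
  have B1': "0 \<le> vh x * K x"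
    using K_bounds[OF assms] profile_range[OF assms] by auto
  have B2: "k_inf \<le> 2 * vp"
    using rate_bounds[of vp] vp_pos vp_less by (auto simp: k_inf_def field_simps)
  have "(D' vp - D' z) * (vh x * K x) * k_inf \<le> (gap x * (C\<^sup>2 / vp\<^sup>2)) * (4 * vp) * (2 * vp)"
    by (intro mult_mono diff B1 B1' B2 mult_nonneg_nonneg k_inf_nonneg) (use vp_pos gap_pos[OF assms] in auto)
  also have "\<dots> = 8 * C\<^sup>2 * gap x" using vp_pos by (simp add: power2_eq_square)
  finally have "(D' vp - D' z) * (vh x * K x) * k_inf \<le> 8 * C\<^sup>2 * gap x" .
  moreover have "0 \<le> (D' vp - D' z) * (vh x * K x) * k_inf"
    by (intro mult_nonneg_nonneg diff B1' k_inf_nonneg)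
  ultimately show ?thesis unfolding A by simp
qed

text \<open>Variation of constants for \<open>\<theta>' + N \<theta> = vh / 2\<close>, \<open>\<theta> 0 = 0\<close>. As a weight in the low-frequency
  functional it cancels the indefinite term \<open>vh * Re (y * cnj q)\<close>; vanishing at the boundary, it
  contributes nothing there.\<close>

definition \<theta> :: "real \<Rightarrow> real" where
  "\<theta> x = slope x * integral {0..x} (\<lambda>t. vh t / (2 * slope t))"

lemma continuous_on_profile:
  "continuous_on {0..} vh" "continuous_on {0..} slope"
  by (rule DERIV_continuous_on, rule vh_deriv, rule DERIV_continuous_on, rule slope_deriv) auto

lemma theta_0: "\<theta> 0 = 0"
  by (simp add: \<theta>_def)

lemma theta_deriv:
  assumes "x \<ge> 0"
  shows "(\<theta> has_real_derivative vh x / 2 - N x * \<theta> x) (at x within {0..})"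
proof -
  have cont: "continuous_on {0..} (\<lambda>t. vh t / (2 * slope t))"
    using continuous_on_profile slope_nonzero by (intro continuous_intros) auto
  have "((\<lambda>x. integral {0..x} (\<lambda>t. vh t / (2 * slope t))) has_real_derivative vh x / (2 * slope x)) (at x within {0..x+1})"
    by (rule integral_has_real_derivative) (use assms in \<open>auto intro: continuous_on_subset[OF cont]\<close>)
  moreover have "at x within {0..x+1} = at x within {0..}"
    by (rule at_within_nhd[of _ "{..<x+1}"]) auto
  ultimately have I: "((\<lambda>x. integral {0..x} (\<lambda>t. vh t / (2 * slope t))) has_real_derivative vh x / (2 * slope x)) (at x within {0..})"
    by simp
  show ?thesis
    unfolding \<theta>_def[abs_def]
    by (rule DERIV_cong[OF DERIV_mult'[OF slope_deriv[OF assms] I]])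
      (use slope_pos[OF assms] in \<open>simp add: field_simps\<close>)
qed

text \<open>The function \<open>4 sqrt (v0 vh)\<close> is a supersolution: its relative decay rate is at most \<open>1/2\<close>, less
  than \<open>N\<close>. A bound by a multiple of \<open>vh\<close> itself would fail by a logarithm of \<open>v0 / vp\<close>, because
  away from the end state \<open>vh\<close> decays nearly at the rate \<open>N\<close>.\<close>

lemma theta_bounds:
  assumes "x \<ge> 0"
  shows "0 \<le> \<theta> x" "\<theta> x \<le> 4 * v0" "(\<theta> x)\<^sup>2 \<le> 16 * v0 * vh x"
proof -
  show nn: "0 \<le> \<theta> x"
    unfolding \<theta>_def
    by (intro mult_nonneg_nonneg integral_nonneg integrable_continuous_interval continuous_intros continuous_on_subset[OF continuous_on_profile(1)] continuous_on_subset[OF continuous_on_profile(2)])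
      (use assms slope_pos slope_nonzero profile_range(3) in \<open>auto simp: less_imp_le\<close>)
  have v0: "v0 > 0" using vp_pos vp_less by simp
  define T where "T = (\<lambda>x. 4 * sqrt (v0 * vh x) - \<theta> x)"
  have Td: "(T has_real_derivative 2 * v0 * (- slope y) / sqrt (v0 * vh y) - (vh y / 2 - N y * \<theta> y)) (at y within {0..})"
    if y: "y \<ge> 0" for y
  proof -
    have "((\<lambda>x. sqrt (v0 * vh x)) has_real_derivative inverse (sqrt (v0 * vh y)) / 2 * (v0 * (- slope y))) (at y within {0..})"
      by (rule DERIV_chain2[OF DERIV_real_sqrt DERIV_cmult[OF vh_deriv_slope]])
        (use v0 profile_range(3)[OF y] in simp)
    from DERIV_diff[OF DERIV_cmult[OF this, of 4] theta_deriv[OF y]] show ?thesis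
      unfolding T_def by (simp add: field_simps)
  qed
  \<comment> \<open>The slope solves the homogeneous equation, so the comparison is monotonicity of a quotient.\<close>
  have "T 0 / slope 0 \<le> T x / slope x"
  proof (rule nondecreasing_halfline[where E = "\<lambda>x. T x / slope x"])
    fix y :: real assume y: "y \<ge> 0"
    let ?r = "sqrt (v0 * vh y)"
    let ?D = "2 * v0 * (- slope y) / ?r - (vh y / 2 - N y * \<theta> y)"
    show "((\<lambda>x. T x / slope x) has_real_derivative (?D + N y * T y) / slope y) (at y within {0..})"
      by (rule DERIV_cong[OF DERIV_divide[OF Td[OF y] slope_deriv[OF y]]])
        (use slope_pos[OF y] in \<open>auto simp: field_simps power2_eq_square\<close>)
    have r: "?r > 0" "?r\<^sup>2 = v0 * vh y" using v0 profile_range(3)[OF y] by auto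
    have "vh y * vh y \<le> v0 * vh y"
      using profile_range[OF y] by (intro mult_right_mono) auto
    then have rv: "vh y \<le> ?r" by (intro real_le_rsqrt) (simp add: power2_eq_square)
    have "v0 * slope y \<le> v0 * vh y" using slope_le_vh[OF y] v0 by simp
    then have "2 * v0 * slope y / ?r \<le> 2 * ?r"
      using r by (simp add: divide_le_eq power2_eq_square mult.assoc)
    moreover have "(3/4) * (4 * ?r) \<le> N y * (4 * ?r)"
      using N_bounds[OF y] r by (intro mult_right_mono) auto
    moreover have "?D + N y * T y = N y * (4 * ?r) - 2 * v0 * slope y / ?r - vh y / 2"
      unfolding T_def by (simp add: algebra_simps)
    moreover have "0 \<le> n * (4 * w) - X - u / 2"
      if "X \<le> 2 * w" "(3/4) * (4 * w) \<le> n * (4 * w)" "u \<le> w" "0 < w" for X w n u :: real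
      using that by linarith
    ultimately have "0 \<le> ?D + N y * T y" using rv r(1) by metis
    then show "0 \<le> (?D + N y * T y) / slope y" using slope_pos[OF y] by simp
  qed (use assms in auto)
  moreover have "0 \<le> T 0 / slope 0"
    using theta_0 slope_pos[of 0] v0 profile_0 by (simp add: T_def)
  ultimately have "0 \<le> T x" using slope_pos[OF assms] by (smt (verit) divide_neg_pos)
  then have up: "\<theta> x \<le> 4 * sqrt (v0 * vh x)" by (simp add: T_def)
  have "(\<theta> x)\<^sup>2 \<le> (4 * sqrt (v0 * vh x))\<^sup>2" by (rule power_mono[OF up nn])
  also have "\<dots> = 16 * v0 * vh x" using v0 profile_range(3)[OF assms] by (simp add: power_mult_distrib)
  finally show sq: "(\<theta> x)\<^sup>2 \<le> 16 * v0 * vh x" .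
  have "sqrt (v0 * vh x) \<le> sqrt (v0 * v0)"
    using v0 profile_range[OF assms] by (intro real_sqrt_le_mono mult_left_mono) auto
  then show "\<theta> x \<le> 4 * v0" using up v0 by simp
qed

end

section \<open>High frequencies\<close>

context inflow_layer
begin

text \<open>The adjoint system \<open>W' = - A\<^sup>* W\<close> for \<open>\<psi> = W\<^sub>1\<close>, \<open>q = (W\<^sub>1 - W\<^sub>2) / s\<close>, \<open>p = - W\<^sub>3 / s\<close> with
  \<open>s = cnj lam\<close>. In these unknowns \<open>q\<close> and \<open>\<psi>\<close> are slow, since \<open>vh\<close> is small, and \<open>p\<close> is
  fast.\<close>

definition decaying_mode :: "complex \<Rightarrow> (real \<Rightarrow> complex) \<Rightarrow> (real \<Rightarrow> complex) \<Rightarrow> (real \<Rightarrow> complex) \<Rightarrow> bool" where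
  "decaying_mode s q \<psi> p \<longleftrightarrow>
     (\<forall>x\<ge>0. (q has_vector_derivative \<psi> x) (at x within {0..}) \<and>
            (\<psi> has_vector_derivative vh x *\<^sub>R (s * p x)) (at x within {0..}) \<and>
            (p has_vector_derivative s * p x + N x *\<^sub>R p x + 2 *\<^sub>R \<psi> x - s * q x) (at x within {0..})) \<and>
     (q \<longlongrightarrow> 0) at_top \<and> (\<psi> \<longlongrightarrow> 0) at_top \<and> (p \<longlongrightarrow> 0) at_top"

end

text \<open>The error terms of the high-frequency estimate, each paired with the dissipation of its two
  factors. The terms in \<open>\<Psi>\<close> carry a factor \<open>r\<close>, the reciprocal of the frequency, because the
  dissipation in \<open>\<Psi>\<close> is itself only of order \<open>r\<close>.\<close>

lemma high_frequency_absorption: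
  fixes Q H \<Psi> v r \<beta> C :: real
  assumes C: "C \<ge> 2" and \<beta>: "\<beta> = 1 / (256 * C\<^sup>2)" and r: "0 < r" "r \<le> \<beta>" and v: "0 < v" "2400 * v \<le> \<beta>"
    and nn: "0 \<le> Q" "0 \<le> H" "0 \<le> \<Psi>"
  shows "v * Q\<^sup>2 / 4 + \<beta> * v * H\<^sup>2 / 32 + \<beta> / 32 * r * \<Psi>\<^sup>2
     \<le> v * Q\<^sup>2 + \<beta> / 16 * r * \<Psi>\<^sup>2 + \<beta> / 4 * v * H\<^sup>2
       - v * (r * \<Psi> * Q + \<beta> / 16 * ((H + Q + r * \<Psi>) * Q) + 5 / 4 * (r * (r / \<beta>)) * Q\<^sup>2
              + 2 * \<beta> * (C * Q * H + C * H * (r * \<Psi>) + v * (H * (H + Q + r * \<Psi>)))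
              + r * (C * H * Q + C * Q\<^sup>2 + C * r * \<Psi> * Q + v * (H + Q + r * \<Psi>) * Q)
              + r * H * \<Psi> + 1 / 2 * (r / \<beta>) * (r * Q * \<Psi>))"
proof -
  have C2: "C\<^sup>2 \<ge> 4" using power_mono[OF C, of 2] by simp
  have b: "0 < \<beta>" "\<beta> * C\<^sup>2 = 1/256" using C2 by (auto simp: \<beta>)
  have b': "\<beta> \<le> 1/1024" unfolding \<beta> using C2 frac_le[of 1 1 1024 "256 * C\<^sup>2"] by simp
  note b = b(1) b' b(2)
  have bC: "\<beta> * C \<le> 1/512"
  proof -
    have "\<beta> * C * 2 \<le> \<beta> * C * C" using b C by (intro mult_left_mono) auto
    then show ?thesis using b(3) by (simp add: power2_eq_square)
  qed
  have rb: "0 \<le> r / \<beta>" "r / \<beta> \<le> 1" using r b by auto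
  have rC: "r * C \<le> \<beta> * C" using r C by (intro mult_right_mono) auto
  have v1: "v \<le> 1" using v b by simp
  have rv: "r * v \<le> \<beta>" "v * r \<le> \<beta>" using mult_mono[OF r(2) v1] r v b by (auto simp: mult.commute)
  have bv: "\<beta> * v \<le> \<beta>" using b v1 by (simp add: mult_le_cancel_left1)
  \<comment> \<open>The error is a quadratic form in Q, H and r * \<Psi>; first its coefficients.\<close>
  have cQQ: "\<beta> / 16 + 5 / 4 * (r * (r / \<beta>)) + r * C + r * v \<le> 1/64"
  proof -
    have "r * (r / \<beta>) \<le> r * 1" using rb r by (intro mult_left_mono) auto
    then show ?thesis using rC bC rv r b by linarith
  qed
  have cQH: "\<beta> / 16 + 2 * \<beta> * C + 2 * \<beta> * v + r * C + r * v \<le> 6 * (\<beta> * C)"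
  proof -
    have "\<beta> * 2 \<le> \<beta> * C" using b C by (intro mult_left_mono) auto
    then show ?thesis using rC rv bv b by linarith
  qed
  have cHH: "2 * \<beta> * v \<le> \<beta> / 16" using v b mult_left_mono[of v "1/32" \<beta>] by simp
  have cPQ: "1 + \<beta> / 16 + r * C + r * v + 1/2 * (r / \<beta>) \<le> 4"
    using rb rC bC rv b by linarith
  have cPH: "2 * \<beta> * C + 2 * \<beta> * v + 1 \<le> 3" using bC bv b by linarith
  have e1: "6 * (\<beta> * C) * Q * H \<le> 9/16 * Q\<^sup>2 + (\<beta> / 16) * H\<^sup>2"
  proof (rule absorb)
    have "(6 * (\<beta> * C))\<^sup>2 = 36 * (\<beta> * (\<beta> * C\<^sup>2))" by (simp add: power2_eq_square)
    then show "(6 * (\<beta> * C))\<^sup>2 \<le> 4 * (9/16) * (\<beta> / 16)" by (simp add: b(3))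
  qed (use b in auto)
  have e2: "4 * \<Psi> * Q \<le> (64 :: real) * \<Psi>\<^sup>2 + 1/16 * Q\<^sup>2" for \<Psi> by (rule absorb) auto
  have e3: "3 * \<Psi> * H \<le> 72 / \<beta> * \<Psi>\<^sup>2 + \<beta> / 32 * H\<^sup>2" for \<Psi> :: real
    by (rule absorb) (use b in auto)
  have tot: "r * \<Psi> * Q + \<beta> / 16 * ((H + Q + r * \<Psi>) * Q) + 5 / 4 * (r * (r / \<beta>)) * Q\<^sup>2
              + 2 * \<beta> * (C * Q * H + C * H * (r * \<Psi>) + v * (H * (H + Q + r * \<Psi>)))
              + r * (C * H * Q + C * Q\<^sup>2 + C * r * \<Psi> * Q + v * (H + Q + r * \<Psi>) * Q)
              + r * H * \<Psi> + 1 / 2 * (r / \<beta>) * (r * Q * \<Psi>)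
      = (\<beta> / 16 + 5 / 4 * (r * (r / \<beta>)) + r * C + r * v) * Q\<^sup>2
        + (\<beta> / 16 + 2 * \<beta> * C + 2 * \<beta> * v + r * C + r * v) * (Q * H)
        + (2 * \<beta> * v) * H\<^sup>2
        + (1 + \<beta> / 16 + r * C + r * v + 1/2 * (r / \<beta>)) * ((r * \<Psi>) * Q)
        + (2 * \<beta> * C + 2 * \<beta> * v + 1) * ((r * \<Psi>) * H)" (is "?err = _")
    by (simp add: algebra_simps power2_eq_square)
  also have "\<dots> \<le> 1/64 * Q\<^sup>2 + 6 * (\<beta> * C) * (Q * H) + \<beta> / 16 * H\<^sup>2 + 4 * ((r * \<Psi>) * Q) + 3 * ((r * \<Psi>) * H)"
    by (intro add_mono mult_right_mono cQQ cQH cHH cPQ cPH) (use nn r in auto)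
  also have "\<dots> \<le> 3/4 * Q\<^sup>2 + 7 / 32 * \<beta> * H\<^sup>2 + (64 + 72 / \<beta>) * (r * \<Psi>)\<^sup>2"
  proof -
    have "0 \<le> \<beta> * H\<^sup>2" "0 \<le> Q\<^sup>2" using b by auto
    then show ?thesis using e1 e2[of "r * \<Psi>"] e3[of "r * \<Psi>"]
      unfolding distrib_right mult.assoc[of _ _ Q] mult.assoc[of _ _ H] mult.assoc[of _ _ "H\<^sup>2"] by linarith
  qed
  finally have err: "v * ?err \<le> v * (3/4 * Q\<^sup>2 + 7 / 32 * \<beta> * H\<^sup>2 + (64 + 72 / \<beta>) * (r * \<Psi>)\<^sup>2)"
    using v by (intro mult_left_mono) auto
  have "v * ((64 + 72 / \<beta>) * (r * \<Psi>)\<^sup>2) \<le> \<beta> / 32 * r * \<Psi>\<^sup>2"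
  proof -
    have "(64 + 72 / \<beta>) * r \<le> (64 + 72 / \<beta>) * \<beta>" using r b by (intro mult_left_mono) auto
    also have "\<dots> \<le> 73" using b by (simp add: algebra_simps)
    finally have "v * ((64 + 72 / \<beta>) * r) \<le> v * 73" using v by (intro mult_left_mono) auto
    then have "v * ((64 + 72 / \<beta>) * r) \<le> \<beta> / 32" using v by linarith
    then have "v * ((64 + 72 / \<beta>) * r) * (r * \<Psi>\<^sup>2) \<le> \<beta> / 32 * (r * \<Psi>\<^sup>2)"
      using r by (intro mult_right_mono) auto
    moreover have eq: "v * (c * (r * \<Psi>)\<^sup>2) = v * (c * r) * (r * \<Psi>\<^sup>2)" for c
      by (simp add: power_mult_distrib power2_eq_square mult_ac)
    ultimately show ?thesis unfolding eq by (simp only: mult.assoc)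
  qed
  moreover have "v * (3/4 * Q\<^sup>2 + 7 / 32 * \<beta> * H\<^sup>2 + (64 + 72 / \<beta>) * (r * \<Psi>)\<^sup>2)
      = 3/4 * (v * Q\<^sup>2) + 7 / 32 * (\<beta> * v * H\<^sup>2) + v * ((64 + 72 / \<beta>) * (r * \<Psi>)\<^sup>2)"
    by (simp add: algebra_simps)
  moreover have "\<beta> / 16 * r * \<Psi>\<^sup>2 = 2 * (\<beta> / 32 * r * \<Psi>\<^sup>2)" "\<beta> / 4 * v * H\<^sup>2 = 1/4 * (\<beta> * v * H\<^sup>2)"
    "v * Q\<^sup>2 / 4 = 1/4 * (v * Q\<^sup>2)" "\<beta> * v * H\<^sup>2 / 32 = 1/32 * (\<beta> * v * H\<^sup>2)" by simp_all
  moreover have "0 \<le> \<beta> / 32 * r * \<Psi>\<^sup>2" "0 \<le> \<beta> * v * H\<^sup>2" "0 \<le> v * Q\<^sup>2" using b v r by auto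
  moreover have "1/4 * q + 1/32 * h + p \<le> q + 2 * p + 1/4 * h - X"
    if "X \<le> 3/4 * q + 7/32 * h + c" "c \<le> p" for q h p c X :: real
    using that by linarith
  ultimately show ?thesis using err by metis
qed

text \<open>For large \<open>s\<close> the fast equation forces \<open>p \<approx> q - \<psi> / s\<close>, and \<open>\<eta>\<close> is the deviation; here
  \<open>i = 1 / s\<close>. The form \<open>Re (\<psi> * cnj q / s)\<close> dissipates \<open>vh |q|\<^sup>2\<close> up to \<open>vh Re (\<eta> * cnj q)\<close>. That
  term is cancelled by the cross term of the square \<open>\<beta> vh |\<xi>|\<^sup>2\<close>, whose shift by \<open>q / (2 \<beta> cnj s)\<close> is
  chosen for this purpose, and the square itself dissipates \<open>vh |\<eta>|\<^sup>2\<close>. The small multiple of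
  \<open>Re (\<psi> * cnj q)\<close> supplies the dissipation in \<open>\<psi>\<close>, which the main form loses for imaginary
  \<open>s\<close>. Writing the weight as a square also gives the functional a sign at the boundary.\<close>

lemma high_frequency_dissipation:
  fixes s i q \<psi> \<eta> :: complex and v sl n C \<beta> r :: real
  assumes C: "C \<ge> 2" and \<beta>: "\<beta> = 1 / (256 * C\<^sup>2)" and s: "i * s = 1" "Re s \<ge> 0" and r: "r = norm i" "r \<le> \<beta>"
    and v: "0 < v" "2400 * v \<le> \<beta>" and sl: "sl \<le> v" and n: "3/4 \<le> n" "n \<le> C"
  defines "p \<equiv> \<eta> + q - i * \<psi>"
  defines "\<xi> \<equiv> \<eta> - (1 / (2 * \<beta>)) *\<^sub>R (cnj i * q)"
  defines "\<eta>' \<equiv> s * \<eta> + n *\<^sub>R \<eta> + n *\<^sub>R q - n *\<^sub>R (i * \<psi>) + v *\<^sub>R p"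
  defines "\<xi>' \<equiv> \<eta>' - (1 / (2 * \<beta>)) *\<^sub>R (cnj i * \<psi>)"
  shows "v * (norm q)\<^sup>2 / 4 + \<beta> * v * (norm \<eta>)\<^sup>2 / 32 + \<beta> / 32 * r * (norm \<psi>)\<^sup>2
      \<le> inner (i * \<psi>) \<psi> + inner (i * (v *\<^sub>R (s * p))) q
        + \<beta> / 16 * r * (inner \<psi> \<psi> + inner (v *\<^sub>R (s * p)) q)
        + \<beta> * (- sl * inner \<xi> \<xi> + v * (2 * inner \<xi> \<xi>'))"
proof -
  define Q H \<Psi> where "Q = norm q" "H = norm \<eta>" "\<Psi> = norm \<psi>"
  have nn: "0 \<le> Q" "0 \<le> H" "0 \<le> \<Psi>" by (auto simp: Q_H_\<Psi>_def)
  have b: "0 < \<beta>" using C by (simp add: \<beta>)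
  have i0: "i \<noteq> 0" using s by auto
  have rpos: "0 < r" using i0 r by simp
  have rs: "r * norm s = 1" using s r by (metis norm_mult norm_one)
  have Rei: "0 \<le> Re i" "Re i \<le> r"
  proof -
    have "s = inverse i" using s i0 by (simp add: field_simps)
    then have "0 \<le> Re i / ((Re i)\<^sup>2 + (Im i)\<^sup>2)" using s(2) by simp
    moreover have "0 < (Re i)\<^sup>2 + (Im i)\<^sup>2" using i0 by (simp add: complex_neq_0)
    ultimately show "0 \<le> Re i" by (simp add: zero_le_divide_iff)
    show "Re i \<le> r" using complex_Re_le_cmod r by simp
  qed
  have innRe: "inner (i * w) w = Re i * (norm w)\<^sup>2" "inner w (i * w) = Re i * (norm w)\<^sup>2" for w
    unfolding cmod_power2 by (simp_all add: inner_complex_def algebra_simps power2_eq_square)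
  have innRes: "inner w (s * w) = Re s * (norm w)\<^sup>2" for w
    unfolding cmod_power2 by (simp add: inner_complex_def algebra_simps power2_eq_square)
  have np: "norm p \<le> H + Q + r * \<Psi>"
    unfolding p_def Q_H_\<Psi>_def r
    by (metis add_mono_thms_linordered_semiring(3) norm_mult norm_triangle_ineq norm_triangle_ineq4 order_trans)
  \<comment> \<open>Exact expansions are A1, A2, A3; the term v * inner \<eta> q occurs in A1 and, with the opposite
    sign, through A2 and A3.\<close>
  have A1: "inner (i * (v *\<^sub>R (s * p))) q = v * inner \<eta> q + v * Q\<^sup>2 - v * inner (i * \<psi>) q"
  proof -
    have "i * (v *\<^sub>R (s * p)) = v *\<^sub>R p" using s(1) by (simp add: mult.assoc[symmetric])
    then have "inner (i * (v *\<^sub>R (s * p))) q = v * inner p q" by (simp only: inner_scaleR_left)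
    then show ?thesis
      unfolding p_def by (simp add: inner_add_left inner_diff_left Q_H_\<Psi>_def dot_square_norm ring_distribs)
  qed
  have B1: "inner (i * \<psi>) q \<le> r * \<Psi> * Q"
    using inner_bound(2)[of "i * \<psi>" q] by (simp add: norm_mult r Q_H_\<Psi>_def)
  have B2: "- (v * ((H + Q + r * \<Psi>) * Q)) \<le> r * inner (v *\<^sub>R (s * p)) q"
  proof -
    have "- (v * (norm s * norm p) * Q) \<le> inner (v *\<^sub>R (s * p)) q"
      using inner_bound(1)[of "v *\<^sub>R (s * p)" q] v by (simp add: norm_mult Q_H_\<Psi>_def)
    then have "r * (- (v * (norm s * norm p) * Q)) \<le> r * inner (v *\<^sub>R (s * p)) q"
      using rpos by (intro mult_left_mono) auto
    moreover have "r * (- (v * (norm s * norm p) * Q)) = - (v * (norm p * Q))"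
      using rs by (simp add: algebra_simps)
    moreover have "v * (norm p * Q) \<le> v * ((H + Q + r * \<Psi>) * Q)"
      using np nn v by (intro mult_left_mono mult_right_mono) auto
    ultimately show ?thesis by linarith
  qed
  have B3: "inner \<xi> \<xi> \<le> 5/4 * H\<^sup>2 + 5 / 4 * (r / \<beta>)\<^sup>2 * Q\<^sup>2"
  proof -
    have "norm \<xi> \<le> H + r / (2 * \<beta>) * Q"
      unfolding \<xi>_def Q_H_\<Psi>_def r by (rule order_trans[OF norm_triangle_ineq4]) (use b in \<open>simp add: norm_mult\<close>)
    then have "(norm \<xi>)\<^sup>2 \<le> (H + r / (2 * \<beta>) * Q)\<^sup>2" by (rule power_mono) simp
    also have "\<dots> \<le> 5/4 * H\<^sup>2 + 5 * (r / (2 * \<beta>) * Q)\<^sup>2"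
      using zero_le_power2[of "H / 2 - 2 * (r / (2 * \<beta>) * Q)"] by (simp add: power2_eq_square algebra_simps)
    finally show ?thesis by (simp add: dot_square_norm power_mult_distrib power_divide)
  qed
  have B4: "sl * inner \<xi> \<xi> \<le> v * (5/4 * H\<^sup>2 + 5 / 4 * (r / \<beta>)\<^sup>2 * Q\<^sup>2)"
    by (rule order_trans[OF mult_right_mono[OF sl]]) (use v B3 in auto)
  have A2: "2 * inner \<xi> \<xi>' * \<beta> = 2 * \<beta> * inner \<eta> \<eta>' - inner q (i * \<eta>') - inner \<xi> (cnj i * \<psi>)"
  proof -
    have "inner \<xi> \<xi>' = inner \<xi> \<eta>' - 1 / (2 * \<beta>) * inner \<xi> (cnj i * \<psi>)"
      by (simp add: \<xi>'_def inner_diff_right)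
    moreover have "inner \<xi> \<eta>' = inner \<eta> \<eta>' - 1 / (2 * \<beta>) * inner q (i * \<eta>')"
      by (simp add: \<xi>_def inner_diff_left inner_mult_left_complex)
    moreover have "2 * (x - 1 / (2 * \<beta>) * y - 1 / (2 * \<beta>) * z) * \<beta> = 2 * \<beta> * x - y - z" for x y z
      using b by (simp add: field_simps)
    ultimately show ?thesis by simp
  qed
  have "i * \<eta>' = \<eta> + n *\<^sub>R (i * \<eta>) + n *\<^sub>R (i * q) - n *\<^sub>R (i * (i * \<psi>)) + v *\<^sub>R (i * p)"
    unfolding \<eta>'_def using s(1) by (simp add: ring_distribs mult.assoc[symmetric])
  then have A3: "inner q (i * \<eta>') = inner \<eta> q + n * inner q (i * \<eta>) + n * (Re i * Q\<^sup>2)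
      - n * inner q (i * (i * \<psi>)) + v * inner q (i * p)"
    by (simp add: inner_add_right inner_diff_right innRe Q_H_\<Psi>_def inner_commute)
  have nb: "0 \<le> n" using n by simp
  have B5: "inner q (i * \<eta>') \<le> inner \<eta> q + r * (C * H * Q + C * Q\<^sup>2 + C * r * \<Psi> * Q + v * (H + Q + r * \<Psi>) * Q)"
  proof -
    have "n * inner q (i * \<eta>) \<le> C * (Q * (r * H))"
      by (rule order_trans[OF mult_left_mono[OF inner_bound(2) nb]])
        (use n nn rpos in \<open>auto simp: norm_mult r Q_H_\<Psi>_def intro!: mult_right_mono\<close>)
    moreover have "n * (Re i * Q\<^sup>2) \<le> C * (r * Q\<^sup>2)"
      using n Rei C by (intro mult_mono) auto
    moreover have "n * - inner q (i * (i * \<psi>)) \<le> C * (Q * (r * (r * \<Psi>)))"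
    proof -
      have "- inner q (i * (i * \<psi>)) \<le> Q * (r * (r * \<Psi>))"
        using inner_bound(1)[of q "i * (i * \<psi>)"] by (simp add: norm_mult r Q_H_\<Psi>_def)
      then have "n * - inner q (i * (i * \<psi>)) \<le> n * (Q * (r * (r * \<Psi>)))" by (rule mult_left_mono[OF _ nb])
      also have "\<dots> \<le> C * (Q * (r * (r * \<Psi>)))" using n nn rpos by (intro mult_right_mono) auto
      finally show ?thesis .
    qed
    moreover have "v * inner q (i * p) \<le> v * (Q * (r * (H + Q + r * \<Psi>)))"
    proof -
      have "inner q (i * p) \<le> Q * (r * norm p)"
        using inner_bound(2)[of q "i * p"] by (simp add: norm_mult r Q_H_\<Psi>_def)
      also have "\<dots> \<le> Q * (r * (H + Q + r * \<Psi>))"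
        using np nn rpos by (intro mult_left_mono) auto
      finally show ?thesis using v by simp
    qed
    ultimately show ?thesis unfolding A3 by (simp add: algebra_simps)
  qed
  have B6: "inner \<xi> (cnj i * \<psi>) \<le> r * H * \<Psi> + 1 / 2 * (r / \<beta>) * (r * Q * \<Psi>)"
  proof -
    have "norm \<xi> \<le> H + r / (2 * \<beta>) * Q"
      unfolding \<xi>_def Q_H_\<Psi>_def r by (rule order_trans[OF norm_triangle_ineq4]) (use b in \<open>simp add: norm_mult\<close>)
    then have "norm \<xi> * (r * \<Psi>) \<le> (H + r / (2 * \<beta>) * Q) * (r * \<Psi>)"
      using nn rpos by (intro mult_right_mono) auto
    moreover have "inner \<xi> (cnj i * \<psi>) \<le> norm \<xi> * (r * \<Psi>)"
      using inner_bound(2)[of \<xi> "cnj i * \<psi>"] by (simp add: norm_mult r Q_H_\<Psi>_def)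
    ultimately show ?thesis by (simp add: algebra_simps)
  qed
  have B7: "inner \<eta> \<eta>' \<ge> 3/4 * H\<^sup>2 - (C * Q * H + C * H * (r * \<Psi>) + v * (H * (H + Q + r * \<Psi>)))"
  proof -
    have "inner \<eta> \<eta>' = Re s * H\<^sup>2 + n * H\<^sup>2 + n * inner \<eta> q - n * inner \<eta> (i * \<psi>) + v * inner \<eta> p"
      unfolding \<eta>'_def by (simp add: inner_add_right inner_diff_right innRes dot_square_norm Q_H_\<Psi>_def)
    moreover have "0 \<le> Re s * H\<^sup>2" using s by simp
    moreover have "3/4 * H\<^sup>2 \<le> n * H\<^sup>2" using n by (intro mult_right_mono) auto
    moreover have "- (C * (H * Q)) \<le> n * inner \<eta> q"
    proof -
      have "n * - inner \<eta> q \<le> n * (H * Q)"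
        using inner_bound(1)[of \<eta> q] nb by (intro mult_left_mono) (auto simp: Q_H_\<Psi>_def)
      also have "\<dots> \<le> C * (H * Q)" using n nn by (intro mult_right_mono) auto
      finally show ?thesis by simp
    qed
    moreover have "n * inner \<eta> (i * \<psi>) \<le> C * (H * (r * \<Psi>))"
    proof -
      have "n * inner \<eta> (i * \<psi>) \<le> n * (H * (r * \<Psi>))"
        using inner_bound(2)[of \<eta> "i * \<psi>"] nb by (intro mult_left_mono) (auto simp: norm_mult r Q_H_\<Psi>_def)
      also have "\<dots> \<le> C * (H * (r * \<Psi>))" using n nn rpos by (intro mult_right_mono) auto
      finally show ?thesis .
    qed
    moreover have "- (v * (H * (H + Q + r * \<Psi>))) \<le> v * inner \<eta> p"
    proof -
      have "- inner \<eta> p \<le> H * norm p" using inner_bound(1)[of \<eta> p] by (simp add: Q_H_\<Psi>_def)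
      also have "\<dots> \<le> H * (H + Q + r * \<Psi>)" using np nn by (intro mult_left_mono) auto
      finally have "v * - inner \<eta> p \<le> v * (H * (H + Q + r * \<Psi>))" using v by (intro mult_left_mono) auto
      then show ?thesis by simp
    qed
    ultimately show ?thesis by (simp add: algebra_simps)
  qed
  have B7': "v * (2 * \<beta> * inner \<eta> \<eta>') \<ge> v * (2 * \<beta> * (3/4 * H\<^sup>2 - (C * Q * H + C * H * (r * \<Psi>) + v * (H * (H + Q + r * \<Psi>)))))"
    using B7 v b by (intro mult_left_mono) auto
  have B5': "v * inner q (i * \<eta>') \<le> v * (inner \<eta> q + r * (C * H * Q + C * Q\<^sup>2 + C * r * \<Psi> * Q + v * (H + Q + r * \<Psi>) * Q))"
    using B5 v by (intro mult_left_mono) auto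
  have B6': "v * inner \<xi> (cnj i * \<psi>) \<le> v * (r * H * \<Psi> + 1 / 2 * (r / \<beta>) * (r * Q * \<Psi>))"
    using B6 v by (intro mult_left_mono) auto
  have B1': "v * inner (i * \<psi>) q \<le> v * (r * \<Psi> * Q)"
    using B1 v by (intro mult_left_mono) auto
  have B2': "\<beta> / 16 * (- (v * ((H + Q + r * \<Psi>) * Q))) \<le> \<beta> / 16 * (r * inner (v *\<^sub>R (s * p)) q)"
    using B2 b by (intro mult_left_mono) auto
  have B4': "\<beta> * (sl * inner \<xi> \<xi>) \<le> \<beta> * (v * (5/4 * H\<^sup>2 + 5 / 4 * (r / \<beta>)\<^sup>2 * Q\<^sup>2))"
    using B4 b by (intro mult_left_mono) auto
  have rr: "\<beta> * (r / \<beta>)\<^sup>2 = r * (r / \<beta>)" using b by (simp add: power2_eq_square)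
  have B4'': "\<beta> * (v * (5/4 * H\<^sup>2 + 5 / 4 * (r / \<beta>)\<^sup>2 * Q\<^sup>2)) = 5/4 * (\<beta> * v * H\<^sup>2) + v * (5/4 * (r * (r / \<beta>)) * Q\<^sup>2)"
  proof -
    have "\<beta> * (v * (5/4 * h + 5/4 * k * Q\<^sup>2)) = 5/4 * (\<beta> * v * h) + v * (5/4 * (\<beta> * k) * Q\<^sup>2)" for h k
      by (simp add: algebra_simps)
    then show ?thesis by (simp only: rr)
  qed
  have T1: "0 \<le> inner (i * \<psi>) \<psi>" using Rei by (simp add: innRe)
  have T3: "inner \<psi> \<psi> = \<Psi>\<^sup>2" by (simp add: dot_square_norm Q_H_\<Psi>_def)
  have A2': "\<beta> * (v * (2 * inner \<xi> \<xi>')) = v * (2 * \<beta> * inner \<eta> \<eta>') - v * inner q (i * \<eta>') - v * inner \<xi> (cnj i * \<psi>)"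
    using A2 by (simp add: algebra_simps flip: A2) (metis (no_types, opaque_lifting) A2 distrib_left mult.commute mult.left_commute right_diff_distrib)
  have "v * Q\<^sup>2 / 4 + \<beta> * v * H\<^sup>2 / 32 + \<beta> / 32 * r * \<Psi>\<^sup>2
     \<le> v * Q\<^sup>2 + \<beta> / 16 * r * \<Psi>\<^sup>2 + \<beta> / 4 * v * H\<^sup>2
       - v * (r * \<Psi> * Q + \<beta> / 16 * ((H + Q + r * \<Psi>) * Q) + 5 / 4 * (r * (r / \<beta>)) * Q\<^sup>2
              + 2 * \<beta> * (C * Q * H + C * H * (r * \<Psi>) + v * (H * (H + Q + r * \<Psi>)))
              + r * (C * H * Q + C * Q\<^sup>2 + C * r * \<Psi> * Q + v * (H + Q + r * \<Psi>) * Q)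
              + r * H * \<Psi> + 1 / 2 * (r / \<beta>) * (r * Q * \<Psi>))"
    by (rule high_frequency_absorption[OF C \<beta> rpos r(2) v nn])
  also have "\<dots> = v * Q\<^sup>2 + \<beta> / 16 * r * \<Psi>\<^sup>2 - v * (r * \<Psi> * Q)
      + \<beta> / 16 * (- (v * ((H + Q + r * \<Psi>) * Q)))
      - (5/4 * (\<beta> * v * H\<^sup>2) + v * (5/4 * (r * (r / \<beta>)) * Q\<^sup>2))
      + v * (2 * \<beta> * (3/4 * H\<^sup>2 - (C * Q * H + C * H * (r * \<Psi>) + v * (H * (H + Q + r * \<Psi>)))))
      - v * (inner \<eta> q + r * (C * H * Q + C * Q\<^sup>2 + C * r * \<Psi> * Q + v * (H + Q + r * \<Psi>) * Q)) + v * inner \<eta> q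
      - v * (r * H * \<Psi> + 1 / 2 * (r / \<beta>) * (r * Q * \<Psi>))"
    by (simp add: ring_distribs mult_ac add_divide_distrib)
  also have "\<dots> \<le> inner (i * \<psi>) \<psi> + (v * inner \<eta> q + v * Q\<^sup>2 - v * inner (i * \<psi>) q)
        + (\<beta> / 16 * r * \<Psi>\<^sup>2 + \<beta> / 16 * (r * inner (v *\<^sub>R (s * p)) q))
        + (- (\<beta> * (sl * inner \<xi> \<xi>)) + (v * (2 * \<beta> * inner \<eta> \<eta>') - v * inner q (i * \<eta>') - v * inner \<xi> (cnj i * \<psi>)))"
    using B1' B2' B4' B5' B6' B7' T1 unfolding B4'' by linarith
  also have "\<dots> = inner (i * \<psi>) \<psi> + inner (i * (v *\<^sub>R (s * p))) q
        + \<beta> / 16 * r * (inner \<psi> \<psi> + inner (v *\<^sub>R (s * p)) q)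
        + \<beta> * (- sl * inner \<xi> \<xi> + v * (2 * inner \<xi> \<xi>'))"
    unfolding A1 T3 A2'[symmetric] by (simp only: ring_distribs mult.assoc mult_minus_left mult_minus_right)
  finally show ?thesis unfolding Q_H_\<Psi>_def .
qed

context inflow_layer
begin

lemma high_frequency_rigidity:
  assumes mode: "decaying_mode s q \<psi> p" and s: "Re s \<ge> 0" "256 * C\<^sup>2 \<le> norm s"
    and v0: "2400 * v0 \<le> 1 / (256 * C\<^sup>2)" and bc: "\<psi> 0 = 0" and x: "x > 0"
  shows "q x = 0 \<and> \<psi> x = 0 \<and> p x = 0"
proof -
  define \<beta> where "\<beta> = 1 / (256 * C\<^sup>2)"
  define i where "i = 1 / s"
  define r where "r = norm i"
  have C2: "C\<^sup>2 > 0" using C_ge by simp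
  then have b: "0 < \<beta>" by (simp add: \<beta>_def)
  have s0: "norm s > 0" using s(2) C2 by linarith
  then have is1: "i * s = 1" by (auto simp: i_def)
  have r: "0 < r" "r \<le> \<beta>"
    using s0 s(2) C2 by (auto simp: r_def i_def \<beta>_def norm_divide intro!: divide_left_mono)
  define \<eta> where "\<eta> = (\<lambda>x. p x + i * \<psi> x - q x)"
  define \<xi> where "\<xi> = (\<lambda>x. \<eta> x - (1 / (2 * \<beta>)) *\<^sub>R (cnj i * q x))"
  define \<psi>' where "\<psi>' = (\<lambda>x. vh x *\<^sub>R (s * p x))"
  define \<eta>' where "\<eta>' = (\<lambda>x. s * \<eta> x + N x *\<^sub>R \<eta> x + N x *\<^sub>R q x - N x *\<^sub>R (i * \<psi> x) + vh x *\<^sub>R p x)"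
  define \<xi>' where "\<xi>' = (\<lambda>x. \<eta>' x - (1 / (2 * \<beta>)) *\<^sub>R (cnj i * \<psi> x))"
  have dq: "(q has_vector_derivative \<psi> y) (at y within {0..})"
    and d\<psi>: "(\<psi> has_vector_derivative \<psi>' y) (at y within {0..})"
    and dp: "(p has_vector_derivative s * p y + N y *\<^sub>R p y + 2 *\<^sub>R \<psi> y - s * q y) (at y within {0..})"
    if "y \<ge> 0" for y
    using mode that by (auto simp: decaying_mode_def \<psi>'_def)
  have d\<eta>: "(\<eta> has_vector_derivative \<eta>' y) (at y within {0..})" if y: "y \<ge> 0" for y
  proof -
    have "(\<eta> has_vector_derivative (s * p y + N y *\<^sub>R p y + 2 *\<^sub>R \<psi> y - s * q y) + i * \<psi>' y - \<psi> y) (at y within {0..})"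
      unfolding \<eta>_def
      by (intro has_vector_derivative_diff has_vector_derivative_add dp[OF y] dq[OF y]
          bounded_linear.has_vector_derivative[OF bounded_linear_mult_right d\<psi>[OF y]])
    moreover have f1: "i * \<psi>' y = vh y *\<^sub>R p y" using is1 by (simp add: \<psi>'_def mult.assoc[symmetric])
    moreover have f2: "i * (s * \<psi> y) = \<psi> y" using is1 by (simp add: mult.assoc[symmetric])
    moreover have "(s * p y + N y *\<^sub>R p y + 2 *\<^sub>R \<psi> y - s * q y) + i * \<psi>' y - \<psi> y = \<eta>' y"
      by (simp add: \<eta>'_def \<eta>_def algebra_simps scaleR_2 f1 f2)
    ultimately show ?thesis by simp
  qed
  have d\<xi>: "(\<xi> has_vector_derivative \<xi>' y) (at y within {0..})" if y: "y \<ge> 0" for y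
    unfolding \<xi>_def \<xi>'_def
    by (intro has_vector_derivative_diff d\<eta>[OF y] bounded_linear.has_vector_derivative[OF bounded_linear_scaleR_right]
        bounded_linear.has_vector_derivative[OF bounded_linear_mult_right] dq[OF y])
  define E where "E = (\<lambda>x. inner (i * \<psi> x) (q x) + \<beta> / 16 * r * inner (\<psi> x) (q x) + \<beta> * (vh x * inner (\<xi> x) (\<xi> x)))"
  define D where "D = (\<lambda>x. (inner (i * \<psi> x) (\<psi> x) + inner (i * \<psi>' x) (q x))
        + \<beta> / 16 * r * (inner (\<psi> x) (\<psi> x) + inner (\<psi>' x) (q x))
        + \<beta> * (- slope x * inner (\<xi> x) (\<xi> x) + vh x * (2 * inner (\<xi> x) (\<xi>' x))))"
  have dE: "(E has_real_derivative D y) (at y within {0..})" if y: "y \<ge> 0" for y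
  proof -
    have "((\<lambda>x. vh x * inner (\<xi> x) (\<xi> x)) has_real_derivative
        - slope y * inner (\<xi> y) (\<xi> y) + vh y * (2 * inner (\<xi> y) (\<xi>' y))) (at y within {0..})"
      by (rule DERIV_cong[OF DERIV_mult[OF vh_deriv_slope has_real_derivative_inner[OF d\<xi>[OF y] d\<xi>[OF y]]]])
        (simp add: inner_commute)
    then show ?thesis
      unfolding E_def D_def
      by (intro DERIV_add DERIV_cmult has_real_derivative_inner d\<psi>[OF y] dq[OF y]
          bounded_linear.has_vector_derivative[OF bounded_linear_mult_right])
  qed
  have diss: "vh y * (norm (q y))\<^sup>2 / 4 + \<beta> * vh y * (norm (\<eta> y))\<^sup>2 / 32 + \<beta> / 32 * r * (norm (\<psi> y))\<^sup>2 \<le> D y"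
    if y: "y \<ge> 0" for y
  proof -
    have p: "p y = \<eta> y + q y - i * \<psi> y" by (simp add: \<eta>_def)
    have "2400 * vh y \<le> \<beta>" using profile_range(2)[OF y] v0 by (simp add: \<beta>_def)
    then show ?thesis
      unfolding D_def \<xi>'_def \<xi>_def \<eta>'_def \<psi>'_def p
      using high_frequency_dissipation[where q = "q y" and \<psi> = "\<psi> y" and \<eta> = "\<eta> y", OF C_ge \<beta>_def is1 s(1) r_def r(2) profile_range(3)[OF y] _ slope_le_vh[OF y] N_bounds(1,2)[OF y]]
      by simp
  qed
  have lower: "0 \<le> vh y * (norm (q y))\<^sup>2 / 4" "0 \<le> \<beta> * vh y * (norm (\<eta> y))\<^sup>2 / 32" "0 \<le> \<beta> / 32 * r * (norm (\<psi> y))\<^sup>2"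
    if y: "y \<ge> 0" for y
    using profile_range(3)[OF y] b r by auto
  have Dpos: "0 \<le> D y" if y: "y \<ge> 0" for y using diss[OF y] lower[OF y] by linarith
  have lim: "(E \<longlongrightarrow> 0) at_top"
  proof -
    have l: "(q \<longlongrightarrow> 0) at_top" "(\<psi> \<longlongrightarrow> 0) at_top" "(p \<longlongrightarrow> 0) at_top"
      using mode by (auto simp: decaying_mode_def)
    have "(\<xi> \<longlongrightarrow> 0 + i * 0 - 0 - (1 / (2 * \<beta>)) *\<^sub>R (cnj i * 0)) at_top"
      unfolding \<xi>_def \<eta>_def by (intro tendsto_intros l)
    then have lx: "(\<xi> \<longlongrightarrow> 0) at_top" by simp
    have "(E \<longlongrightarrow> inner (i * 0) 0 + \<beta> / 16 * r * inner 0 (0::complex) + \<beta> * (vp * inner 0 (0::complex))) at_top"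
      unfolding E_def by (intro tendsto_intros l lx profile_limit)
    then show ?thesis by simp
  qed
  have "0 \<le> E 0"
    using bc b profile_range(3)[of 0] by (simp add: E_def)
  then have "D x = 0"
    using lyapunov_rigidity[OF dE Dpos lim _ x] by simp
  then have z: "vh x * (norm (q x))\<^sup>2 / 4 \<le> 0" "\<beta> * vh x * (norm (\<eta> x))\<^sup>2 / 32 \<le> 0" "\<beta> / 32 * r * (norm (\<psi> x))\<^sup>2 \<le> 0"
    using diss[of x] lower[of x] x by linarith+
  have "vh x > 0" using profile_range(3) x by simp
  then have "q x = 0" "\<eta> x = 0" "\<psi> x = 0"
    using z b r by (auto simp: mult_le_0_iff)
  then show ?thesis by (simp add: \<eta>_def)
qed

end

section \<open>Low frequencies\<close>

text \<open>The error terms of the low-frequency estimate, each charged to the dissipation of its two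
  factors. The dissipation in \<open>Q\<close> is only of order \<open>S\<^sup>2\<close>, so it is essential that every error term
  containing \<open>Q\<close> has a factor \<open>S\<close>, with the one exception \<open>z \<Psi> Q\<close>: this term is charged to
  \<open>B z \<Psi>\<^sup>2\<close>, where \<open>B\<close> is as large as \<open>1 / S\<^sup>2\<close>.\<close>

lemma low_frequency_absorption:
  fixes Q Y \<Psi> S M R \<epsilon> b B v v0 z \<theta> :: real
  assumes M: "4 \<le> M" and \<epsilon>: "\<epsilon> = 1 / (128 * M\<^sup>2)" and b: "b = \<epsilon> / 8"
    and S: "0 < S" "S \<le> M" and R: "0 \<le> R" "R \<le> M" and B: "B = 64 * R\<^sup>2 / (\<epsilon> * S\<^sup>2)"
    and v: "0 < v" "v \<le> v0" "2000000 * v0 \<le> \<epsilon>\<^sup>2" and z: "0 \<le> z" "z \<le> v"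
    and \<theta>: "0 \<le> \<theta>" "\<theta> \<le> 4 * v0" "\<theta>\<^sup>2 \<le> 16 * v0 * v"
    and nn: "0 \<le> Q" "0 \<le> Y" "0 \<le> \<Psi>"
  defines "f \<equiv> 5 * (S * \<Psi>) + 4 * (v * (S * Y))"
  shows "v * Y\<^sup>2 / 16 + \<epsilon> * v * (S * Q)\<^sup>2 / 16 + b * \<Psi>\<^sup>2 / 4
    \<le> b * \<Psi>\<^sup>2 - b * (v * (S * ((Y + 4 * \<Psi>) * Q))) - 2 * R * z * (\<Psi> * Q) + v / 2 * Y\<^sup>2
      - 2 * \<theta> * (Y * f + Y * \<Psi> + f * Q)
      + \<epsilon> * v * ((S * Q)\<^sup>2 / 2 - 2 * Y\<^sup>2 - M * (S * (Y * Q)) - (2 * Y + S * Q) * (6 * (S * \<Psi>) + 4 * (v * (S * Y))))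
      + B * (3/4 * z * \<Psi>\<^sup>2 - 2 * (z * (v * (S * ((Y + 4 * \<Psi>) * \<Psi>)))))"
proof -
  have M2: "16 \<le> M\<^sup>2" using power_mono[OF M, of 2] by simp
  have e0: "0 < \<epsilon>" and eM2: "\<epsilon> * M\<^sup>2 = 1/128" using M2 by (auto simp: \<epsilon>)
  have e1: "\<epsilon> \<le> 1/2048"
    unfolding \<epsilon> using M2 frac_le[of 1 1 2048 "128 * M\<^sup>2"] by simp
  have eM: "\<epsilon> * M \<le> 1/512"
  proof -
    have "\<epsilon> * M * 4 \<le> \<epsilon> * M * M" using M e0 by (intro mult_left_mono) auto
    then show ?thesis using eM2 by (simp add: power2_eq_square)
  qed
  have v0: "0 < v0" using v by simp
  have v0e: "2000000 * v0 \<le> \<epsilon> * (1/2048)"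
    using v(3) mult_left_mono[OF e1, of \<epsilon>] e0 unfolding power2_eq_square by linarith
  have v0M: "1000000 * (v0 * M) \<le> \<epsilon>"
  proof -
    have "2000000 * v0 * M \<le> \<epsilon>\<^sup>2 * M" using v(3) M by (intro mult_right_mono) auto
    also have "\<dots> = \<epsilon> * (\<epsilon> * M)" by (simp add: power2_eq_square)
    also have "\<dots> \<le> \<epsilon> * 1" using eM e0 by (intro mult_left_mono) auto
    finally show ?thesis using e0 by simp
  qed
  have v1: "v \<le> 1" "v0 \<le> 1" using v v0e e1 by auto
  have vS: "v * S \<le> v0 * M" using v S by (intro mult_mono) auto
  have tS: "\<theta> * S \<le> 4 * (v0 * M)" using mult_mono[OF \<theta>(2) S(2)] \<theta> S v0 by (simp add: mult.assoc)
  have B0: "0 \<le> B" using e0 by (simp add: B)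
  have YQ: "(b + 8 * \<theta> + \<epsilon> * M + 4 * (\<epsilon> * (v * S))) * Y * (S * Q) \<le> 1/16 * Y\<^sup>2 + \<epsilon> / 8 * (S * Q)\<^sup>2"
  proof -
    have "\<epsilon> * (v * S) \<le> \<epsilon> * 1" using vS v0M e1 e0 by (intro mult_left_mono) auto
    moreover have "\<epsilon> * 4 \<le> \<epsilon> * M" using e0 M by (intro mult_left_mono) auto
    ultimately have "b + 8 * \<theta> + \<epsilon> * M + 4 * (\<epsilon> * (v * S)) \<le> 4 * (\<epsilon> * M)"
      using b \<theta> v0e e0 by linarith
    moreover have "\<epsilon> * (v * S) \<le> \<epsilon> * (1/4)" using vS v0M e1 e0 by (intro mult_left_mono) auto
    ultimately have "b + 8 * \<theta> + \<epsilon> * M + 4 * (\<epsilon> * (v * S)) \<le> 2 * (\<epsilon> * M)"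
      using b \<theta> v0e e0 \<open>\<epsilon> * 4 \<le> \<epsilon> * M\<close> by linarith
    then have "(b + 8 * \<theta> + \<epsilon> * M + 4 * (\<epsilon> * (v * S))) * (Y * (S * Q)) \<le> 2 * (\<epsilon> * M) * (Y * (S * Q))"
      using nn S by (intro mult_right_mono) auto
    also have "\<dots> = 2 * (\<epsilon> * M) * Y * (S * Q)" by simp
    also have "\<dots> \<le> 1/16 * Y\<^sup>2 + \<epsilon> / 8 * (S * Q)\<^sup>2"
    proof (rule absorb)
      have "(2 * (\<epsilon> * M))\<^sup>2 = 4 * (\<epsilon> * (\<epsilon> * M\<^sup>2))" by (simp add: power2_eq_square)
      then show "(2 * (\<epsilon> * M))\<^sup>2 \<le> 4 * (1/16) * (\<epsilon> / 8)" by (simp add: eM2)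
    qed (use e0 in auto)
    finally show ?thesis by (simp add: mult.assoc)
  qed
  have YY: "(2 * \<epsilon> + 8 * (\<theta> * S) + 8 * (\<epsilon> * (v * S))) * Y\<^sup>2 \<le> 1/16 * Y\<^sup>2"
  proof (rule mult_right_mono)
    have "\<epsilon> * (v * S) \<le> \<epsilon> * 1" using vS v0M e1 e0 by (intro mult_left_mono) auto
    then show "2 * \<epsilon> + 8 * (\<theta> * S) + 8 * (\<epsilon> * (v * S)) \<le> 1/16" using tS v0M e1 by linarith
  qed simp
  have sq3: "(x + y + w)\<^sup>2 \<le> 3 * (x\<^sup>2 + y\<^sup>2 + w\<^sup>2)" for x y w :: real
    using zero_le_power2[of "x - y"] zero_le_power2[of "y - w"] zero_le_power2[of "x - w"]
    by (simp add: power2_eq_square algebra_simps)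
  have vv: "v\<^sup>2 \<le> v0 * v" using v by (simp add: power2_eq_square)
  have PQ1: "(4 * (b * v) + 10 * \<theta> + 6 * (\<epsilon> * (v * S))) * (S * Q) * \<Psi> \<le> \<epsilon> * v / 16 * (S * Q)\<^sup>2 + b / 8 * \<Psi>\<^sup>2"
  proof (rule absorb)
    have A: "(4 * (b * v))\<^sup>2 \<le> v0 * v"
    proof -
      have "(4 * b)\<^sup>2 * v\<^sup>2 \<le> 1 * (v0 * v)"
        by (intro mult_mono vv power_le_one) (use b e0 e1 in auto)
      then show ?thesis by (simp add: power_mult_distrib)
    qed
    have B: "(10 * \<theta>)\<^sup>2 \<le> 1600 * (v0 * v)" using \<theta>(3) by (simp add: power_mult_distrib mult_ac)
    have C: "(6 * (\<epsilon> * (v * S)))\<^sup>2 \<le> v0 * v"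
    proof -
      have "\<epsilon> * S \<le> \<epsilon> * M" using S e0 by simp
      then have "6 * (\<epsilon> * S) \<le> 1" using eM by linarith
      then have "(6 * (\<epsilon> * S))\<^sup>2 * v\<^sup>2 \<le> 1 * (v0 * v)"
        by (intro mult_mono vv power_le_one) (use e0 S in auto)
      then show ?thesis by (simp add: power_mult_distrib mult_ac)
    qed
    have "(4 * (b * v) + 10 * \<theta> + 6 * (\<epsilon> * (v * S)))\<^sup>2 \<le> 3 * (v0 * v + 1600 * (v0 * v) + v0 * v)"
      by (rule order_trans[OF sq3 mult_left_mono[OF add_mono[OF add_mono[OF A B] C]]]) simp
    also have "\<dots> = (4806 * v0) * v" by simp
    also have "\<dots> \<le> (\<epsilon>\<^sup>2 / 256) * v" using v by (intro mult_right_mono) auto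
    also have "\<dots> = 4 * (\<epsilon> * v / 16) * (b / 8)" by (simp add: b power2_eq_square)
    finally show "(4 * (b * v) + 10 * \<theta> + 6 * (\<epsilon> * (v * S)))\<^sup>2 \<le> 4 * (\<epsilon> * v / 16) * (b / 8)" .
  qed (use e0 v b in auto)
  have PQ2: "(2 * R * z / S) * (S * Q) * \<Psi> \<le> \<epsilon> * v / 16 * (S * Q)\<^sup>2 + B * z / 4 * \<Psi>\<^sup>2"
  proof (rule absorb)
    have "(2 * R * z / S)\<^sup>2 = (4 * R\<^sup>2 / S\<^sup>2 * z) * z" by (simp add: power2_eq_square)
    also have "\<dots> \<le> (4 * R\<^sup>2 / S\<^sup>2 * z) * v" using z by (intro mult_left_mono) auto
    also have "\<dots> = 4 * (\<epsilon> * v / 16) * (B * z / 4)" using e0 S by (simp add: B field_simps)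
    finally show "(2 * R * z / S)\<^sup>2 \<le> 4 * (\<epsilon> * v / 16) * (B * z / 4)" .
  qed (use e0 v B0 z in auto)
  have PY1: "(10 * (\<theta> * S) + 2 * \<theta> + 12 * (\<epsilon> * (v * S))) * Y * \<Psi> \<le> v / 16 * Y\<^sup>2 + b / 8 * \<Psi>\<^sup>2"
  proof (rule absorb)
    have M1: "1 \<le> M\<^sup>2" "S\<^sup>2 \<le> M\<^sup>2" using M2 S by (auto intro: power_mono)
    have vvp: "0 \<le> v0 * v" using v by simp
    have A: "(10 * (\<theta> * S))\<^sup>2 \<le> 1600 * (v0 * v * M\<^sup>2)"
    proof -
      have "\<theta>\<^sup>2 * S\<^sup>2 \<le> 16 * v0 * v * M\<^sup>2" by (rule mult_mono[OF \<theta>(3) M1(2)]) (use v v0 in auto)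
      then show ?thesis by (simp add: power_mult_distrib mult_ac)
    qed
    have B: "(2 * \<theta>)\<^sup>2 \<le> 64 * (v0 * v * M\<^sup>2)"
    proof -
      have "\<theta>\<^sup>2 * 1 \<le> 16 * v0 * v * M\<^sup>2" by (rule mult_mono[OF \<theta>(3) M1(1)]) (use v v0 in auto)
      then show ?thesis by (simp add: power_mult_distrib mult_ac)
    qed
    have C: "(12 * (\<epsilon> * (v * S)))\<^sup>2 \<le> v0 * v * M\<^sup>2"
    proof -
      have "(12 * \<epsilon>)\<^sup>2 * (v\<^sup>2 * S\<^sup>2) \<le> 1 * (v0 * v * M\<^sup>2)"
        by (intro mult_mono vv M1 power_le_one) (use e0 e1 vvp in auto)
      then show ?thesis by (simp add: power_mult_distrib)
    qed
    have "(10 * (\<theta> * S) + 2 * \<theta> + 12 * (\<epsilon> * (v * S)))\<^sup>2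
        \<le> 3 * (1600 * (v0 * v * M\<^sup>2) + 64 * (v0 * v * M\<^sup>2) + v0 * v * M\<^sup>2)"
      by (rule order_trans[OF sq3 mult_left_mono[OF add_mono[OF add_mono[OF A B] C]]]) simp
    also have "\<dots> = (4995 * v0) * (v * M\<^sup>2)" by simp
    also have "\<dots> \<le> (\<epsilon>\<^sup>2 / 2) * (v * M\<^sup>2)" using v by (intro mult_right_mono) auto
    also have "\<dots> = v * \<epsilon> * (\<epsilon> * M\<^sup>2) / 2" by (simp add: power2_eq_square)
    also have "\<dots> = 4 * (v / 16) * (b / 8)" by (simp add: eM2 b)
    finally show "(10 * (\<theta> * S) + 2 * \<theta> + 12 * (\<epsilon> * (v * S)))\<^sup>2 \<le> 4 * (v / 16) * (b / 8)" .
  qed (use e0 v b in auto)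
  have PY2: "(2 * B * z * v * S) * Y * \<Psi> \<le> v / 16 * Y\<^sup>2 + B * z / 4 * \<Psi>\<^sup>2"
  proof (rule absorb)
    have "64 * (B * S\<^sup>2) * (z * v) \<le> 1"
    proof -
      have "B * S\<^sup>2 * \<epsilon> = 64 * R\<^sup>2" using e0 S by (simp add: B)
      also have "\<dots> \<le> 64 * M\<^sup>2" using R by (auto intro: power_mono)
      finally have "B * S\<^sup>2 * \<epsilon> * \<epsilon> \<le> 64 * M\<^sup>2 * \<epsilon>" using e0 by (intro mult_right_mono) auto
      also have "\<dots> = 1/2" using eM2 by (simp add: mult.commute)
      finally have 1: "B * S\<^sup>2 * \<epsilon>\<^sup>2 \<le> 1/2" by (simp add: power2_eq_square mult.assoc)
      have "z * v \<le> v0 * 1" using z v v1 by (intro mult_mono) auto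
      then have "64 * (z * v) \<le> \<epsilon>\<^sup>2" using v(3) v0 by linarith
      then have "B * S\<^sup>2 * (64 * (z * v)) \<le> B * S\<^sup>2 * \<epsilon>\<^sup>2" using B0 by (intro mult_left_mono) auto
      then show ?thesis using 1 by (simp add: mult_ac)
    qed
    then have "64 * (B * S\<^sup>2) * (z * v) * (B * z * v / 16) \<le> 1 * (B * z * v / 16)"
      using B0 z v by (intro mult_right_mono) auto
    then show "(2 * B * z * v * S)\<^sup>2 \<le> 4 * (v / 16) * (B * z / 4)"
      by (simp add: power_mult_distrib power2_eq_square mult_ac)
  qed (use v B0 z in auto)
  have PP: "8 * B * z * (v * S) * \<Psi>\<^sup>2 \<le> B * z / 4 * \<Psi>\<^sup>2"
  proof (rule mult_right_mono)
    have "B * z * (32 * (v * S)) \<le> B * z * 1"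
      using vS v0M e1 B0 z by (intro mult_left_mono) auto
    then show "8 * B * z * (v * S) \<le> B * z / 4" by simp
  qed simp
  have "b * (v * (S * ((Y + 4 * \<Psi>) * Q))) + 2 * R * z * (\<Psi> * Q) + 2 * \<theta> * (Y * f + Y * \<Psi> + f * Q)
      + \<epsilon> * v * (2 * Y\<^sup>2 + M * (S * (Y * Q)) + (2 * Y + S * Q) * (6 * (S * \<Psi>) + 4 * (v * (S * Y))))
      + B * (2 * (z * (v * (S * ((Y + 4 * \<Psi>) * \<Psi>)))))
    = v * ((b + 8 * \<theta> + \<epsilon> * M + 4 * (\<epsilon> * (v * S))) * Y * (S * Q))
      + v * ((2 * \<epsilon> + 8 * (\<theta> * S) + 8 * (\<epsilon> * (v * S))) * Y\<^sup>2)
      + (4 * (b * v) + 10 * \<theta> + 6 * (\<epsilon> * (v * S))) * (S * Q) * \<Psi>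
      + 2 * R * z * (\<Psi> * Q)
      + (10 * (\<theta> * S) + 2 * \<theta> + 12 * (\<epsilon> * (v * S))) * Y * \<Psi>
      + (2 * B * z * v * S) * Y * \<Psi> + 8 * B * z * (v * S) * \<Psi>\<^sup>2" (is "?err = _")
    unfolding f_def by (simp add: algebra_simps power2_eq_square)
  moreover have "2 * R * z * (\<Psi> * Q) = (2 * R * z / S) * (S * Q) * \<Psi>" using S by simp
  ultimately have "?err \<le> v * (1/16 * Y\<^sup>2 + \<epsilon> / 8 * (S * Q)\<^sup>2) + v * (1/16 * Y\<^sup>2)
      + (\<epsilon> * v / 16 * (S * Q)\<^sup>2 + b / 8 * \<Psi>\<^sup>2) + (\<epsilon> * v / 16 * (S * Q)\<^sup>2 + B * z / 4 * \<Psi>\<^sup>2)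
      + (v / 16 * Y\<^sup>2 + b / 8 * \<Psi>\<^sup>2) + (v / 16 * Y\<^sup>2 + B * z / 4 * \<Psi>\<^sup>2) + B * z / 4 * \<Psi>\<^sup>2"
    using mult_left_mono[OF YQ, of v] mult_left_mono[OF YY, of v] PQ1 PQ2 PY1 PY2 PP v by linarith
  also have "\<dots> = 1/4 * (v * Y\<^sup>2) + 1/4 * (\<epsilon> * v * (S * Q)\<^sup>2) + 1/4 * (b * \<Psi>\<^sup>2) + 3/4 * (B * z * \<Psi>\<^sup>2)"
    by (simp add: algebra_simps)
  finally have err: "?err \<le> 1/4 * (v * Y\<^sup>2) + 1/4 * (\<epsilon> * v * (S * Q)\<^sup>2) + 1/4 * (b * \<Psi>\<^sup>2) + 3/4 * (B * z * \<Psi>\<^sup>2)" .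
  have "v * Y\<^sup>2 / 16 + \<epsilon> * v * (S * Q)\<^sup>2 / 16 + b * \<Psi>\<^sup>2 / 4
    \<le> (b * \<Psi>\<^sup>2 + 1/2 * (v * Y\<^sup>2) + 1/2 * (\<epsilon> * v * (S * Q)\<^sup>2) + 3/4 * (B * z * \<Psi>\<^sup>2))
      - (1/4 * (v * Y\<^sup>2) + 1/4 * (\<epsilon> * v * (S * Q)\<^sup>2) + 1/4 * (b * \<Psi>\<^sup>2) + 3/4 * (B * z * \<Psi>\<^sup>2))"
  proof -
    have "0 \<le> v * Y\<^sup>2" "0 \<le> \<epsilon> * v * (S * Q)\<^sup>2" "0 \<le> b * \<Psi>\<^sup>2" using v e0 b by auto
    then show ?thesis by linarith
  qed
  also have "\<dots> \<le> (b * \<Psi>\<^sup>2 + 1/2 * (v * Y\<^sup>2) + 1/2 * (\<epsilon> * v * (S * Q)\<^sup>2) + 3/4 * (B * z * \<Psi>\<^sup>2)) - ?err"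
    using err by (intro diff_left_mono)
  also have "\<dots> = b * \<Psi>\<^sup>2 - b * (v * (S * ((Y + 4 * \<Psi>) * Q))) - 2 * R * z * (\<Psi> * Q) + v / 2 * Y\<^sup>2
      - 2 * \<theta> * (Y * f + Y * \<Psi> + f * Q)
      + \<epsilon> * v * ((S * Q)\<^sup>2 / 2 - 2 * Y\<^sup>2 - M * (S * (Y * Q)) - (2 * Y + S * Q) * (6 * (S * \<Psi>) + 4 * (v * (S * Y))))
      + B * (3/4 * z * \<Psi>\<^sup>2 - 2 * (z * (v * (S * ((Y + 4 * \<Psi>) * \<Psi>)))))"
    by (simp add: algebra_simps)
  finally show ?thesis .
qed

text \<open>The bookkeeping by which the terms that are not small relative to \<open>|s|\<^sup>2\<close> disappear. The unknown
  \<open>y = p + 2 K \<psi>\<close> satisfies the fast equation without the forcing \<open>2 \<psi>\<close>, up to terms with a factor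
  \<open>s\<close>. The form \<open>Re (\<psi> * cnj q / s)\<close> then produces \<open>vh Re (y * cnj q) - 2 vh K Re (\<psi> * cnj q)\<close>.
  The first part is cancelled by the weight \<open>\<theta>\<close>, which leaves \<open>vh |y|\<^sup>2 / 2\<close> and nonnegative terms.
  In the second part \<open>vh K\<close> is replaced by its limit, which makes it the derivative of \<open>- k |q|\<^sup>2\<close>; the
  remainder is bounded by the gap \<open>z\<close>, and is charged to the dissipation that \<open>- B z |\<psi>|\<^sup>2\<close> gains
  from the decay of the gap. Finally \<open>\<epsilon> vh |y - s q / 2|\<^sup>2\<close> trades a little of the dissipation in \<open>y\<close>
  for dissipation of order \<open>|s|\<^sup>2\<close> in \<open>q\<close>, through the forcing \<open>- s q\<close> of \<open>y\<close>. The functional is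
  nonnegative at the boundary when \<open>\<psi>\<close> and \<open>\<theta>\<close> vanish there.\<close>

lemma low_frequency_dissipation:
  fixes s i q \<psi> y :: complex and C M R \<epsilon> b B v v0 sl n K k z \<theta> :: real
  assumes M: "4 \<le> M" "2 + norm s + C \<le> M" and \<epsilon>: "\<epsilon> = 1 / (128 * M\<^sup>2)" and b: "b = \<epsilon> / 8"
    and s: "i * s = 1" "Re s \<ge> 0" and R: "0 \<le> R" "R \<le> M" and B: "B = 64 * R\<^sup>2 / (\<epsilon> * (norm s)\<^sup>2)"
    and v: "0 < v" "v \<le> v0" "2000000 * v0 \<le> \<epsilon>\<^sup>2" and z: "0 \<le> z" "z \<le> v"
    and sl: "3/4 * z \<le> sl" "sl \<le> v" and n: "3/4 \<le> n" "n \<le> C" and K: "0 \<le> K" "K \<le> 2"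
    and k: "\<bar>v * K - k\<bar> \<le> R * z"
    and \<theta>: "0 \<le> \<theta>" "\<theta> \<le> 4 * v0" "\<theta>\<^sup>2 \<le> 16 * v0 * v"
  defines "p \<equiv> y - (2 * K) *\<^sub>R \<psi>"
  defines "\<psi>' \<equiv> v *\<^sub>R (s * p)"
  defines "y' \<equiv> s * y + n *\<^sub>R y - s * q + ((2 * K * v) *\<^sub>R (s * p) - (2 * K) *\<^sub>R (s * \<psi>))"
  defines "\<xi> \<equiv> y - (1/2) *\<^sub>R (s * q)"
  defines "\<xi>' \<equiv> y' - (1/2) *\<^sub>R (s * \<psi>)"
  shows "v * (norm y)\<^sup>2 / 16 + \<epsilon> * v * (norm s * norm q)\<^sup>2 / 16 + b * (norm \<psi>)\<^sup>2 / 4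
    \<le> (inner (i * \<psi>) \<psi> + inner (i * \<psi>') q) + b * (inner \<psi> \<psi> + inner \<psi>' q)
      + ((v / 2 - n * \<theta>) * (inner y y - 2 * inner y q) + \<theta> * (2 * inner y y' - 2 * (inner y \<psi> + inner y' q)))
      + \<epsilon> * (- sl * inner \<xi> \<xi> + v * (2 * inner \<xi> \<xi>'))
      + k * (2 * inner q \<psi>)
      - B * (- sl * inner \<psi> \<psi> + z * (2 * inner \<psi> \<psi>'))"
proof -
  define S Q Y \<Psi> where "S = norm s" "Q = norm q" "Y = norm y" "\<Psi> = norm \<psi>"
  note d = S_Q_Y_\<Psi>_def
  have nn: "0 \<le> Q" "0 \<le> Y" "0 \<le> \<Psi>" by (auto simp: d)
  have S: "0 < S" using s by (auto simp: d)
  have SM: "2 + S + C \<le> M" "S \<le> M" using M n by (auto simp: d)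
  have M2: "16 \<le> M\<^sup>2" using power_mono[OF M(1), of 2] by simp
  have e0: "0 < \<epsilon>" using M2 by (auto simp: \<epsilon>)
  have e1: "\<epsilon> \<le> 1/2048"
    unfolding \<epsilon> using M2 frac_le[of 1 1 2048 "128 * M\<^sup>2"] by simp
  have "\<epsilon>\<^sup>2 \<le> 1" using e0 e1 by (intro power_le_one) auto
  then have v16: "16 * v \<le> 1" using v by linarith
  have B0: "0 \<le> B" using e0 by (simp add: B)
  have b0: "0 \<le> b" using e0 b by simp
  define F where "F = (2 * K * v) *\<^sub>R (s * p) - (2 * K) *\<^sub>R (s * \<psi>)"
  define f where "f = 5 * (S * \<Psi>) + 4 * (v * (S * Y))"
  have np: "norm p \<le> Y + 4 * \<Psi>"
  proof -
    have "norm p \<le> norm y + norm ((2 * K) *\<^sub>R \<psi>)" unfolding p_def by (rule norm_triangle_ineq4)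
    moreover have "norm ((2 * K) *\<^sub>R \<psi>) \<le> 4 * \<Psi>"
      using K nn by (auto simp: d intro!: mult_right_mono)
    ultimately show ?thesis by (simp add: d)
  qed
  have n\<psi>': "norm \<psi>' \<le> v * (S * (Y + 4 * \<Psi>))"
    unfolding \<psi>'_def using np v S by (auto simp: norm_mult d intro!: mult_left_mono)
  have nF: "norm F \<le> f"
  proof -
    have "norm F \<le> norm ((2 * K * v) *\<^sub>R (s * p)) + norm ((2 * K) *\<^sub>R (s * \<psi>))"
      unfolding F_def by (rule norm_triangle_ineq4)
    moreover have "norm ((2 * K * v) *\<^sub>R (s * p)) \<le> (4 * v) * (S * (Y + 4 * \<Psi>))"
    proof -
      have "(2 * K * v) * (S * norm p) \<le> (4 * v) * (S * (Y + 4 * \<Psi>))"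
        using K v np S nn by (intro mult_mono mult_left_mono) auto
      then show ?thesis using K v by (simp add: norm_mult d)
    qed
    moreover have "norm ((2 * K) *\<^sub>R (s * \<psi>)) \<le> 4 * (S * \<Psi>)"
      using K S nn by (auto simp: norm_mult d intro!: mult_right_mono)
    moreover have "16 * v * (S * \<Psi>) \<le> 1 * (S * \<Psi>)" using v16 S nn by (intro mult_right_mono) auto
    ultimately show ?thesis unfolding f_def by (simp add: algebra_simps)
  qed
  have f0: "0 \<le> f" using nF norm_ge_zero order_trans by blast
  have innRes: "inner w (s * w) = Re s * (norm w)\<^sup>2" "inner (s * w) w = Re s * (norm w)\<^sup>2" for w
    unfolding cmod_power2 by (simp_all add: inner_complex_def algebra_simps power2_eq_square)
  have innss: "inner (s * w) (s * w) = (S * norm w)\<^sup>2" for w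
    by (simp add: dot_square_norm norm_mult d)
  have T0: "0 \<le> inner (i * \<psi>) \<psi>"
  proof -
    have i0: "i \<noteq> 0" using s by auto
    have "s = inverse i" using s i0 by (simp add: field_simps)
    then have "0 \<le> Re i / ((Re i)\<^sup>2 + (Im i)\<^sup>2)" using s(2) by simp
    moreover have "0 < (Re i)\<^sup>2 + (Im i)\<^sup>2" using i0 by (simp add: complex_neq_0)
    ultimately have "0 \<le> Re i" by (simp add: zero_le_divide_iff)
    moreover have "inner (i * \<psi>) \<psi> = Re i * (norm \<psi>)\<^sup>2"
      unfolding cmod_power2 by (simp add: inner_complex_def algebra_simps power2_eq_square)
    ultimately show ?thesis by simp
  qed
  \<comment> \<open>Replacing v * K by its limit k leaves only the gap times \<Psi> * Q.\<close>
  have T1: "inner (i * \<psi>') q + k * (2 * inner q \<psi>) \<ge> v * inner y q - 2 * R * z * (\<Psi> * Q)"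
  proof -
    have e: "i * \<psi>' = v *\<^sub>R p" unfolding \<psi>'_def using s(1) by (simp add: mult.assoc[symmetric])
    have "inner (i * \<psi>') q + k * (2 * inner q \<psi>) = v * inner y q - 2 * ((v * K - k) * inner \<psi> q)"
      unfolding e p_def by (simp add: inner_diff_left algebra_simps inner_commute)
    moreover have "(v * K - k) * inner \<psi> q \<le> (R * z) * (\<Psi> * Q)"
    proof -
      have "\<bar>(v * K - k) * inner \<psi> q\<bar> \<le> (R * z) * (\<Psi> * Q)"
        unfolding abs_mult using k Cauchy_Schwarz_ineq2[of \<psi> q] R z by (intro mult_mono) (auto simp: d)
      then show ?thesis by linarith
    qed
    ultimately show ?thesis by simp
  qed
  have T2: "b * (inner \<psi> \<psi> + inner \<psi>' q) \<ge> b * \<Psi>\<^sup>2 - b * (v * (S * ((Y + 4 * \<Psi>) * Q)))"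
  proof -
    have "- inner \<psi>' q \<le> norm \<psi>' * Q" using inner_bound(1)[of \<psi>' q] by (simp add: d)
    also have "\<dots> \<le> v * (S * (Y + 4 * \<Psi>)) * Q" using n\<psi>' nn by (intro mult_right_mono) auto
    finally have "inner \<psi> \<psi> + inner \<psi>' q \<ge> \<Psi>\<^sup>2 - v * (S * ((Y + 4 * \<Psi>) * Q))"
      by (simp add: dot_square_norm d mult.assoc)
    from mult_left_mono[OF this b0] show ?thesis by (simp add: right_diff_distrib)
  qed
  have y': "y' = s * y + n *\<^sub>R y - s * q + F" by (simp add: y'_def F_def)
  have cross: "inner y (s * q) + inner (s * y) q = 2 * (Re s * inner y q)"
    by (simp add: inner_complex_def algebra_simps)
  \<comment> \<open>The terms with Re s combine to a multiple of the square of norm (y - q).\<close>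
  have T3: "(v / 2 - n * \<theta>) * (inner y y - 2 * inner y q) + \<theta> * (2 * inner y y' - 2 * (inner y \<psi> + inner y' q))
     \<ge> v / 2 * Y\<^sup>2 - v * inner y q - 2 * \<theta> * (Y * f + Y * \<Psi> + f * Q)"
  proof -
    have a1: "inner y y' = Re s * Y\<^sup>2 + n * Y\<^sup>2 - inner y (s * q) + inner y F"
      unfolding y' by (simp add: inner_add_right inner_diff_right innRes dot_square_norm d)
    have a2: "inner y' q = inner (s * y) q + n * inner y q - Re s * Q\<^sup>2 + inner F q"
      unfolding y' by (simp add: inner_add_left inner_diff_left innRes d)
    have "(v / 2 - n * \<theta>) * (inner y y - 2 * inner y q) + \<theta> * (2 * inner y y' - 2 * (inner y \<psi> + inner y' q))
      = v / 2 * Y\<^sup>2 - v * inner y q + \<theta> * (n * Y\<^sup>2 + 2 * (Re s * (norm (y - q))\<^sup>2))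
        + 2 * \<theta> * (inner y F - inner y \<psi> - inner F q)"
    proof -
      have 1: "(norm (y - q))\<^sup>2 = Y\<^sup>2 - 2 * inner y q + Q\<^sup>2"
        by (simp add: d flip: dot_square_norm add: inner_diff_left inner_diff_right inner_commute)
      have 2: "inner (s * y) q = 2 * (Re s * inner y q) - inner y (s * q)" using cross by simp
      show ?thesis unfolding a1 a2 1 2 by (simp add: dot_square_norm d algebra_simps)
    qed
    moreover have "0 \<le> \<theta> * (n * Y\<^sup>2 + 2 * (Re s * (norm (y - q))\<^sup>2))"
      using \<theta> n s by (intro mult_nonneg_nonneg add_nonneg_nonneg) auto
    moreover have "2 * \<theta> * (- (Y * f + Y * \<Psi> + f * Q)) \<le> 2 * \<theta> * (inner y F - inner y \<psi> - inner F q)"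
    proof (rule mult_left_mono)
      have "- inner y F \<le> Y * f"
        using inner_bound(1)[of y F] mult_left_mono[OF nF nn(2)] by (simp add: d)
      moreover have "inner F q \<le> f * Q"
        using inner_bound(2)[of F q] mult_right_mono[OF nF nn(1)] by (simp add: d)
      moreover have "inner y \<psi> \<le> Y * \<Psi>" using inner_bound(2)[of y \<psi>] by (simp add: d)
      ultimately show "- (Y * f + Y * \<Psi> + f * Q) \<le> inner y F - inner y \<psi> - inner F q" by linarith
    qed (use \<theta> in auto)
    moreover have "2 * \<theta> * (- (Y * f + Y * \<Psi> + f * Q)) = - (2 * \<theta> * (Y * f + Y * \<Psi> + f * Q))" by (simp add: algebra_simps)
    ultimately show ?thesis by linarith
  qed
  have T4: "- sl * inner \<xi> \<xi> + v * (2 * inner \<xi> \<xi>')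
     \<ge> v * ((S * Q)\<^sup>2 / 2 - 2 * Y\<^sup>2 - M * (S * (Y * Q)) - (2 * Y + S * Q) * (6 * (S * \<Psi>) + 4 * (v * (S * Y))))"
  proof -
    have n\<xi>: "norm \<xi> \<le> Y + S * Q / 2"
      unfolding \<xi>_def d by (rule order_trans[OF norm_triangle_ineq4]) (simp add: norm_mult)
    have "(norm \<xi>)\<^sup>2 \<le> (Y + S * Q / 2)\<^sup>2" by (rule power_mono[OF n\<xi>]) simp
    also have "\<dots> \<le> 2 * Y\<^sup>2 + (S * Q)\<^sup>2 / 2"
      using zero_le_power2[of "Y - S * Q / 2"] by (simp add: power2_eq_square algebra_simps)
    finally have "sl * inner \<xi> \<xi> \<le> v * (2 * Y\<^sup>2 + (S * Q)\<^sup>2 / 2)"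
      using sl v z by (intro mult_mono) (auto simp: dot_square_norm)
    moreover have "inner \<xi> \<xi>' \<ge> (S * Q)\<^sup>2 / 2 - M / 2 * (S * (Y * Q)) - (Y + S * Q / 2) * (6 * (S * \<Psi>) + 4 * (v * (S * Y)))"
    proof -
      define G where "G = F - (1/2) *\<^sub>R (s * \<psi>)"
      have xi': "\<xi>' = s * y + n *\<^sub>R y - s * q + G" by (simp add: \<xi>'_def y' G_def)
      have "norm G \<le> norm F + norm ((1/2) *\<^sub>R (s * \<psi>))" unfolding G_def by (rule norm_triangle_ineq4)
      then have nG: "norm G \<le> 6 * (S * \<Psi>) + 4 * (v * (S * Y))"
      proof -
        have "norm ((1/2) *\<^sub>R (s * \<psi>)) = S * \<Psi> / 2" by (simp add: norm_mult d)
        moreover have "0 \<le> S * \<Psi>" using S nn by simp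
        ultimately show ?thesis
          using nF \<open>norm G \<le> norm F + norm ((1/2) *\<^sub>R (s * \<psi>))\<close> unfolding f_def by linarith
      qed
      have g1: "- inner \<xi> G \<le> (Y + S * Q / 2) * (6 * (S * \<Psi>) + 4 * (v * (S * Y)))"
      proof -
        have "- inner \<xi> G \<le> norm \<xi> * norm G" using inner_bound(1)[of \<xi> G] by simp
        also have "\<dots> \<le> (Y + S * Q / 2) * (6 * (S * \<Psi>) + 4 * (v * (S * Y)))"
          using n\<xi> nG nn S by (intro mult_mono) auto
        finally show ?thesis .
      qed
      have "inner \<xi> \<xi>' = Re s * Y\<^sup>2 + n * Y\<^sup>2 - inner y (s * q)
          - 1/2 * inner (s * q) (s * y) - 1/2 * (n * inner (s * q) y) + 1/2 * (S * Q)\<^sup>2 + inner \<xi> G"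
        unfolding xi' by (simp add: inner_add_right inner_diff_right)
          (simp add: \<xi>_def inner_diff_left innRes innss dot_square_norm d ring_distribs norm_mult)
      moreover have "0 \<le> Re s * Y\<^sup>2" "0 \<le> n * Y\<^sup>2" using s n by auto
      moreover have "inner y (s * q) \<le> S * (Y * Q)"
        using inner_bound(2)[of y "s * q"] by (simp add: norm_mult d mult_ac)
      moreover have "inner (s * q) (s * y) \<le> S * (S * (Y * Q))"
        using inner_bound(2)[of "s * q" "s * y"] by (simp add: norm_mult d mult_ac)
      moreover have "n * inner (s * q) y \<le> C * (S * (Y * Q))"
      proof -
        have "n * inner (s * q) y \<le> n * (S * (Y * Q))"
          using inner_bound(2)[of "s * q" y] n by (intro mult_left_mono) (auto simp: norm_mult d mult_ac)
        also have "\<dots> \<le> C * (S * (Y * Q))" using n nn S by (intro mult_right_mono) auto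
        finally show ?thesis .
      qed
      moreover have "(2 + S + C) * (S * (Y * Q)) \<le> M * (S * (Y * Q))"
        using SM nn S by (intro mult_right_mono) auto
      ultimately show ?thesis using g1 by (simp add: algebra_simps)
    qed
    then have "v * (2 * inner \<xi> \<xi>') \<ge> v * (2 * ((S * Q)\<^sup>2 / 2 - M / 2 * (S * (Y * Q)) - (Y + S * Q / 2) * (6 * (S * \<Psi>) + 4 * (v * (S * Y)))))"
      using v by (intro mult_left_mono) auto
    moreover have "v * (2 * (u / 2 - M / 2 * w - (Y + S * Q / 2) * g)) - v * (2 * Y\<^sup>2 + u / 2)
        = v * (u / 2 - 2 * Y\<^sup>2 - M * w - (2 * Y + S * Q) * g)" for u w g
      by (simp add: algebra_simps)
    moreover have "r \<le> - sl * X + Z" if "sl * X \<le> a1" "a2 \<le> Z" "a2 - a1 = r" for X Z a1 a2 r :: real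
      using that by simp
    ultimately show ?thesis by metis
  qed
  have T5: "- (- sl * inner \<psi> \<psi> + z * (2 * inner \<psi> \<psi>')) \<ge> 3/4 * z * \<Psi>\<^sup>2 - 2 * (z * (v * (S * ((Y + 4 * \<Psi>) * \<Psi>))))"
  proof -
    have "3/4 * z * \<Psi>\<^sup>2 \<le> sl * \<Psi>\<^sup>2" using sl by (intro mult_right_mono) auto
    moreover have "inner \<psi> \<psi>' \<le> v * (S * ((Y + 4 * \<Psi>) * \<Psi>))"
    proof -
      have "inner \<psi> \<psi>' \<le> norm \<psi>' * \<Psi>" using inner_bound(2)[of \<psi> \<psi>'] by (simp add: d mult.commute)
      also have "\<dots> \<le> v * (S * (Y + 4 * \<Psi>)) * \<Psi>" using n\<psi>' nn by (intro mult_right_mono) auto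
      finally show ?thesis by (simp add: mult.assoc)
    qed
    from mult_left_mono[OF this z(1)]
    have "z * (2 * inner \<psi> \<psi>') \<le> 2 * (z * (v * (S * ((Y + 4 * \<Psi>) * \<Psi>))))"
      unfolding mult.left_commute[of z 2] by linarith
    moreover have "inner \<psi> \<psi> = \<Psi>\<^sup>2" by (simp add: dot_square_norm d)
    moreover have "u - w \<le> - (- sl * a + t)" if "u \<le> sl * a" "t \<le> w" for u w t a :: real
      using that by simp
    ultimately show ?thesis by metis
  qed
  have "v * Y\<^sup>2 / 16 + \<epsilon> * v * (S * Q)\<^sup>2 / 16 + b * \<Psi>\<^sup>2 / 4
    \<le> b * \<Psi>\<^sup>2 - b * (v * (S * ((Y + 4 * \<Psi>) * Q))) - 2 * R * z * (\<Psi> * Q) + v / 2 * Y\<^sup>2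
      - 2 * \<theta> * (Y * f + Y * \<Psi> + f * Q)
      + \<epsilon> * v * ((S * Q)\<^sup>2 / 2 - 2 * Y\<^sup>2 - M * (S * (Y * Q)) - (2 * Y + S * Q) * (6 * (S * \<Psi>) + 4 * (v * (S * Y))))
      + B * (3/4 * z * \<Psi>\<^sup>2 - 2 * (z * (v * (S * ((Y + 4 * \<Psi>) * \<Psi>)))))"
    unfolding f_def
    by (rule low_frequency_absorption[OF M(1) \<epsilon> b S SM(2) R B[folded S_Q_Y_\<Psi>_def(1)] v z \<theta> nn])
  also have "\<dots> \<le> (inner (i * \<psi>) \<psi> + inner (i * \<psi>') q) + b * (inner \<psi> \<psi> + inner \<psi>' q)
      + ((v / 2 - n * \<theta>) * (inner y y - 2 * inner y q) + \<theta> * (2 * inner y y' - 2 * (inner y \<psi> + inner y' q)))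
      + \<epsilon> * (- sl * inner \<xi> \<xi> + v * (2 * inner \<xi> \<xi>'))
      + k * (2 * inner q \<psi>)
      + B * (- (- sl * inner \<psi> \<psi> + z * (2 * inner \<psi> \<psi>')))"
    using T0 T1 T2 T3 mult_left_mono[OF T4 less_imp_le[OF e0]] mult_left_mono[OF T5 B0]
    by (simp only: mult.assoc)
  finally show ?thesis unfolding d by (simp only: mult_minus_right diff_conv_add_uminus)
qed

context inflow_layer
begin

text \<open>Large enough to dominate \<open>2 + |s| + C\<close> for every frequency that the high-frequency estimate leaves
  over, as well as the constant of \<open>vK_near_limit\<close>.\<close>

definition M :: real where "M = 256 * C\<^sup>2 + C + 2"

lemma low_frequency_rigidity:
  assumes mode: "decaying_mode s q \<psi> p" and s: "Re s \<ge> 0" "s \<noteq> 0" "norm s \<le> 256 * C\<^sup>2"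
    and v0: "2000000 * v0 \<le> (1 / (128 * M\<^sup>2))\<^sup>2" and bc: "\<psi> 0 = 0" and x: "x > 0"
  shows "q x = 0 \<and> \<psi> x = 0 \<and> p x = 0"
proof -
  define R where "R = 8 * C\<^sup>2"
  define \<epsilon> where "\<epsilon> = 1 / (128 * M\<^sup>2)"
  define b where "b = \<epsilon> / 8"
  define B where "B = 64 * R\<^sup>2 / (\<epsilon> * (norm s)\<^sup>2)"
  define i where "i = 1 / s"
  have C2: "4 \<le> C\<^sup>2" using power_mono[OF C_ge, of 2] by simp
  have M4: "4 \<le> M" "2 + norm s + C \<le> M" and R: "0 \<le> R" "R \<le> M"
    using C2 C_ge s(3) by (auto simp: M_def R_def)
  have e0: "0 < \<epsilon>" using M4 by (simp add: \<epsilon>_def)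
  have b0: "0 < b" using e0 by (simp add: b_def)
  have is1: "i * s = 1" using s by (simp add: i_def)
  have v0e: "2000000 * v0 \<le> \<epsilon>\<^sup>2" using v0 by (simp add: \<epsilon>_def)
  define y where "y = (\<lambda>x. p x + (2 * K x) *\<^sub>R \<psi> x)"
  define \<xi> where "\<xi> = (\<lambda>x. y x - (1/2) *\<^sub>R (s * q x))"
  define \<psi>' where "\<psi>' = (\<lambda>x. vh x *\<^sub>R (s * p x))"
  define y' where "y' = (\<lambda>x. s * y x + N x *\<^sub>R y x - s * q x
      + ((2 * K x * vh x) *\<^sub>R (s * p x) - (2 * K x) *\<^sub>R (s * \<psi> x)))"
  define \<xi>' where "\<xi>' = (\<lambda>x. y' x - (1/2) *\<^sub>R (s * \<psi> x))"
  have dq: "(q has_vector_derivative \<psi> t) (at t within {0..})"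
    and d\<psi>: "(\<psi> has_vector_derivative \<psi>' t) (at t within {0..})"
    and dp: "(p has_vector_derivative s * p t + N t *\<^sub>R p t + 2 *\<^sub>R \<psi> t - s * q t) (at t within {0..})"
    if "t \<ge> 0" for t
    using mode that by (auto simp: decaying_mode_def \<psi>'_def)
  have dy: "(y has_vector_derivative y' t) (at t within {0..})" if t: "t \<ge> 0" for t
  proof -
    have "(y has_vector_derivative (s * p t + N t *\<^sub>R p t + 2 *\<^sub>R \<psi> t - s * q t)
        + ((2 * K t) *\<^sub>R \<psi>' t + (2 * (N t * K t - 1)) *\<^sub>R \<psi> t)) (at t within {0..})"
      unfolding y_def
      by (intro has_vector_derivative_add dp[OF t] has_vector_derivative_scaleR DERIV_cmult K_deriv d\<psi> t)
    moreover have "(s * p t + N t *\<^sub>R p t + 2 *\<^sub>R \<psi> t - s * q t)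
        + ((2 * K t) *\<^sub>R \<psi>' t + (2 * (N t * K t - 1)) *\<^sub>R \<psi> t) = y' t"
      by (simp add: y'_def y_def \<psi>'_def algebra_simps)
    ultimately show ?thesis by simp
  qed
  have d\<xi>: "(\<xi> has_vector_derivative \<xi>' t) (at t within {0..})" if t: "t \<ge> 0" for t
    unfolding \<xi>_def \<xi>'_def
    by (intro has_vector_derivative_diff dy[OF t] bounded_linear.has_vector_derivative[OF bounded_linear_scaleR_right]
        bounded_linear.has_vector_derivative[OF bounded_linear_mult_right] dq[OF t])
  \<comment> \<open>When \<psi> vanishes at the boundary, only the squares of \<xi> and q contribute to E 0.\<close>
  define E where "E = (\<lambda>x. inner (i * \<psi> x) (q x) + b * inner (\<psi> x) (q x)
      + \<theta> x * (inner (y x) (y x) - 2 * inner (y x) (q x)) + \<epsilon> * (vh x * inner (\<xi> x) (\<xi> x))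
      + k_inf * inner (q x) (q x) - B * (gap x * inner (\<psi> x) (\<psi> x)))"
  define D where "D = (\<lambda>x. (inner (i * \<psi> x) (\<psi> x) + inner (i * \<psi>' x) (q x)) + b * (inner (\<psi> x) (\<psi> x) + inner (\<psi>' x) (q x))
      + ((vh x / 2 - N x * \<theta> x) * (inner (y x) (y x) - 2 * inner (y x) (q x))
         + \<theta> x * (2 * inner (y x) (y' x) - 2 * (inner (y x) (\<psi> x) + inner (y' x) (q x))))
      + \<epsilon> * (- slope x * inner (\<xi> x) (\<xi> x) + vh x * (2 * inner (\<xi> x) (\<xi>' x)))
      + k_inf * (2 * inner (q x) (\<psi> x))
      - B * (- slope x * inner (\<psi> x) (\<psi> x) + gap x * (2 * inner (\<psi> x) (\<psi>' x))))"
  have dE: "(E has_real_derivative D t) (at t within {0..})" if t: "t \<ge> 0" for t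
  proof -
    have sq: "((\<lambda>x. inner (w x) (w x)) has_real_derivative 2 * inner (w t) w') (at t within {0..})"
      if "(w has_vector_derivative w') (at t within {0..})" for w :: "real \<Rightarrow> complex" and w'
      by (rule DERIV_cong[OF has_real_derivative_inner[OF that that]]) (simp add: inner_commute)
    have pr: "((\<lambda>x. g x * h x) has_real_derivative g' * h t + g t * h') (at t within {0..})"
      if "(g has_real_derivative g') (at t within {0..})" "(h has_real_derivative h') (at t within {0..})" for g h g' h'
      by (rule DERIV_cong[OF DERIV_mult[OF that]]) simp
    show ?thesis
      unfolding E_def D_def
      by (intro DERIV_add DERIV_diff DERIV_cmult pr sq has_real_derivative_inner d\<psi>[OF t] dq[OF t] dy[OF t] d\<xi>[OF t]
          theta_deriv[OF t] vh_deriv_slope gap_deriv bounded_linear.has_vector_derivative[OF bounded_linear_mult_right])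
  qed
  have diss: "vh t * (norm (y t))\<^sup>2 / 16 + \<epsilon> * vh t * (norm s * norm (q t))\<^sup>2 / 16 + b * (norm (\<psi> t))\<^sup>2 / 4 \<le> D t"
    if t: "t \<ge> 0" for t
  proof -
    have p: "p t = y t - (2 * K t) *\<^sub>R \<psi> t" by (simp add: y_def)
    show ?thesis
      unfolding D_def \<xi>'_def \<xi>_def y'_def \<psi>'_def p
      by (rule low_frequency_dissipation[OF M4 \<epsilon>_def b_def is1 s(1) R B_def profile_range(3)[OF t] profile_range(2)[OF t] v0e
          less_imp_le[OF gap_pos[OF t]] gap_le[OF t] slope_bounds(1)[OF t] slope_le_vh[OF t] N_bounds(1,2)[OF t]
          K_bounds(1,2)[OF t] vK_near_limit[OF t, folded R_def] theta_bounds[OF t]])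
  qed
  have lower: "0 \<le> vh t * (norm (y t))\<^sup>2 / 16" "0 \<le> \<epsilon> * vh t * (norm s * norm (q t))\<^sup>2 / 16" "0 \<le> b * (norm (\<psi> t))\<^sup>2 / 4"
    if t: "t \<ge> 0" for t
    using profile_range(3)[OF t] b0 e0 by auto
  have Dpos: "0 \<le> D t" if t: "t \<ge> 0" for t using diss[OF t] lower[OF t] by linarith
  have lim: "(E \<longlongrightarrow> 0) at_top"
  proof -
    have l: "(q \<longlongrightarrow> 0) at_top" "(\<psi> \<longlongrightarrow> 0) at_top" "(p \<longlongrightarrow> 0) at_top"
      using mode by (auto simp: decaying_mode_def)
    have bdd: "((\<lambda>x. g x *\<^sub>R h x) \<longlongrightarrow> 0) at_top"
      if "(h \<longlongrightarrow> 0) at_top" "\<And>x. x \<ge> 0 \<Longrightarrow> \<bar>g x\<bar> \<le> c" for g :: "real \<Rightarrow> real" and h :: "real \<Rightarrow> 'a::real_normed_vector" and c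
    proof (rule Lim_null_comparison)
      show "\<forall>\<^sub>F x in at_top. norm (g x *\<^sub>R h x) \<le> c * norm (h x)"
        using eventually_ge_at_top[of 0] by eventually_elim (use that in \<open>auto intro!: mult_right_mono\<close>)
      show "((\<lambda>x. c * norm (h x)) \<longlongrightarrow> 0) at_top"
        using tendsto_mult_right_zero[OF tendsto_norm_zero[OF that(1)]] by blast
    qed
    have ly: "(y \<longlongrightarrow> 0) at_top"
      unfolding y_def using tendsto_add[OF l(3) bdd[OF l(2), of "\<lambda>x. 2 * K x" 4]] K_bounds by simp
    have "(\<xi> \<longlongrightarrow> 0 - (1/2) *\<^sub>R (s * 0)) at_top"
      unfolding \<xi>_def by (intro tendsto_intros ly l)
    then have lx: "(\<xi> \<longlongrightarrow> 0) at_top" by simp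
    have "((\<lambda>x. inner (y x) (y x) - 2 * inner (y x) (q x)) \<longlongrightarrow> inner 0 (0::complex) - 2 * inner 0 (0::complex)) at_top"
      by (intro tendsto_intros ly l)
    then have "((\<lambda>x. \<theta> x *\<^sub>R (inner (y x) (y x) - 2 * inner (y x) (q x))) \<longlongrightarrow> 0) at_top"
      by (intro bdd[of _ _ "4 * v0"]) (use theta_bounds in auto)
    then have lt: "((\<lambda>x. \<theta> x * (inner (y x) (y x) - 2 * inner (y x) (q x))) \<longlongrightarrow> 0) at_top" by simp
    have lg: "(gap \<longlongrightarrow> vp - vp) at_top"
      unfolding gap_def[abs_def] by (intro tendsto_intros profile_limit)
    have "(E \<longlongrightarrow> inner (i * 0) 0 + b * inner 0 (0::complex) + 0 + \<epsilon> * (vp * inner 0 (0::complex))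
        + k_inf * inner 0 (0::complex) - B * ((vp - vp) * inner 0 (0::complex))) at_top"
      unfolding E_def by (intro tendsto_intros l lx lt lg profile_limit)
    then show ?thesis by simp
  qed
  have "0 \<le> E 0"
    using bc e0 profile_range(3)[of 0] k_inf_nonneg by (simp add: E_def theta_0)
  then have "D x = 0"
    using lyapunov_rigidity[OF dE Dpos lim _ x] by simp
  then have z: "vh x * (norm (y x))\<^sup>2 / 16 \<le> 0" "\<epsilon> * vh x * (norm s * norm (q x))\<^sup>2 / 16 \<le> 0" "b * (norm (\<psi> x))\<^sup>2 / 4 \<le> 0"
    using diss[of x] lower[of x] x by linarith+
  have "vh x > 0" using profile_range(3) x by simp
  then have "y x = 0" "q x = 0" "\<psi> x = 0"
    using z b0 e0 s by (auto simp: mult_le_0_iff)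
  then show ?thesis by (simp add: y_def)
qed

end

section \<open>Positive real frequencies\<close>

lemma continuous_nonpositive_last:
  fixes m :: "real \<Rightarrow> real"
  assumes "continuous_on {0..} m" "0 \<le> x" "m x \<le> 0" "x \<le> x1" "0 < m x1"
  obtains a where "0 \<le> a" "a < x1" "m a \<le> 0" "\<And>y. a < y \<Longrightarrow> y \<le> x1 \<Longrightarrow> 0 < m y"
proof -
  define A where "A = {0..x1} \<inter> m -` {..0}"
  have "closed A"
    unfolding A_def
    by (rule continuous_closed_preimage) (auto intro: continuous_on_subset[OF assms(1)])
  moreover have "A = {0..x1} \<inter> A" by (auto simp: A_def)
  ultimately have "compact A" using compact_Int_closed[OF compact_Icc, of A 0 x1] by simp
  moreover have "A \<noteq> {}" using assms by (auto simp: A_def)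
  ultimately obtain a where a: "a \<in> A" "\<And>y. y \<in> A \<Longrightarrow> y \<le> a"
    using compact_attains_sup by metis
  show thesis
  proof (rule that[of a])
    show "0 \<le> a" "m a \<le> 0" using a by (auto simp: A_def)
    moreover have "a \<le> x1" using a by (simp add: A_def)
    ultimately show "a < x1" using assms(5) by (cases "a = x1") auto
    show "0 < m y" if "a < y" "y \<le> x1" for y
    proof (rule ccontr)
      assume "\<not> 0 < m y"
      then have "y \<in> A" using that \<open>0 \<le> a\<close> by (simp add: A_def)
      then show False using a(2) that by fastforce
    qed
  qed
qed

text \<open>Two conjugate roots in the left half-plane would leave a positive third root, whereas the product
  of the three roots is negative.\<close>

lemma cubic_root_real:
  fixes \<mu> :: complex and s n v :: real
  assumes "0 < s" "0 < n" "0 < v" "Re \<mu> < 0"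
    and root: "\<mu>^3 = (of_real n + of_real s) * \<mu>\<^sup>2 + 2 * of_real s * of_real v * \<mu> - (of_real s)\<^sup>2 * of_real v"
  shows "Im \<mu> = 0"
proof (rule ccontr)
  assume y0: "Im \<mu> \<noteq> 0"
  define x y where "x = Re \<mu>" "y = Im \<mu>"
  note xy = x_y_def
  have \<mu>: "\<mu> = Complex x y" by (simp add: xy)
  have re: "x^3 - 3 * x * y\<^sup>2 = (n + s) * (x\<^sup>2 - y\<^sup>2) + 2 * s * v * x - s\<^sup>2 * v"
    using arg_cong[OF root, of Re] unfolding \<mu>
    by (simp add: power2_eq_square power3_eq_cube algebra_simps)
  have im: "(3 * x\<^sup>2 - y\<^sup>2) * y = (2 * (n + s) * x + 2 * s * v) * y"
    using arg_cong[OF root, of Im] unfolding \<mu>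
    by (simp add: power2_eq_square power3_eq_cube algebra_simps)
  then have im': "2 * s * v = 3 * x\<^sup>2 - y\<^sup>2 - 2 * (n + s) * x" using y0 by (simp add: xy)
  \<comment> \<open>The third root is \<open>n + s - 2 * x\<close>, and the product of the roots is \<open>- s^2 * v\<close>.\<close>
  have "(n + s - 2 * x) * (x\<^sup>2 + y\<^sup>2) = - (s\<^sup>2 * v)"
    using re unfolding im' by (simp add: power2_eq_square power3_eq_cube algebra_simps)
  moreover have "0 \<le> (n + s - 2 * x) * (x\<^sup>2 + y\<^sup>2)" using assms by (simp add: xy)
  moreover have "0 < s\<^sup>2 * v" using assms by simp
  ultimately show False by linarith
qed

context inflow_layer
begin

text \<open>A bound for \<open>s / t\<close>, uniform as \<open>s\<close> tends to \<open>0\<close>, where \<open>- t\<close> is the decaying root at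
  frequency \<open>s\<close>.\<close>

definition slow_ratio :: real where "slow_ratio = sqrt ((C + 2) / vp)"

definition low_bound :: real where
  "low_bound = (3 / (4 * vp)) / (slow_ratio * (1 + (1 + C) / vp) + (2 + C) / vp + 2 + (1 + C) / vp)"

lemma low_bound_pos: "0 < low_bound"
proof -
  have "0 \<le> slow_ratio" using C_ge vp_pos by (simp add: slow_ratio_def)
  then show ?thesis
    using C_ge vp_pos unfolding low_bound_def
    by (intro divide_pos_pos add_pos_pos add_nonneg_pos mult_nonneg_nonneg) auto
qed

lemma slow_root_bounds:
  assumes s: "0 < s" "s \<le> 1/4" and t: "0 < t"
    and root: "t\<^sup>2 * (t + s + rate vp) = s\<^sup>2 * vp + 2 * s * t * vp"
  shows "t \<le> 1" "s / t \<le> slow_ratio"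
proof -
  have n: "3/4 \<le> rate vp" "rate vp \<le> C" using rate_bounds[of vp] vp_less by auto
  have vp8: "vp \<le> 1/8" using vp_less v0_le by simp
  show t1: "t \<le> 1"
  proof (rule ccontr)
    assume "\<not> t \<le> 1"
    then have t: "1 < t" by simp
    have "t * t * 1 \<le> t * t * (t + s + rate vp)" using t s n by (intro mult_left_mono) auto
    moreover have "s\<^sup>2 * vp \<le> 1 * 1" by (intro mult_mono power_le_one) (use s vp8 vp_pos in auto)
    moreover have "2 * s * t * vp \<le> 2 * (1/4) * t * (1/8)"
      using s t vp8 vp_pos by (intro mult_mono) auto
    moreover have "s * s * vp \<le> 1/4 * (1/4) * (1/8)"
      using s vp8 vp_pos by (intro mult_mono) auto
    moreover have "t < t * t" using t by simp
    ultimately show False using root t unfolding power2_eq_square by linarith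
  qed
  have "vp * s\<^sup>2 \<le> (C + 2) * t\<^sup>2"
  proof -
    have "vp * s\<^sup>2 \<le> t\<^sup>2 * (t + s + rate vp)"
      unfolding root using s t vp_pos by (simp add: mult.commute)
    also have "\<dots> \<le> t\<^sup>2 * (C + 2)" using t1 s n by (intro mult_left_mono) auto
    finally show ?thesis by (simp add: mult.commute)
  qed
  then have "(s / t)\<^sup>2 \<le> (C + 2) / vp"
    using t vp_pos by (simp add: power_divide divide_simps mult.commute)
  then show "s / t \<le> slow_ratio" unfolding slow_ratio_def by (rule real_le_rsqrt)
qed

text \<open>At a real frequency the mode can be taken real, with \<open>exp (t x) \<psi> x\<close> tending to \<open>- 1\<close>.
  The sign pattern \<open>q > 0 > \<psi>\<close>, \<open>P > 0\<close> holds there and persists backward in \<open>x\<close>, as each of the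
  three equations moves its unknown away from zero. Pairing with the left eigenvector of the limit
  system gives a functional that is constant for constant coefficients; the signs make it decrease
  along the layer, because \<open>vh\<close> and \<open>- N\<close> exceed their limits. So the boundary values cannot all be
  small, and two more monotone combinations bound \<open>q 0\<close> and \<open>P 0\<close> by \<open>- \<psi> 0\<close>. The bound does
  not depend on \<open>s\<close>.\<close>

lemma real_mode_lower_bound:
  fixes q \<psi> P :: "real \<Rightarrow> real"
  assumes s: "0 < s" "s \<le> 1/4" and t: "0 < t"
    and root: "t\<^sup>2 * (t + s + rate vp) = s\<^sup>2 * vp + 2 * s * t * vp"
    and dq: "\<And>x. x \<ge> 0 \<Longrightarrow> (q has_real_derivative \<psi> x) (at x within {0..})"
    and d\<psi>: "\<And>x. x \<ge> 0 \<Longrightarrow> (\<psi> has_real_derivative vh x * P x) (at x within {0..})"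
    and dP: "\<And>x. x \<ge> 0 \<Longrightarrow> (P has_real_derivative (s + N x) * P x + 2 * s * \<psi> x - s\<^sup>2 * q x) (at x within {0..})"
    and lq: "((\<lambda>x. exp (t * x) * q x) \<longlongrightarrow> 1 / t) at_top"
    and l\<psi>: "((\<lambda>x. exp (t * x) * \<psi> x) \<longlongrightarrow> - 1) at_top"
    and lP: "((\<lambda>x. exp (t * x) * P x) \<longlongrightarrow> t / vp) at_top"
  shows "low_bound \<le> - \<psi> 0"
proof -
  have n: "3/4 \<le> rate vp" "rate vp \<le> C" using rate_bounds[of vp] vp_less by auto
  have "\<forall>\<^sub>F x in at_top. 0 < exp (t * x) * q x" "\<forall>\<^sub>F x in at_top. exp (t * x) * \<psi> x < 0" "\<forall>\<^sub>F x in at_top. 0 < exp (t * x) * P x"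
    using order_tendstoD(1)[OF lq, of 0] order_tendstoD(2)[OF l\<psi>, of 0] order_tendstoD(1)[OF lP, of 0] t vp_pos by auto
  then have "\<forall>\<^sub>F x in at_top. 0 < q x \<and> \<psi> x < 0 \<and> 0 < P x"
    by eventually_elim (auto simp: zero_less_mult_iff mult_less_0_iff)
  then obtain X where X: "\<And>x. x \<ge> X \<Longrightarrow> 0 < q x \<and> \<psi> x < 0 \<and> 0 < P x"
    unfolding eventually_at_top_linorder by blast
  define m where "m = (\<lambda>x. min (q x) (min (- \<psi> x) (P x)))"
  have m_iff: "0 < m x \<longleftrightarrow> 0 < q x \<and> \<psi> x < 0 \<and> 0 < P x" for x by (auto simp: m_def)
  have cont: "continuous_on {0..} q" "continuous_on {0..} \<psi>" "continuous_on {0..} P"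
    by (auto intro!: DERIV_continuous_on dq d\<psi> dP)
  have cm: "continuous_on {0..} m" unfolding m_def by (intro continuous_intros cont)
  \<comment> \<open>An integrating factor for the fast equation.\<close>
  define G where "G = (\<lambda>x. slope x * exp (- s * x))"
  have G0: "0 < G x" if "x \<ge> 0" for x using slope_pos[OF that] by (simp add: G_def)
  have dG: "((\<lambda>x. G x * T x) has_real_derivative G x * (T' - (s + N x) * T x)) (at x within {0..})"
    if "x \<ge> 0" "(T has_real_derivative T') (at x within {0..})" for T T' x
    unfolding G_def using that(1)
    by (auto intro!: derivative_eq_intros slope_deriv that simp: algebra_simps)
  have pos: "0 < m x" if x: "x \<ge> 0" for x
  proof (rule ccontr)
    assume neg: "\<not> 0 < m x"
    define x1 where "x1 = max x X"
    have x1: "x \<le> x1" "0 < m x1" using X by (auto simp: x1_def m_iff)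
    obtain a where a: "0 \<le> a" "a < x1" "m a \<le> 0" "\<And>y. a < y \<Longrightarrow> y \<le> x1 \<Longrightarrow> 0 < m y"
      using continuous_nonpositive_last[OF cm x _ x1] neg by (metis not_le)
    have "- q a \<le> - q x1"
    proof (rule nondecreasing_interval[where E = "\<lambda>x. - q x" and D = "\<lambda>x. - \<psi> x"])
      show "0 \<le> - \<psi> y" if "a < y" "y < x1" for y using a(4)[of y] that by (simp add: m_iff)
    qed (use a in \<open>auto intro!: DERIV_minus dq\<close>)
    moreover have "\<psi> a \<le> \<psi> x1"
    proof (rule nondecreasing_interval[where E = \<psi> and D = "\<lambda>x. vh x * P x"])
      show "0 \<le> vh y * P y" if "a < y" "y < x1" for y
        using a(4)[of y] that profile_range(3)[of y] a(1) by (simp add: m_iff)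
    qed (use a in \<open>auto intro!: d\<psi>\<close>)
    moreover have "- (G a * P a) \<le> - (G x1 * P x1)"
    proof (rule nondecreasing_interval[where E = "\<lambda>x. - (G x * P x)" and D = "\<lambda>x. - (G x * ((s + N x) * P x + 2 * s * \<psi> x - s\<^sup>2 * q x - (s + N x) * P x))"])
      show "0 \<le> - (G y * ((s + N y) * P y + 2 * s * \<psi> y - s\<^sup>2 * q y - (s + N y) * P y))" if "a < y" "y < x1" for y
      proof -
        have "2 * s * \<psi> y \<le> 0" "0 \<le> s\<^sup>2 * q y"
          using a(4)[of y] that s by (auto simp: m_iff mult_nonneg_nonpos)
        then have "G y * (2 * s * \<psi> y - s\<^sup>2 * q y) \<le> 0"
          using G0[of y] that a(1) by (intro mult_nonneg_nonpos) auto
        then show ?thesis by simp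
      qed
      show "((\<lambda>x. - (G x * P x)) has_real_derivative - (G y * ((s + N y) * P y + 2 * s * \<psi> y - s\<^sup>2 * q y - (s + N y) * P y))) (at y within {0..})"
        if "0 \<le> y" for y
        by (intro DERIV_minus dG dP that)
    qed (use a in auto)
    moreover have "0 < G x1 * P x1" using G0[of x1] x1 a by (simp add: m_iff)
    ultimately have "q x1 \<le> q a" "\<psi> a \<le> \<psi> x1" "0 < G a * P a" by linarith+
    moreover have "0 < G a" using G0 a by simp
    ultimately have "0 < m a"
      using x1(2) zero_less_mult_pos[of "G a" "P a"] unfolding m_iff by auto
    then show False using a(3) by simp
  qed
  have sg: "0 < q x" "\<psi> x < 0" "0 < P x" if "x \<ge> 0" for x using pos[OF that] by (auto simp: m_iff)
  have decay: "(w \<longlongrightarrow> 0) at_top" if "((\<lambda>x. exp (t * x) * w x) \<longlongrightarrow> c) at_top" for w :: "real \<Rightarrow> real" and c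
  proof -
    have "((\<lambda>x. exp (- (t * x))) \<longlongrightarrow> 0) at_top"
      using t by (intro filterlim_compose[OF exp_at_bot] filterlim_compose[OF filterlim_uminus_at_bot_at_top]
          filterlim_tendsto_pos_mult_at_top[OF tendsto_const] filterlim_ident)
    from tendsto_mult[OF this that] show ?thesis by (simp add: mult.assoc[symmetric] exp_minus)
  qed
  note l0 = decay[OF lq] decay[OF l\<psi>] decay[OF lP]
  have v00: "vp \<le> vh x" if "x \<ge> 0" for x using profile_range(1)[OF that] .
  \<comment> \<open>The coefficients 4 s and 2 s^2 make T a subsolution of the homogeneous fast equation.\<close>
  have P0: "P 0 \<le> 4 * s * (- \<psi> 0) + 2 * s\<^sup>2 * q 0"
  proof -
    define T where "T = (\<lambda>x. P x + 4 * s * \<psi> x - 2 * s\<^sup>2 * q x)"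
    define T' where "T' = (\<lambda>x. ((s + N x) * P x + 2 * s * \<psi> x - s\<^sup>2 * q x) + 4 * s * (vh x * P x) - 2 * s\<^sup>2 * \<psi> x)"
    have dT: "(T has_real_derivative T' x) (at x within {0..})" if "x \<ge> 0" for x
      unfolding T_def T'_def by (intro DERIV_add DERIV_diff DERIV_cmult dP d\<psi> dq that)
    have "G 0 * T 0 \<le> 0"
    proof (rule nondecreasing_to_zero[OF dG[OF _ dT], where x = 0])
      fix x :: real assume x: "x \<ge> 0"
      have "T' x - (s + N x) * T x = 4 * s * (vh x * P x) + (2 * s - 2 * s\<^sup>2 - (s + N x) * (4 * s)) * \<psi> x
          + ((s + N x) * (2 * s\<^sup>2) - s\<^sup>2) * q x"
        by (simp add: T_def T'_def algebra_simps)
      moreover have "0 \<le> 4 * s * (vh x * P x)" using s sg[OF x] profile_range(3)[OF x] by simp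
      moreover have "0 \<le> (2 * s - 2 * s\<^sup>2 - (s + N x) * (4 * s)) * \<psi> x"
      proof (rule mult_nonpos_nonpos)
        have "3/4 * (4 * s) \<le> (s + N x) * (4 * s)" using N_bounds(1)[OF x] s by (intro mult_right_mono) auto
        moreover have "2 * s - 2 * s\<^sup>2 - X \<le> 0" if "3/4 * (4 * s) \<le> X" for X
          using that s zero_le_power2[of s] by linarith
        ultimately show "2 * s - 2 * s\<^sup>2 - (s + N x) * (4 * s) \<le> 0" by blast
      qed (use sg[OF x] in auto)
      moreover have "0 \<le> ((s + N x) * (2 * s\<^sup>2) - s\<^sup>2) * q x"
      proof (rule mult_nonneg_nonneg)
        have "1/2 * (2 * s\<^sup>2) \<le> (s + N x) * (2 * s\<^sup>2)" using N_bounds(1)[OF x] s by (intro mult_right_mono) auto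
        then show "0 \<le> (s + N x) * (2 * s\<^sup>2) - s\<^sup>2" by simp
      qed (use sg[OF x] in auto)
      ultimately show "0 \<le> G x * (T' x - (s + N x) * T x)" using G0[OF x] by simp
    next
      have "(T \<longlongrightarrow> 0 + 4 * s * 0 - 2 * s\<^sup>2 * 0) at_top" unfolding T_def by (intro tendsto_intros l0)
      then have lT: "(T \<longlongrightarrow> 0) at_top" by simp
      show "((\<lambda>x. G x * T x) \<longlongrightarrow> 0) at_top"
      proof (rule Lim_null_comparison[OF _ tendsto_norm_zero[OF lT]])
        show "\<forall>\<^sub>F x in at_top. norm (G x * T x) \<le> norm (T x)"
          using eventually_ge_at_top[of 0]
        proof eventually_elim
          fix x :: real assume x: "0 \<le> x"
          have "G x \<le> 1 * 1"
            unfolding G_def using slope_le_vh[OF x] slope_pos[OF x] profile_range(2)[OF x] v0_le s x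
            by (intro mult_mono) auto
          then show "norm (G x * T x) \<le> norm (T x)"
            using G0[OF x] by (simp add: abs_mult mult_left_le_one_le)
        qed
      qed
    qed auto
    then have "T 0 \<le> 0" using G0[of 0] by (simp add: mult_le_0_iff)
    then show ?thesis by (simp add: T_def)
  qed
  define \<kappa> where "\<kappa> = (s + C) / vp"
  have \<kappa>: "0 \<le> \<kappa>" "\<kappa> \<le> (1 + C) / vp" "\<kappa> * vp = s + C"
    using s C_ge vp_pos by (auto simp: \<kappa>_def intro: divide_right_mono)
  \<comment> \<open>The multiple \<kappa> is chosen so that \<kappa> * vh dominates s + N.\<close>
  have q0: "2 * s * q 0 \<le> P 0 + \<kappa> * (- \<psi> 0)"
  proof -
    have "- (P 0 - 2 * s * q 0 - \<kappa> * \<psi> 0) \<le> 0"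
    proof (rule nondecreasing_to_zero[where E = "\<lambda>x. - (P x - 2 * s * q x - \<kappa> * \<psi> x)"])
      fix x :: real assume x: "x \<ge> 0"
      show "((\<lambda>x. - (P x - 2 * s * q x - \<kappa> * \<psi> x)) has_real_derivative
          - (((s + N x) * P x + 2 * s * \<psi> x - s\<^sup>2 * q x) - 2 * s * \<psi> x - \<kappa> * (vh x * P x))) (at x within {0..})"
        by (intro DERIV_minus DERIV_diff DERIV_cmult dP d\<psi> dq x)
      have "\<kappa> * vp \<le> \<kappa> * vh x" using \<kappa> v00[OF x] by (intro mult_left_mono) auto
      then have "(s + N x) * P x \<le> (\<kappa> * vh x) * P x"
        using \<kappa> N_bounds(2)[OF x] sg[OF x] by (intro mult_right_mono) auto
      moreover have "0 \<le> s\<^sup>2 * q x" using sg[OF x] by simp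
      ultimately show "0 \<le> - (((s + N x) * P x + 2 * s * \<psi> x - s\<^sup>2 * q x) - 2 * s * \<psi> x - \<kappa> * (vh x * P x))"
        by simp
    next
      have "((\<lambda>x. - (P x - 2 * s * q x - \<kappa> * \<psi> x)) \<longlongrightarrow> - (0 - 2 * s * 0 - \<kappa> * 0)) at_top"
        by (intro tendsto_intros l0)
      then show "((\<lambda>x. - (P x - 2 * s * q x - \<kappa> * \<psi> x)) \<longlongrightarrow> 0) at_top" by simp
    qed simp
    then show ?thesis by simp
  qed
  define Z where "Z = - \<psi> 0"
  have Z0: "0 < Z" using sg[of 0] by (simp add: Z_def)
  have sq0: "s * q 0 \<le> (1 + \<kappa>) * Z"
  proof -
    have "s * (s * q 0) \<le> 1/4 * (s * q 0)" using s sg[of 0] by (intro mult_right_mono) auto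
    moreover have "s * Z \<le> 1/4 * Z" using s Z0 by (intro mult_right_mono) auto
    ultimately show ?thesis using P0 q0 sg(1)[of 0] mult_pos_pos[OF s(1) sg(1)[of 0]]
      by (simp add: Z_def power2_eq_square algebra_simps)
  qed
  have P0': "P 0 \<le> (2 + \<kappa>) * Z"
  proof -
    have "s * (s * q 0) \<le> 1/4 * ((1 + \<kappa>) * Z)"
      by (rule mult_mono[OF s(2) sq0]) (use s sg[of 0] in auto)
    moreover have "s * Z \<le> 1/4 * Z" using s Z0 by (intro mult_right_mono) auto
    ultimately have "4 * (s * Z) + 2 * (s * (s * q 0)) \<le> 4 * (1/4 * Z) + 2 * (1/4 * ((1 + \<kappa>) * Z))"
      by (intro add_mono mult_left_mono) auto
    also have "\<dots> \<le> (2 + \<kappa>) * Z"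
      using mult_nonneg_nonneg[OF \<kappa>(1) less_imp_le[OF Z0]] Z0 by (simp add: algebra_simps)
    finally show ?thesis using P0 by (simp add: Z_def power2_eq_square)
  qed
  \<comment> \<open>The left eigenvector is (s^2 / t, - l2, 1).\<close>
  define l2 where "l2 = (t + s + rate vp) / vp"
  have l2: "l2 * vp = t + s + rate vp" "0 < l2" using vp_pos t s n by (auto simp: l2_def)
  have l2': "s\<^sup>2 / t + 2 * s = t * l2"
    using root t vp_pos by (simp add: l2_def field_simps power2_eq_square)
  define L where "L = (\<lambda>x. s\<^sup>2 / t * (exp (t * x) * q x) + - l2 * (exp (t * x) * \<psi> x) + exp (t * x) * P x)"
  have "- L 0 \<le> - (s\<^sup>2 / t * (1 / t) + - l2 * (- 1) + t / vp)"
  proof (rule tendsto_lowerbound)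
    show "((\<lambda>x. - L x) \<longlongrightarrow> - (s\<^sup>2 / t * (1 / t) + - l2 * (- 1) + t / vp)) at_top"
      unfolding L_def by (intro tendsto_intros lq l\<psi> lP)
    have "- L 0 \<le> - L x" if "x \<ge> 0" for x
    proof (rule nondecreasing_halfline[where E = "\<lambda>x. - L x"])
      fix y :: real assume y: "y \<ge> 0"
      show "((\<lambda>x. - L x) has_real_derivative exp (t * y) * ((l2 * (vh y - vp) + (rate vp - N y)) * P y)) (at y within {0..})"
      proof -
        have "((\<lambda>x. - L x) has_real_derivative
          - (s\<^sup>2 / t * (exp (t * y) * (t * q y + \<psi> y)) + - l2 * (exp (t * y) * (t * \<psi> y + vh y * P y))
             + exp (t * y) * (t * P y + ((s + N y) * P y + 2 * s * \<psi> y - s\<^sup>2 * q y)))) (at y within {0..})"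
        proof -
          have ex: "((\<lambda>x. exp (t * x) * w x) has_real_derivative exp (t * y) * (t * w y + w')) (at y within {0..})"
            if "(w has_real_derivative w') (at y within {0..})" for w w'
            by (auto intro!: derivative_eq_intros that simp: algebra_simps)
          show ?thesis unfolding L_def by (intro DERIV_minus DERIV_add DERIV_cmult ex dq d\<psi> dP y)
        qed
        moreover have "- (s\<^sup>2 / t * (e * (t * q y + \<psi> y)) + - l2 * (e * (t * \<psi> y + vh y * P y))
             + e * (t * P y + ((s + N y) * P y + 2 * s * \<psi> y - s\<^sup>2 * q y)))
           = e * ((l2 * (vh y - vp) + (rate vp - N y)) * P y)" for e
        proof -
          have "- (s\<^sup>2 / t * (e * (t * q y + \<psi> y)) + - l2 * (e * (t * \<psi> y + vh y * P y))
             + e * (t * P y + ((s + N y) * P y + 2 * s * \<psi> y - s\<^sup>2 * q y)))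
            = e * (l2 * vh y * P y - (t + s + N y) * P y) - e * ((s\<^sup>2 / t + 2 * s - t * l2) * \<psi> y)
              - e * ((s\<^sup>2 / t * t - s\<^sup>2) * q y)"
            by (simp add: algebra_simps)
          also have "\<dots> = e * (l2 * vh y * P y - (t + s + N y) * P y)" using l2' t by simp
          also have "\<dots> = e * ((l2 * vh y - l2 * vp + (rate vp - N y)) * P y)"
            unfolding l2(1) by (simp add: algebra_simps)
          finally show ?thesis by (simp add: algebra_simps)
        qed
        ultimately show ?thesis by simp
      qed
      show "0 \<le> exp (t * y) * ((l2 * (vh y - vp) + (rate vp - N y)) * P y)"
        using l2 v00[OF y] N_bounds(3)[OF y] sg[OF y]
        by (intro mult_nonneg_nonneg add_nonneg_nonneg) auto
    qed (use that in auto)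
    then show "\<forall>\<^sub>F x in at_top. - L 0 \<le> - L x"
      by (rule eventually_mono[OF eventually_ge_at_top[of 0]])
  qed simp
  then have "l2 \<le> s\<^sup>2 / t * q 0 + l2 * Z + P 0"
  proof -
    assume a: "- L 0 \<le> - (s\<^sup>2 / t * (1 / t) + - l2 * (- 1) + t / vp)"
    have "0 \<le> s\<^sup>2 / t * (1 / t)" "0 \<le> t / vp" using t vp_pos by auto
    moreover have "l \<le> L0" if "- L0 \<le> - (u + - l * (- 1) + w)" "0 \<le> u" "0 \<le> w" for l u w L0 :: real
      using that by simp
    ultimately have "l2 \<le> L 0" using a by metis
    then show ?thesis by (simp add: L_def Z_def)
  qed
  also have "s\<^sup>2 / t * q 0 \<le> slow_ratio * ((1 + \<kappa>) * Z)"
  proof -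
    have "(s / t) * (s * q 0) \<le> slow_ratio * ((1 + \<kappa>) * Z)"
      by (rule mult_mono[OF slow_root_bounds(2)[OF s t root] sq0])
        (use s t sg(1)[of 0] C_ge vp_pos in \<open>auto simp: slow_ratio_def\<close>)
    then show ?thesis by (simp add: power2_eq_square)
  qed
  also have "slow_ratio * ((1 + \<kappa>) * Z) \<le> slow_ratio * ((1 + (1 + C) / vp) * Z)"
    using \<kappa> Z0 C_ge vp_pos by (intro mult_left_mono mult_right_mono) (auto simp: slow_ratio_def)
  also have "l2 * Z \<le> (2 + C) / vp * Z"
    unfolding l2_def using slow_root_bounds(1)[OF s t root] s n vp_pos Z0
    by (intro mult_right_mono divide_right_mono) auto
  also have "P 0 \<le> (2 + (1 + C) / vp) * Z"
    using P0' mult_right_mono[of "2 + \<kappa>" "2 + (1 + C) / vp" Z] \<kappa> Z0 by linarith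
  finally have main: "l2 \<le> (slow_ratio * (1 + (1 + C) / vp) + (2 + C) / vp + 2 + (1 + C) / vp) * Z"
    by (simp add: algebra_simps)
  have "3 / (4 * vp) \<le> l2"
    unfolding l2_def using n s t vp_pos by (simp add: field_simps)
  then have "3 / (4 * vp) \<le> (slow_ratio * (1 + (1 + C) / vp) + (2 + C) / vp + 2 + (1 + C) / vp) * Z"
    using main by simp
  moreover have "0 < slow_ratio * (1 + (1 + C) / vp) + (2 + C) / vp + 2 + (1 + C) / vp"
    using C_ge vp_pos by (intro add_pos_pos add_nonneg_pos mult_nonneg_nonneg) (auto simp: slow_ratio_def)
  ultimately show ?thesis
    unfolding low_bound_def Z_def[symmetric] by (simp only: pos_divide_le_eq mult.commute[of Z])
qed

end

section \<open>Zeros of the Evans function\<close>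

lemma adjoint_matrix_mult:
  fixes w :: "complex ^ 3"
  shows "((- conj_transpose (evans_A \<gamma> vp vh x lam)) *v w) $ 1 = - (of_real (vh x) * w $ 3)"
    and "((- conj_transpose (evans_A \<gamma> vp vh x lam)) *v w) $ 2 = - (cnj lam * w $ 1) - of_real (vh x) * w $ 3"
    and "((- conj_transpose (evans_A \<gamma> vp vh x lam)) *v w) $ 3
      = - (cnj lam * w $ 1) - cnj lam * w $ 2 - (of_real (bl_f \<gamma> vp (vh x)) - cnj lam) * w $ 3"
  by (simp_all add: matrix_vector_mult_def conj_transpose_def evans_A_def sum_3)

lemma D_in_eq: "D_in W lam = cnj (W lam 0 $ 1)"
  by (simp add: D_in_def herm_dot_def sum_3)

context inflow_layer
begin

text \<open>The limit matrix is the coefficient matrix of the constant profile \<open>vp\<close>, so statements about one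
  apply to the other.\<close>

lemma evans_A_plus_eq: "evans_A_plus \<gamma> vp vh lam = evans_A \<gamma> vp (\<lambda>_. vp) 0 lam"
proof -
  have f: "((\<lambda>x. bl_f \<gamma> vp (vh x)) \<longlongrightarrow> bl_f \<gamma> vp vp) at_top"
    unfolding bl_f_def by (intro tendsto_intros profile_limit) (use vp_pos in auto)
  have "((\<lambda>x. evans_A \<gamma> vp vh x lam) \<longlongrightarrow> evans_A \<gamma> vp (\<lambda>_. vp) 0 lam) at_top"
  proof (intro vec_tendstoI)
    fix i j :: 3
    have "i = 1 \<or> i = 2 \<or> i = 3" "j = 1 \<or> j = 2 \<or> j = 3" by (rule exhaust_3)+
    then show "((\<lambda>x. evans_A \<gamma> vp vh x lam $ i $ j) \<longlongrightarrow> evans_A \<gamma> vp (\<lambda>_. vp) 0 lam $ i $ j) at_top"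
      by (elim disjE) (auto simp: evans_A_def intro!: tendsto_intros profile_limit f)
  qed
  then show ?thesis unfolding evans_A_plus_def by (intro tendsto_Lim) auto
qed

lemma eigenvector_relations:
  fixes U :: "complex ^ 3"
  assumes eig: "(- conj_transpose (evans_A_plus \<gamma> vp vh lam)) *v U = \<mu> *s U"
    and \<mu>: "\<mu> \<noteq> 0" and U: "U \<noteq> 0"
  shows "U $ 1 \<noteq> 0" "U $ 3 = - (\<mu> / of_real vp) * U $ 1" "U $ 2 = (1 - cnj lam / \<mu>) * U $ 1"
    "\<mu>^3 = (of_real (rate vp) + cnj lam) * \<mu>\<^sup>2 + 2 * cnj lam * of_real vp * \<mu> - (cnj lam)\<^sup>2 * of_real vp"
proof -
  define s where "s = cnj lam"
  have v: "complex_of_real vp \<noteq> 0" using vp_pos by simp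
  have e: "\<mu> * U $ 1 = - (of_real vp * U $ 3)" "\<mu> * U $ 2 = - (s * U $ 1) - of_real vp * U $ 3"
    "\<mu> * U $ 3 = - (s * U $ 1) - s * U $ 2 + (of_real (rate vp) + s) * U $ 3"
    using arg_cong[OF eig, of "\<lambda>w. w $ 1"] arg_cong[OF eig, of "\<lambda>w. w $ 2"] arg_cong[OF eig, of "\<lambda>w. w $ 3"]
    unfolding evans_A_plus_eq adjoint_matrix_mult by (simp_all add: rate_def s_def algebra_simps)
  show U3: "U $ 3 = - (\<mu> / of_real vp) * U $ 1"
    using e(1) v by (simp add: field_simps)
  show U2: "U $ 2 = (1 - cnj lam / \<mu>) * U $ 1"
  proof -
    have "\<mu> * U $ 2 = (\<mu> - s) * U $ 1" using e(1,2) by (simp add: left_diff_distrib)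
    then have "U $ 2 = (\<mu> - s) * U $ 1 / \<mu>" using \<mu> by (simp add: field_simps)
    then show ?thesis using \<mu> by (simp add: s_def diff_divide_distrib left_diff_distrib)
  qed
  show U1: "U $ 1 \<noteq> 0"
  proof
    assume "U $ 1 = 0"
    then have "U $ i = 0" for i using U2 U3 exhaust_3[of i] by auto
    then show False using U by (simp add: vec_eq_iff)
  qed
  have "\<mu> * (\<mu> / of_real vp) = 2 * s - s * (s / \<mu>) + (of_real (rate vp) + s) * (\<mu> / of_real vp)"
  proof -
    have "(\<mu> * (\<mu> / of_real vp)) * U $ 1 = (2 * s - s * (s / \<mu>) + (of_real (rate vp) + s) * (\<mu> / of_real vp)) * U $ 1"
      using e(3) unfolding U3 U2 s_def[symmetric] by (simp add: algebra_simps add_divide_distrib)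
    then show ?thesis by (rule mult_right_cancel[OF U1, THEN iffD1])
  qed
  then show "\<mu>^3 = (of_real (rate vp) + cnj lam) * \<mu>\<^sup>2 + 2 * cnj lam * of_real vp * \<mu> - (cnj lam)\<^sup>2 * of_real vp"
    using v \<mu> unfolding s_def[symmetric] by (simp add: field_simps power2_eq_square power3_eq_cube)
qed

lemma adjoint_components:
  assumes sol: "\<forall>x\<ge>0. (W has_vector_derivative (- conj_transpose (evans_A \<gamma> vp vh x lam)) *v W x) (at x within {0..})"
    and x: "x \<ge> 0"
  shows "((\<lambda>x. W x $ 1) has_vector_derivative - (of_real (vh x) * W x $ 3)) (at x within {0..})"
    and "((\<lambda>x. W x $ 2) has_vector_derivative - (cnj lam * W x $ 1) - of_real (vh x) * W x $ 3) (at x within {0..})"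
    and "((\<lambda>x. W x $ 3) has_vector_derivative
      - (cnj lam * W x $ 1) - cnj lam * W x $ 2 + (of_real (N x) + cnj lam) * W x $ 3) (at x within {0..})"
proof -
  have c: "((\<lambda>x. W x $ i) has_vector_derivative ((- conj_transpose (evans_A \<gamma> vp vh x lam)) *v W x) $ i) (at x within {0..})" for i
    using bounded_linear.has_vector_derivative[OF bounded_linear_vec_nth] sol x by blast
  show "((\<lambda>x. W x $ 1) has_vector_derivative - (of_real (vh x) * W x $ 3)) (at x within {0..})"
    and "((\<lambda>x. W x $ 2) has_vector_derivative - (cnj lam * W x $ 1) - of_real (vh x) * W x $ 3) (at x within {0..})"
    using c[of 1] c[of 2] unfolding adjoint_matrix_mult .
  have "((- conj_transpose (evans_A \<gamma> vp vh x lam)) *v W x) $ 3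
      = - (cnj lam * W x $ 1) - cnj lam * W x $ 2 + (of_real (N x) + cnj lam) * W x $ 3"
    unfolding adjoint_matrix_mult by (simp add: N_def rate_def algebra_simps)
  then show "((\<lambda>x. W x $ 3) has_vector_derivative
      - (cnj lam * W x $ 1) - cnj lam * W x $ 2 + (of_real (N x) + cnj lam) * W x $ 3) (at x within {0..})"
    using c[of 3] by simp
qed

lemma adjoint_decaying_mode:
  assumes sol: "\<forall>x\<ge>0. (W has_vector_derivative (- conj_transpose (evans_A \<gamma> vp vh x lam)) *v W x) (at x within {0..})"
    and asym: "((\<lambda>x. exp (- \<mu> * of_real x) *s W x) \<longlongrightarrow> U) at_top"
    and \<mu>: "Re \<mu> < 0" and lam: "lam \<noteq> 0"
  shows "decaying_mode (cnj lam) (\<lambda>x. (1 / cnj lam) * (W x $ 1 - W x $ 2)) (\<lambda>x. W x $ 1) (\<lambda>x. - (1 / cnj lam) * W x $ 3)"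
proof -
  define s where "s = cnj lam"
  have s0: "s \<noteq> 0" using lam by (simp add: s_def)
  have lim: "((\<lambda>x. W x $ i) \<longlongrightarrow> 0) at_top" for i
  proof -
    have 1: "((\<lambda>x. exp (- \<mu> * of_real x) * W x $ i) \<longlongrightarrow> U $ i) at_top"
      using tendsto_vec_nth[OF asym, of i] by simp
    have 2: "((\<lambda>x. exp (\<mu> * of_real x)) \<longlongrightarrow> 0) at_top"
    proof (rule tendsto_norm_zero_cancel)
      have "((\<lambda>x. exp (- (- Re \<mu> * x))) \<longlongrightarrow> 0) at_top"
        using \<mu> by (intro filterlim_compose[OF exp_at_bot] filterlim_compose[OF filterlim_uminus_at_bot_at_top]
          filterlim_tendsto_pos_mult_at_top[OF tendsto_const] filterlim_ident) auto
      then show "((\<lambda>x. norm (exp (\<mu> * complex_of_real x))) \<longlongrightarrow> 0) at_top" by simp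
    qed
    have "((\<lambda>x. exp (\<mu> * of_real x) * (exp (- \<mu> * of_real x) * W x $ i)) \<longlongrightarrow> 0 * U $ i) at_top"
      by (rule tendsto_mult[OF 2 1])
    then show ?thesis by (simp add: mult.assoc[symmetric] exp_minus)
  qed
  have "((\<lambda>x. (1 / s) * (W x $ 1 - W x $ 2)) \<longlongrightarrow> (1 / s) * (0 - 0)) at_top"
    "((\<lambda>x. - (1 / s) * W x $ 3) \<longlongrightarrow> - (1 / s) * 0) at_top"
    by (intro tendsto_intros lim)+
  moreover have "((\<lambda>x. (1 / s) * (W x $ 1 - W x $ 2)) has_vector_derivative W x $ 1) (at x within {0..})"
    "((\<lambda>x. W x $ 1) has_vector_derivative vh x *\<^sub>R (s * (- (1 / s) * W x $ 3))) (at x within {0..})"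
    "((\<lambda>x. - (1 / s) * W x $ 3) has_vector_derivative
        s * (- (1 / s) * W x $ 3) + N x *\<^sub>R (- (1 / s) * W x $ 3) + 2 *\<^sub>R W x $ 1 - s * ((1 / s) * (W x $ 1 - W x $ 2))) (at x within {0..})"
    if x: "x \<ge> 0" for x
  proof -
    note c = adjoint_components[OF sol x, folded s_def]
    have "(1 / s) * ((- (of_real (vh x) * W x $ 3)) - (- (s * W x $ 1) - of_real (vh x) * W x $ 3)) = W x $ 1"
      using s0 by (simp add: field_simps)
    then show "((\<lambda>x. (1 / s) * (W x $ 1 - W x $ 2)) has_vector_derivative W x $ 1) (at x within {0..})"
      using bounded_linear.has_vector_derivative[OF bounded_linear_mult_right has_vector_derivative_diff[OF c(1,2)], of "1 / s"]
      by simp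
    have "- (of_real (vh x) * W x $ 3) = vh x *\<^sub>R (s * (- (1 / s) * W x $ 3))"
      using s0 by (simp add: scaleR_conv_of_real)
    then show "((\<lambda>x. W x $ 1) has_vector_derivative vh x *\<^sub>R (s * (- (1 / s) * W x $ 3))) (at x within {0..})"
      using c(1) by simp
    have "- (1 / s) * (- (s * W x $ 1) - s * W x $ 2 + (of_real (N x) + s) * W x $ 3)
      = s * (- (1 / s) * W x $ 3) + N x *\<^sub>R (- (1 / s) * W x $ 3) + 2 *\<^sub>R W x $ 1 - s * ((1 / s) * (W x $ 1 - W x $ 2))"
      using s0 by (simp add: scaleR_conv_of_real field_simps)
    then show "((\<lambda>x. - (1 / s) * W x $ 3) has_vector_derivative
        s * (- (1 / s) * W x $ 3) + N x *\<^sub>R (- (1 / s) * W x $ 3) + 2 *\<^sub>R W x $ 1 - s * ((1 / s) * (W x $ 1 - W x $ 2))) (at x within {0..})"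
      using bounded_linear.has_vector_derivative[OF bounded_linear_mult_right c(3), of "- (1 / s)"] by simp
  qed
  ultimately show ?thesis
    unfolding decaying_mode_def s_def[symmetric] using lim[of 1] by simp
qed

text \<open>If \<open>\<psi> 0 = 0\<close>, one of the two energy estimates makes the mode vanish identically, which
  contradicts its asymptotics.\<close>

lemma nonzero_frequency:
  assumes small: "2400 * v0 \<le> 1 / (256 * C\<^sup>2)" "2000000 * v0 \<le> (1 / (128 * M\<^sup>2))\<^sup>2"
    and sol: "\<forall>x\<ge>0. (W has_vector_derivative (- conj_transpose (evans_A \<gamma> vp vh x lam)) *v W x) (at x within {0..})"
    and asym: "((\<lambda>x. exp (- \<mu> * of_real x) *s W x) \<longlongrightarrow> U) at_top"
    and \<mu>: "Re \<mu> < 0" and lam: "Re lam \<ge> 0" "lam \<noteq> 0" and U: "U \<noteq> 0"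
  shows "W 0 $ 1 \<noteq> 0"
proof
  assume bc: "W 0 $ 1 = 0"
  have mode: "decaying_mode (cnj lam) (\<lambda>x. (1 / cnj lam) * (W x $ 1 - W x $ 2)) (\<lambda>x. W x $ 1) (\<lambda>x. - (1 / cnj lam) * W x $ 3)"
    by (rule adjoint_decaying_mode[OF sol asym \<mu> lam(2)])
  have "(1 / cnj lam) * (W x $ 1 - W x $ 2) = 0 \<and> W x $ 1 = 0 \<and> - (1 / cnj lam) * W x $ 3 = 0" if x: "x > 0" for x
  proof (cases "norm (cnj lam) \<le> 256 * C\<^sup>2")
    case True
    show ?thesis by (rule low_frequency_rigidity[OF mode _ _ True small(2) bc x]) (use lam in auto)
  next
    case False
    show ?thesis by (rule high_frequency_rigidity[OF mode _ _ small(1) bc x]) (use lam False in auto)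
  qed
  then have "W x $ i = 0" if "x > 0" for x i
    using that lam exhaust_3[of i] by fastforce
  then have "W x = 0" if "x > 0" for x using that by (simp add: vec_eq_iff)
  then have "\<forall>\<^sub>F x in at_top. exp (- \<mu> * of_real x) *s W x = 0"
    by (intro eventually_mono[OF eventually_gt_at_top[of 0]]) simp
  then have "((\<lambda>x::real. 0) \<longlongrightarrow> U) at_top" by (rule Lim_transform_eventually[OF asym])
  then show False using U by (simp add: tendsto_const_iff)
qed

lemma real_frequency_lower_bound:
  assumes s: "0 < s" "s \<le> 1/4"
    and sol: "\<forall>x\<ge>0. (W has_vector_derivative (- conj_transpose (evans_A \<gamma> vp vh x (of_real s))) *v W x) (at x within {0..})"
    and asym: "((\<lambda>x. exp (- \<mu> * of_real x) *s W x) \<longlongrightarrow> U) at_top"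
    and eig: "(- conj_transpose (evans_A_plus \<gamma> vp vh (of_real s))) *v U = \<mu> *s U"
    and \<mu>: "Re \<mu> < 0" and U: "U \<noteq> 0"
  shows "low_bound * norm (U $ 1) \<le> norm (W 0 $ 1)"
    and "norm (U $ 2) \<le> (1 + slow_ratio) * norm (U $ 1)" "norm (U $ 3) \<le> 1 / vp * norm (U $ 1)"
proof -
  have \<mu>0: "\<mu> \<noteq> 0" using \<mu> by auto
  note rel = eigenvector_relations[OF eig \<mu>0 U, simplified]
  have n: "3/4 \<le> rate vp" using rate_bounds[of vp] vp_less by auto
  define t where "t = - Re \<mu>"
  have t: "0 < t" using \<mu> by (simp add: t_def)
  have "Im \<mu> = 0"
    by (rule cubic_root_real[OF s(1) _ vp_pos \<mu>, of "rate vp"]) (use n rel(4) in auto)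
  then have \<mu>t: "\<mu> = - of_real t" by (simp add: t_def complex_eq_iff)
  have root: "t\<^sup>2 * (t + s + rate vp) = s\<^sup>2 * vp + 2 * s * t * vp"
    using arg_cong[OF rel(4), of Re] unfolding \<mu>t
    by (simp add: power2_eq_square power3_eq_cube algebra_simps)
  have vpc: "complex_of_real vp \<noteq> 0" using vp_pos by simp
  define \<kappa> where "\<kappa> = - 1 / U $ 1"
  have \<kappa>: "\<kappa> * U $ 1 = - 1" using rel(1) by (simp add: \<kappa>_def)
  define q \<psi> P where "q = (\<lambda>x. Re ((1 / of_real s) * (\<kappa> * (W x $ 1 - W x $ 2))))"
    and "\<psi> = (\<lambda>x. Re (\<kappa> * W x $ 1))" and "P = (\<lambda>x. Re (- (\<kappa> * W x $ 3)))"
  note q_\<psi>_P_def = q_def \<psi>_def P_def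
  have Re_deriv: "((\<lambda>x. Re (w x)) has_real_derivative Re w') F" if "(w has_vector_derivative w') F" for w w' F
    using bounded_linear.has_vector_derivative[OF bounded_linear_Re that]
    by (simp add: has_real_derivative_iff_has_vector_derivative)
  have bl: "((\<lambda>x. c * w x) has_vector_derivative c * w') F" if "(w has_vector_derivative w') F" for c :: complex and w w' F
    using bounded_linear.has_vector_derivative[OF bounded_linear_mult_right that] .
  have "low_bound \<le> - \<psi> 0"
  proof (rule real_mode_lower_bound[OF s t root, of q \<psi> P])
    fix x :: real assume x: "x \<ge> 0"
    note c = adjoint_components[OF sol x, unfolded complex_cnj_complex_of_real]
    show "(q has_real_derivative \<psi> x) (at x within {0..})"
    proof -
      have "(1 / of_real s) * (\<kappa> * ((- (of_real (vh x) * W x $ 3)) - (- (of_real s * W x $ 1) - of_real (vh x) * W x $ 3))) = \<kappa> * W x $ 1"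
        using s by (simp add: field_simps)
      with Re_deriv[OF bl[OF bl[OF has_vector_derivative_diff[OF c(1,2)]]], of "1 / of_real s" \<kappa>]
      show ?thesis unfolding q_\<psi>_P_def by simp
    qed
    show "(\<psi> has_real_derivative vh x * P x) (at x within {0..})"
      by (rule DERIV_cong[OF Re_deriv[OF bl[OF c(1)], of \<kappa>, folded q_\<psi>_P_def]])
        (simp add: q_\<psi>_P_def algebra_simps)
    show "(P has_real_derivative (s + N x) * P x + 2 * s * \<psi> x - s\<^sup>2 * q x) (at x within {0..})"
    proof -
      have "- \<kappa> * (- (of_real s * W x $ 1) - of_real s * W x $ 2 + (of_real (N x) + of_real s) * W x $ 3)
        = of_real (s + N x) * (- (\<kappa> * W x $ 3)) + of_real (2 * s) * (\<kappa> * W x $ 1)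
          - of_real (s\<^sup>2) * ((1 / of_real s) * (\<kappa> * (W x $ 1 - W x $ 2)))"
        using s by (simp add: field_simps power2_eq_square)
      moreover have Re_of_real: "Re (of_real r * z) = r * Re z" for r z by simp
      ultimately have "Re (- \<kappa> * (- (of_real s * W x $ 1) - of_real s * W x $ 2 + (of_real (N x) + of_real s) * W x $ 3))
        = (s + N x) * P x + 2 * s * \<psi> x - s\<^sup>2 * q x"
        unfolding q_\<psi>_P_def by (simp only: minus_complex.simps plus_complex.simps Re_of_real)
      with Re_deriv[OF bl[OF c(3)], of "- \<kappa>"] show ?thesis
        unfolding q_\<psi>_P_def(3) by simp
    qed
  next
    have e: "exp (t * x) * Re w = Re (exp (- \<mu> * of_real x) * w)" for x w
    proof -
      have "exp (- \<mu> * of_real x) = of_real (exp (t * x))" by (simp add: \<mu>t exp_of_real[symmetric])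
      then show ?thesis by simp
    qed
    have l: "((\<lambda>x. exp (- \<mu> * of_real x) * W x $ i) \<longlongrightarrow> U $ i) at_top" for i
      using tendsto_vec_nth[OF asym, of i] by simp
    have "((\<lambda>x. Re ((1 / of_real s) * (\<kappa> * (exp (- \<mu> * of_real x) * W x $ 1 - exp (- \<mu> * of_real x) * W x $ 2))))
        \<longlongrightarrow> Re ((1 / of_real s) * (\<kappa> * (U $ 1 - U $ 2)))) at_top"
      by (intro tendsto_intros l)
    moreover have "(1 / of_real s) * (\<kappa> * (U $ 1 - U $ 2)) = of_real (1 / t)"
    proof -
      have "\<kappa> * (U $ 1 - U $ 2) = (\<kappa> * U $ 1) * (of_real s / \<mu>)"
        unfolding rel(3) by (simp add: algebra_simps)
      then show ?thesis using s t unfolding \<kappa> \<mu>t by simp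
    qed
    moreover have "exp (t * x) * q x = Re ((1 / of_real s) * (\<kappa> * (exp (- \<mu> * of_real x) * W x $ 1 - exp (- \<mu> * of_real x) * W x $ 2)))" for x
      unfolding q_def e by (rule arg_cong[of _ _ Re]) (simp add: algebra_simps)
    ultimately show "((\<lambda>x. exp (t * x) * q x) \<longlongrightarrow> 1 / t) at_top" by (simp only: Re_complex_of_real)
    have "((\<lambda>x. Re (\<kappa> * (exp (- \<mu> * of_real x) * W x $ 1))) \<longlongrightarrow> Re (\<kappa> * U $ 1)) at_top"
      by (intro tendsto_intros l)
    moreover have "exp (t * x) * \<psi> x = Re (\<kappa> * (exp (- \<mu> * of_real x) * W x $ 1))" for x
      unfolding \<psi>_def e by (rule arg_cong[of _ _ Re]) (simp add: algebra_simps)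
    moreover have "Re (\<kappa> * U $ 1) = - 1" by (simp only: \<kappa>) simp
    ultimately show "((\<lambda>x. exp (t * x) * \<psi> x) \<longlongrightarrow> - 1) at_top" by (simp only:)
    have "((\<lambda>x. Re (- (\<kappa> * (exp (- \<mu> * of_real x) * W x $ 3)))) \<longlongrightarrow> Re (- (\<kappa> * U $ 3))) at_top"
      by (intro tendsto_intros l)
    moreover have "- (\<kappa> * U $ 3) = of_real (t / vp)"
    proof -
      have "- (\<kappa> * U $ 3) = (\<kappa> * U $ 1) * (\<mu> / of_real vp)" unfolding rel(2) by simp
      then show ?thesis unfolding \<kappa> \<mu>t by simp
    qed
    moreover have "exp (t * x) * P x = Re (- (\<kappa> * (exp (- \<mu> * of_real x) * W x $ 3)))" for x
      unfolding P_def e by (rule arg_cong[of _ _ Re]) (simp add: algebra_simps)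
    ultimately show "((\<lambda>x. exp (t * x) * P x) \<longlongrightarrow> t / vp) at_top" by (simp only: Re_complex_of_real)
  qed
  also have "- \<psi> 0 \<le> norm (\<kappa> * W 0 $ 1)"
    unfolding q_\<psi>_P_def using abs_Re_le_cmod[of "\<kappa> * W 0 $ 1"] by linarith
  also have "norm (\<kappa> * W 0 $ 1) = norm (W 0 $ 1) / norm (U $ 1)"
    by (simp add: \<kappa>_def norm_mult norm_divide)
  finally show "low_bound * norm (U $ 1) \<le> norm (W 0 $ 1)"
    using rel(1) by (simp add: pos_le_divide_eq)
  have "norm (1 - of_real s / \<mu>) \<le> 1 + s / t"
    by (rule order_trans[OF norm_triangle_ineq4]) (use s t in \<open>simp add: \<mu>t norm_divide\<close>)
  also have "\<dots> \<le> 1 + slow_ratio" using slow_root_bounds(2)[OF s t root] by simp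
  finally show "norm (U $ 2) \<le> (1 + slow_ratio) * norm (U $ 1)"
    unfolding rel(3) norm_mult by (rule mult_right_mono) simp
  have "t / vp \<le> 1 / vp" using slow_root_bounds(1)[OF s t root] vp_pos by (simp add: divide_right_mono)
  moreover have "norm (U $ 3) = t / vp * norm (U $ 1)"
    unfolding rel(2) using t vp_pos by (simp add: \<mu>t norm_mult norm_divide)
  ultimately show "norm (U $ 3) \<le> 1 / vp * norm (U $ 1)" by (simp only: mult_right_mono norm_ge_zero)
qed

text \<open>At \<open>lam = 0\<close> the adjoint solution is only known as a limit, and the limit may be taken along
  positive reals. There the uniform lower bound passes to the limit; it would force \<open>V 0\<close> to have
  vanishing first component, and the remaining components are controlled by the first one.\<close>

lemma zero_frequency:
  assumes mode: "inflow_adjoint_mode \<gamma> vp vh \<mu> V W"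
  shows "W 0 0 $ 1 \<noteq> 0"
proof
  assume z: "W 0 0 $ 1 = 0"
  note m = mode[unfolded inflow_adjoint_mode_def]
  \<comment> \<open>The positive real axis approaches the origin within the closed right half-plane.\<close>
  have line: "filterlim complex_of_real (at 0 within {lam. Re lam \<ge> 0}) (at_right 0)"
    unfolding filterlim_at
    by (intro conjI tendsto_eq_intros) (auto simp: eventually_at_filter intro!: eventually_mono[OF eventually_True] tendsto_of_real tendsto_ident_at)
  have "((\<lambda>lam. W lam 0) \<longlongrightarrow> W 0 0) (at 0 within {lam. Re lam \<ge> 0})" using m by auto
  from filterlim_compose[OF this line] have "((\<lambda>r. W (of_real r) 0) \<longlongrightarrow> W 0 0) (at_right 0)" by simp
  from tendsto_norm[OF tendsto_vec_nth[OF this, of 1]] have w: "((\<lambda>r. norm (W (of_real r) 0 $ 1)) \<longlongrightarrow> 0) (at_right 0)"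
    using z by simp
  have V: "((\<lambda>r. norm (V (of_real r) $ i)) \<longlongrightarrow> norm (V 0 $ i)) (at_right 0)" for i
  proof -
    have "(\<lambda>z. V (cnj z) $ i) analytic_on {z. Re z \<ge> 0}" using m by auto
    then have "isCont (\<lambda>z. V (cnj z) $ i) 0"
      by (metis analytic_at_imp_isCont analytic_on_analytic_at complex.sel(1) mem_Collect_eq order_refl zero_complex.sel(1))
    then have "((\<lambda>z. V (cnj z) $ i) \<longlongrightarrow> V (cnj 0) $ i) (at 0)" by (simp add: isCont_def)
    moreover have "filterlim complex_of_real (at 0) (at_right 0)"
      using line by (rule filterlim_mono) (auto simp: at_le)
    ultimately have "((\<lambda>r. V (cnj (of_real r)) $ i) \<longlongrightarrow> V (cnj 0) $ i) (at_right 0)"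
      by (rule filterlim_compose)
    from tendsto_norm[OF this] show ?thesis by simp
  qed
  have ev: "\<forall>\<^sub>F r in at_right 0. low_bound * norm (V (of_real r) $ 1) \<le> norm (W (of_real r) 0 $ 1)
      \<and> norm (V (of_real r) $ 2) \<le> (1 + slow_ratio) * norm (V (of_real r) $ 1)
      \<and> norm (V (of_real r) $ 3) \<le> 1 / vp * norm (V (of_real r) $ 1)"
    unfolding eventually_at_right_field
  proof (intro exI[of _ "1/4"] conjI allI impI)
    fix r :: real assume r: "0 < r" "r < 1/4"
    have lam: "0 \<le> Re (of_real r)" "complex_of_real r \<noteq> 0" using r by auto
    note f = real_frequency_lower_bound[of r "W (of_real r)" "\<mu> (of_real r)" "V (of_real r)"]
    show "low_bound * norm (V (of_real r) $ 1) \<le> norm (W (of_real r) 0 $ 1)"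
      and "norm (V (of_real r) $ 2) \<le> (1 + slow_ratio) * norm (V (of_real r) $ 1)"
      and "norm (V (of_real r) $ 3) \<le> 1 / vp * norm (V (of_real r) $ 1)"
      using f r lam m by auto
  qed simp
  have "low_bound * norm (V 0 $ 1) \<le> 0"
    by (rule tendsto_le[OF _ w tendsto_mult[OF tendsto_const V]]) (use ev in \<open>auto elim: eventually_mono\<close>)
  then have V1: "V 0 $ 1 = 0" using low_bound_pos by (simp add: mult_le_0_iff)
  have "norm (V 0 $ 2) \<le> (1 + slow_ratio) * norm (V 0 $ 1)"
    by (rule tendsto_le[OF _ tendsto_mult[OF tendsto_const V] V]) (use ev in \<open>auto elim: eventually_mono\<close>)
  moreover have "norm (V 0 $ 3) \<le> 1 / vp * norm (V 0 $ 1)"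
    by (rule tendsto_le[OF _ tendsto_mult[OF tendsto_const V] V]) (use ev in \<open>auto elim: eventually_mono\<close>)
  ultimately have "V 0 $ i = 0" for i using V1 exhaust_3[of i] by auto
  then have "V 0 = 0" by (simp add: vec_eq_iff)
  then show False using m by auto
qed

lemma stable_if_small:
  assumes small: "2400 * v0 \<le> 1 / (256 * C\<^sup>2)" "2000000 * v0 \<le> (1 / (128 * M\<^sup>2))\<^sup>2"
    and mode: "inflow_adjoint_mode \<gamma> vp vh \<mu> V W" and lam: "Re lam \<ge> 0"
  shows "D_in W lam \<noteq> 0"
proof (cases "lam = 0")
  case True
  then show ?thesis using zero_frequency[OF mode] by (simp add: D_in_eq)
next
  case False
  have "W lam 0 $ 1 \<noteq> 0"
    by (rule nonzero_frequency[OF small, of "W lam" lam "\<mu> lam" "V lam"])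
      (use mode lam False in \<open>auto simp: inflow_adjoint_mode_def\<close>)
  then show ?thesis by (simp add: D_in_eq)
qed

end

theorem theorem3p4:
  fixes \<gamma> :: real
  assumes "\<gamma> \<ge> 1"
  shows "\<exists>\<epsilon>>0. \<forall>v0 vp :: real. 0 < vp \<and> vp < v0 \<and> v0 < \<epsilon> \<and> v0 < 1 \<longrightarrow>
           inflow_spectrally_stable \<gamma> v0 vp"
proof -
  define c where "c = \<gamma> + 1"
  define m where "m = 256 * c\<^sup>2 + c + 2"
  \<comment> \<open>The second bound is that of the high-frequency, the third that of the low-frequency estimate.\<close>
  define \<epsilon> where "\<epsilon> = min (1/8) (min (1 / (256 * c\<^sup>2) / 2400) ((1 / (128 * m\<^sup>2))\<^sup>2 / 2000000))"
  have "0 < c" using assms by (simp add: c_def)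
  moreover have "0 < m" using calculation by (simp add: m_def add_pos_pos)
  ultimately have "0 < \<epsilon>" by (simp add: \<epsilon>_def)
  moreover have "inflow_spectrally_stable \<gamma> v0 vp" if h: "0 < vp" "vp < v0" "v0 < \<epsilon>" for v0 vp
    unfolding inflow_spectrally_stable_def
  proof (intro allI impI)
    fix vh \<mu> V W lam
    assume A: "compressive_inflow_profile \<gamma> v0 vp vh \<and> inflow_adjoint_mode \<gamma> vp vh \<mu> V W" and lam: "0 \<le> Re lam"
    interpret inflow_layer \<gamma> vp v0 vh
      by unfold_locales (use assms h A in \<open>auto simp: \<epsilon>_def\<close>)
    have "2400 * v0 \<le> 1 / (256 * C\<^sup>2)" "2000000 * v0 \<le> (1 / (128 * M\<^sup>2))\<^sup>2"
      using h(3) unfolding \<epsilon>_def m_def c_def M_def C_def by auto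
    then show "D_in W lam \<noteq> 0" by (rule stable_if_small) (use A lam in auto)
  qed
  ultimately show ?thesis by blast
qed

end
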